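(* Let $\Gamma$ be an ordinary subgraph of $\mathcal R$ such that for some $i\ge a_\Gamma$ the number of vertices of $\Gamma$ in row $i+1$ is greater than the number in row $i$. Then $\psi_\Gamma(b_1,\ldots,b_{l_\Gamma})=0$ for all integers $b_1\ge\cdots\ge b_{l_\Gamma}$.
   Context: $\mathcal R$: graph with vertex set $\mathbb Z^2$, row $i=\{(i,j)\}$, edges joining $(i,j)$ to its upper neighbours $(i-1,j)$ and $(i-1,j+1)$. Ordinary subgraph $\Gamma$: finite connected full subgraph such that $(i,j),(i,j+1)\in\Gamma\Rightarrow(i+1,j)\in\Gamma$, and, with $a_\Gamma$ the top row of $\Gamma$, for $i>a_\Gamma$: $(i,j),(i,j+1)\in\Gamma\Rightarrow(i-1,j+1)\in\Gamma$. $l_\Gamma$ = number of vertices of $\Gamma$ in row $a_\Gamma$. $D_\Gamma(b_1,\ldots,b_{l_\Gamma})$: real arrays $(s_{i,j})$ vanishing off $\Gamma$, with row $a_\Gamma$ entries $b_1,\ldots,b_{l_\Gamma}$ left to right, and $s_{i-1,j}\ge s_{i,j}\ge s_{i-1,j+1}$ whenever the relevant vertices are in $\Gamma$ (a finite-dimensional rational polyhedron). For a face $f$, $\Delta_f$ is the subgraph of $\Gamma$ with all vertices of $\Gamma$ and those edges whose two coordinates are equal at a point whose minimal face is $f$. $\varphi_\Gamma(b_1,\ldots,b_{l_\Gamma})(f)=\prod_{l\ge1}(1-t^l)^{d_l}$, where $d_l$ is the number of pairs $(E,i)$ with $E$ a connected component of $\Delta_f$ and $i>a_\Gamma$ such that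 $E$ has exactly $l-1$ vertices in row $i-1$ and $l$ vertices in row $i$. For a face-weight $\varphi$ on a rational polyhedron $P$, with $g(x)=\varphi(\text{minimal face containing }x)$, $S_\varphi(P)=\sum_{a\in P\cap\mathbb Z^{(\mathbb Z^2)}}g(a)e^a$ where $e^a=\prod t_{i,j}^{a_{i,j}}$, and $\sigma_\varphi(P)=QS_\varphi(P)/Q$ is the weighted integer point transform (rational function in the $t_{i,j}$ over $\mathbb Z[t]$; $Q$ any nonzero Laurent polynomial making $QS_\varphi(P)$ a Laurent polynomial). $F$ is the specialization $t_{i,j}\mapsto x_i^{-1}x_{i+1}$, and $\psi_\Gamma(b_1,\ldots,b_{l_\Gamma})=F\big(\sigma_{\varphi_\Gamma(b_1,\ldots,b_{l_\Gamma})}(D_\Gamma(b_1,\ldots,b_{l_\Gamma}))\big)$, a well-defined rational function in the $x_i$. *)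

theory Defs
  imports
    "HOL-Analysis.Polytope"
    "HOL-Analysis.Finite_Function_Topology"
    "HOL-Library.Product_Lexorder"
    "HOL-Computational_Algebra.Polynomial"
    "HOL-Computational_Algebra.Fraction_Field"
begin

text \<open>
  \<^theory>\<open>HOL-Library.Product_Lexorder\<close> serves only to make the rings of Laurent polynomials below
  instances of \<^class>\<open>idom\<close>. It is incompatible with the componentwise order on pairs that
  the theory \<open>HOL-Analysis.Analysis\<close> loads.
\<close>

section \<open>Ordinary subgraphs\<close>

type_synonym vertex = "int \<times> int"

definition R_edges :: "(vertex \<times> vertex) set" where
  "R_edges = (let U = {((i, j), (i', j')). i' = i - 1 \<and> (j' = j \<or> j' = j + 1)} in U \<union> U\<inverse>)"

text \<open>
  A full subgraph is given by its vertex set; a general subgraph by its vertex set and its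
  symmetric set of edges.
\<close>

definition full_edges :: "vertex set \<Rightarrow> (vertex \<times> vertex) set" where
  "full_edges \<Gamma> = R_edges \<inter> \<Gamma> \<times> \<Gamma>"

definition components :: "vertex set \<Rightarrow> (vertex \<times> vertex) set \<Rightarrow> vertex set set" where
  "components V E = V // (E\<^sup>* \<inter> V \<times> V)"

definition row :: "vertex set \<Rightarrow> int \<Rightarrow> vertex set" where
  "row \<Gamma> i = {v \<in> \<Gamma>. fst v = i}"

text \<open>Upper neighbours have the smaller row index, so the top row is the minimal one.\<close>

definition top_row :: "vertex set \<Rightarrow> int" where
  "top_row \<Gamma> = Min (fst ` \<Gamma>)"

definition top_length :: "vertex set \<Rightarrow> nat" where
  "top_length \<Gamma> = card (row \<Gamma> (top_row \<Gamma>))"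

definition ordinary :: "vertex set \<Rightarrow> bool" where
  "ordinary \<Gamma> \<longleftrightarrow>
     finite \<Gamma> \<and> \<Gamma> \<noteq> {} \<and>
     (\<forall>u\<in>\<Gamma>. \<forall>v\<in>\<Gamma>. (u, v) \<in> (full_edges \<Gamma>)\<^sup>*) \<and>
     (\<forall>i j. (i, j) \<in> \<Gamma> \<and> (i, j + 1) \<in> \<Gamma> \<longrightarrow> (i + 1, j) \<in> \<Gamma>) \<and>
     (\<forall>i j. i > top_row \<Gamma> \<and> (i, j) \<in> \<Gamma> \<and> (i, j + 1) \<in> \<Gamma> \<longrightarrow> (i - 1, j + 1) \<in> \<Gamma>)"

section \<open>The polyhedron and its face weight\<close>

type_synonym array = "vertex \<Rightarrow>\<^sub>0 real"

definition D_poly :: "vertex set \<Rightarrow> real list \<Rightarrow> array set" where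
  "D_poly \<Gamma> bs = {s.
     (\<forall>v. v \<notin> \<Gamma> \<longrightarrow> Poly_Mapping.lookup s v = 0) \<and>
     map (\<lambda>j. Poly_Mapping.lookup s (top_row \<Gamma>, j)) (sorted_list_of_set {j. (top_row \<Gamma>, j) \<in> \<Gamma>}) = bs \<and>
     (\<forall>i j. (i - 1, j) \<in> \<Gamma> \<and> (i, j) \<in> \<Gamma> \<longrightarrow> Poly_Mapping.lookup s (i - 1, j) \<ge> Poly_Mapping.lookup s (i, j)) \<and>
     (\<forall>i j. (i, j) \<in> \<Gamma> \<and> (i - 1, j + 1) \<in> \<Gamma> \<longrightarrow> Poly_Mapping.lookup s (i, j) \<ge> Poly_Mapping.lookup s (i - 1, j + 1))}"

definition minimal_face :: "'a::real_vector set \<Rightarrow> 'a \<Rightarrow> 'a set" where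
  "minimal_face P x = \<Inter>{f. f face_of P \<and> x \<in> f}"

definition Delta_edges :: "vertex set \<Rightarrow> real list \<Rightarrow> array set \<Rightarrow> (vertex \<times> vertex) set" where
  "Delta_edges \<Gamma> bs f = {(u, v) \<in> full_edges \<Gamma>.
     \<exists>s \<in> D_poly \<Gamma> bs. minimal_face (D_poly \<Gamma> bs) s = f \<and> Poly_Mapping.lookup s u = Poly_Mapping.lookup s v}"

definition d_count :: "vertex set \<Rightarrow> real list \<Rightarrow> array set \<Rightarrow> nat \<Rightarrow> nat" where
  "d_count \<Gamma> bs f l = card {(E, i).
     E \<in> components \<Gamma> (Delta_edges \<Gamma> bs f) \<and> i > top_row \<Gamma> \<and>
     card (row E (i - 1)) = l - 1 \<and> card (row E i) = l}"

text \<open>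
  The weight lies in \<open>\<int>[t]\<close>, with \<open>t\<close> the variable of \<^typ>\<open>int poly\<close>. The product over all
  \<open>l \<ge> 1\<close> stops at \<open>card \<Gamma>\<close>, beyond which the exponents vanish.
\<close>

definition face_weight :: "vertex set \<Rightarrow> real list \<Rightarrow> array set \<Rightarrow> int poly" where
  "face_weight \<Gamma> bs f = (\<Prod>l = 1..card \<Gamma>. (1 - monom 1 l) ^ d_count \<Gamma> bs f l)"

section \<open>Weighted integer point transforms\<close>

text \<open>
  \<open>'v laurent\<close> is the ring of Laurent polynomials over \<open>\<int>[t]\<close> in variables indexed by \<open>'v\<close>:
  finitely supported functions on the group of exponents, with convolution as product.
  Formal Laurent series, infinite in all directions, are arbitrary functions on the exponents;
  they form a module over the Laurent polynomials.
\<close>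

type_synonym 'v laurent = "('v \<Rightarrow>\<^sub>0 int) \<Rightarrow>\<^sub>0 int poly"
type_synonym 'v series = "('v \<Rightarrow>\<^sub>0 int) \<Rightarrow> int poly"

definition laurent_times_series :: "'v laurent \<Rightarrow> 'v series \<Rightarrow> 'v series" where
  "laurent_times_series Q S = (\<lambda>a. \<Sum>m\<in>Poly_Mapping.keys Q. Poly_Mapping.lookup Q m * S (a - m))"

definition weighted_series :: "(array set \<Rightarrow> int poly) \<Rightarrow> array set \<Rightarrow> vertex series" where
  "weighted_series \<phi> P = (\<lambda>a.
     let x = Poly_Mapping.map real_of_int a in if x \<in> P then \<phi> (minimal_face P x) else 0)"

definition weighted_ipt :: "(array set \<Rightarrow> int poly) \<Rightarrow> array set \<Rightarrow> vertex laurent fract" where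
  "weighted_ipt \<phi> P = (THE r. \<exists>Q p. Q \<noteq> 0 \<and>
     laurent_times_series Q (weighted_series \<phi> P) = Poly_Mapping.lookup p \<and> r = Fract p Q)"

section \<open>The specialization\<close>

definition F_exponent :: "(vertex \<Rightarrow>\<^sub>0 int) \<Rightarrow> (int \<Rightarrow>\<^sub>0 int)" where
  "F_exponent a = (\<Sum>(i, j)\<in>Poly_Mapping.keys a.
     Poly_Mapping.single (i + 1) (Poly_Mapping.lookup a (i, j)) - Poly_Mapping.single i (Poly_Mapping.lookup a (i, j)))"

definition F_laurent :: "vertex laurent \<Rightarrow> int laurent" where
  "F_laurent p = (\<Sum>a\<in>Poly_Mapping.keys p. Poly_Mapping.single (F_exponent a) (Poly_Mapping.lookup p a))"

text \<open>
  The substitution \<open>t\<^sub>i\<^sub>,\<^sub>j \<mapsto> x\<^sub>i\<^sup>-\<^sup>1 x\<^sub>i\<^sub>+\<^sub>1\<close> is not injective on Laurent polynomials, so it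
  applies to those rational functions that have a denominator it does not annihilate; the value
  does not depend on the fraction chosen.
\<close>

definition F_spec :: "vertex laurent fract \<Rightarrow> int laurent fract" where
  "F_spec r = (THE y. \<exists>p q. F_laurent q \<noteq> 0 \<and> r = Fract p q \<and>
     y = Fract (F_laurent p) (F_laurent q))"

definition psi :: "vertex set \<Rightarrow> int list \<Rightarrow> int laurent fract" where
  "psi \<Gamma> bs = (let b = map real_of_int bs in
     F_spec (weighted_ipt (face_weight \<Gamma> b) (D_poly \<Gamma> b)))"

end

theory Submission
  imports Defs
begin

text \<open>
  Along the specialization an array contributes a monomial that depends only on its row sums, and
  its weight is a product over pairs of consecutive rows: the factor \<open>1 - t ^ m\<close> occurs for every
  value taken \<open>m\<close> times in the lower and \<open>m - 1\<close> times in the upper row. Summing over one row with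
  its two neighbours fixed is therefore a transfer matrix computation along the values, and a
  Yang--Baxter relation shows that this sum does not change, up to a constant factor, when the two
  steps above and below the row are exchanged along with the corresponding variables \<open>x\<^sub>r\<close>,
  \<open>x\<^sub>r\<^sub>+\<^sub>1\<close>. In this way a step that enlarges the row is moved downwards. It finally sits between two
  empty rows, where the sum over the single entry is a two-sided geometric series, whose value as a
  rational function is \<open>0\<close>.
\<close>

text \<open>The obstacle is infinite summation. A row that is longer than the row above it may have
  a left end that is unbounded above and a right end that is unbounded below, so its sum exists only
  as a rational function, and sums of this kind cannot be interchanged freely. The substitute for
  Fubini, \<open>reg_fibrewise_null\<close>, requires one convolution kernel that acts along a
  single row and regularizes the sums for all choices of the other rows at once. Such a kernel
  exists because the weight depends only on the order of the entries, so that far out it is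
  invariant under moving whole groups of entries. The variables are exchanged because the relation
  reflects the exponent: \<open>z\<close> to the row sum becomes \<open>z\<close> to the sum of both
  neighbouring rows minus the row sum, with \<open>z = x (r + 1) / x r\<close>, and swapping the two
  variables has just this effect. The scalar that appears depends on the shape but not on the
  entries of the neighbours; hence the identities for all fibres combine into one between the two
  full series. All this takes place in a field with values \<open>t\<close>, \<open>x i\<close>
  subject only to \<open>generic\<close>, a condition that survives permuting the variables.\<close>

abbreviation (input) lk :: "('a \<Rightarrow>\<^sub>0 'b::zero) \<Rightarrow> 'a \<Rightarrow> 'b" where "lk \<equiv> Poly_Mapping.lookup"
abbreviation (input) keys :: "('a \<Rightarrow>\<^sub>0 'b::zero) \<Rightarrow> 'a set" where "keys \<equiv> Poly_Mapping.keys"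
abbreviation (input) single :: "'a \<Rightarrow> 'b::zero \<Rightarrow> 'a \<Rightarrow>\<^sub>0 'b" where "single \<equiv> Poly_Mapping.single"

section \<open>Regularized summation\<close>

lemma poly_mapping_additive_induct [case_names zero single add]:
  assumes "P 0" "\<And>m k. P (single m k)" "\<And>f g. P f \<Longrightarrow> P g \<Longrightarrow> P (f + g)"
  shows "P (f :: 'a \<Rightarrow>\<^sub>0 'b::comm_monoid_add)"
proof (induction f rule: update_induct)
  case const
  show ?case by (rule assms(1))
next
  case (update f a b)
  have "Poly_Mapping.update a b f = f + single a b"
    using update by (intro poly_mapping_eqI) (auto simp: lookup_update lookup_add lookup_single when_def in_keys_iff)
  then show ?case using update assms by simp
qed

section \<open>Convolution with finitely supported kernels\<close>

definition conv :: "('g::ab_group_add \<Rightarrow>\<^sub>0 'k::comm_ring_1) \<Rightarrow> ('g \<Rightarrow> 'k) \<Rightarrow> 'g \<Rightarrow> 'k" where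
  "conv Q g x = (\<Sum>m\<in>keys Q. lk Q m * g (x - m))"

text \<open>The augmentation of the group ring. Once the specialized monomials are absorbed into the
  coefficients, this is the specialized denominator, so nonzero mass means that the denominator
  survives the specialization.\<close>

definition mass :: "('g \<Rightarrow>\<^sub>0 'k::comm_ring_1) \<Rightarrow> 'k" where
  "mass Q = (\<Sum>m\<in>keys Q. lk Q m)"

lemma conv_superset:
  assumes "finite A" "keys Q \<subseteq> A"
  shows "conv Q g x = (\<Sum>m\<in>A. lk Q m * g (x - m))"
  unfolding conv_def using assms by (intro sum.mono_neutral_left) (auto simp: in_keys_iff)

lemma mass_superset:
  assumes "finite A" "keys Q \<subseteq> A"
  shows "mass Q = (\<Sum>m\<in>A. lk Q m)"
  unfolding mass_def using assms by (intro sum.mono_neutral_left) (auto simp: in_keys_iff)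

lemma conv_zero [simp]: "conv 0 g x = 0" and mass_zero [simp]: "mass 0 = 0"
  by (simp_all add: conv_def mass_def)

lemma conv_single [simp]: "conv (single m k) g x = k * g (x - m)"
  by (subst conv_superset[where A = "{m}"]) auto

lemma mass_single [simp]: "mass (single m k) = k"
  by (subst mass_superset[where A = "{m}"]) auto

lemma conv_add: "conv (P + Q) g x = conv P g x + conv Q g x"
proof -
  let ?A = "keys P \<union> keys Q"
  have "conv (P + Q) g x = (\<Sum>m\<in>?A. lk (P + Q) m * g (x - m))"
    by (rule conv_superset) (use keys_add[of P Q] in auto)
  also have "\<dots> = conv P g x + conv Q g x"
    by (subst (1 2) conv_superset[where A = ?A]) (auto simp: lookup_add distrib_right sum.distrib)
  finally show ?thesis .
qed

lemma mass_add: "mass (P + Q) = mass P + mass Q"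
proof -
  let ?A = "keys P \<union> keys Q"
  have "mass (P + Q) = (\<Sum>m\<in>?A. lk (P + Q) m)"
    by (rule mass_superset) (use keys_add[of P Q] in auto)
  also have "\<dots> = mass P + mass Q"
    by (subst (1 2) mass_superset[where A = ?A]) (auto simp: lookup_add sum.distrib)
  finally show ?thesis .
qed

lemma conv_one [simp]: "conv 1 g x = g x" and mass_one [simp]: "mass 1 = 1"
  by (simp_all flip: single_one)

lemma conv_one_fun: "conv 1 g = g"
  by (rule ext) simp

lemma conv_diff: "conv (P - Q) g x = conv P g x - conv Q g x"
  using conv_add[of "P - Q" Q g x] by simp

lemma mass_diff: "mass (P - Q) = mass P - mass Q"
  using mass_add[of "P - Q" Q] by simp

lemma conv_mult: "conv (P * Q) g = conv P (conv Q g)"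
proof (induction P rule: poly_mapping_additive_induct)
  case (single m k)
  show ?case
  proof (induction Q rule: poly_mapping_additive_induct)
    case (single m' k')
    show ?case by (rule ext) (simp add: mult_single algebra_simps)
  next
    case (add Q Q')
    then show ?case by (auto simp: fun_eq_iff conv_add distrib_left)
  qed (auto simp: fun_eq_iff)
qed (auto simp: fun_eq_iff conv_add distrib_right)

lemma conv_commute: "conv P (conv Q g) = conv Q (conv P g)"
  by (simp add: mult.commute flip: conv_mult)

lemma mass_mult: "mass (P * Q) = mass P * mass Q"
proof (induction P rule: poly_mapping_additive_induct)
  case (single m k)
  show ?case
    by (induction Q rule: poly_mapping_additive_induct) (auto simp: mult_single mass_add distrib_left)
qed (auto simp: mass_add distrib_right)

lemma mass_prod: "mass (\<Prod>i\<in>A. f i) = (\<Prod>i\<in>A. mass (f i))"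
  by (induction A rule: infinite_finite_induct) (auto simp: mass_mult)

definition fsupp :: "('g \<Rightarrow> 'k::zero) \<Rightarrow> bool" where
  "fsupp h \<longleftrightarrow> finite {x. h x \<noteq> 0}"

definition tsum :: "('g \<Rightarrow> 'k::comm_monoid_add) \<Rightarrow> 'k" where
  "tsum h = sum h {x. h x \<noteq> 0}"

lemma fsuppI: "finite A \<Longrightarrow> (\<And>x. h x \<noteq> 0 \<Longrightarrow> x \<in> A) \<Longrightarrow> fsupp h"
  unfolding fsupp_def by (rule finite_subset) auto

lemma tsum_superset: "finite A \<Longrightarrow> (\<And>x. h x \<noteq> 0 \<Longrightarrow> x \<in> A) \<Longrightarrow> tsum h = sum h A"
  unfolding tsum_def by (intro sum.mono_neutral_left) auto

lemma fsupp_add: "fsupp f \<Longrightarrow> fsupp g \<Longrightarrow> fsupp (\<lambda>x. f x + g x :: 'k::comm_monoid_add)"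
  unfolding fsupp_def by (rule finite_subset[of _ "{x. f x \<noteq> 0} \<union> {x. g x \<noteq> 0}"]) auto

lemma tsum_add:
  assumes "fsupp f" "fsupp g"
  shows "tsum (\<lambda>x. f x + g x) = tsum f + (tsum g :: 'k::comm_monoid_add)"
proof -
  let ?A = "{x. f x \<noteq> 0} \<union> {x. g x \<noteq> 0}"
  have fin: "finite ?A" using assms by (auto simp: fsupp_def)
  have "tsum (\<lambda>x. f x + g x) = sum (\<lambda>x. f x + g x) ?A" by (rule tsum_superset) (use fin in auto)
  moreover have "tsum f = sum f ?A" "tsum g = sum g ?A" by (rule tsum_superset; use fin in auto)+
  ultimately show ?thesis by (simp add: sum.distrib)
qed

lemma fsupp_scale: "fsupp f \<Longrightarrow> fsupp (\<lambda>x. k * f x :: 'k::comm_ring_1)"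
  unfolding fsupp_def by (rule finite_subset[of _ "{x. f x \<noteq> 0}"]) auto

lemma tsum_scale:
  assumes "fsupp f"
  shows "tsum (\<lambda>x. k * f x) = k * (tsum f :: 'k::comm_ring_1)"
proof -
  let ?A = "{x. f x \<noteq> 0}"
  have "tsum (\<lambda>x. k * f x) = sum (\<lambda>x. k * f x) ?A"
    by (rule tsum_superset) (use assms in \<open>auto simp: fsupp_def\<close>)
  then show ?thesis by (simp add: tsum_def sum_distrib_left)
qed

lemma fsupp_shift: "fsupp f \<Longrightarrow> fsupp (\<lambda>x. f (x - m :: 'g::ab_group_add))"
  unfolding fsupp_def by (rule finite_subset[of _ "(\<lambda>x. x + m) ` {x. f x \<noteq> 0}"])
    (auto simp: image_iff intro!: exI[of _ "_ - m"])

lemma tsum_shift: "tsum (\<lambda>x. f (x - m :: 'g::ab_group_add)) = tsum f"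
  unfolding tsum_def
  by (rule sum.reindex_bij_witness[where j = "\<lambda>x. x - m" and i = "\<lambda>x. x + m"]) auto

lemma fsupp_tsum_conv:
  assumes "fsupp h"
  shows "fsupp (conv Q h) \<and> tsum (conv Q h) = mass Q * tsum h"
proof (induction Q rule: poly_mapping_additive_induct)
  case zero
  then show ?case by (simp add: fsupp_def tsum_def)
next
  case (single m k)
  show ?case using assms
    by (simp add: fsupp_scale fsupp_shift tsum_scale tsum_shift cong: if_cong)
next
  case (add f g)
  have "conv (f + g) h = (\<lambda>x. conv f h x + conv g h x)" by (auto simp: conv_add)
  then show ?case using add by (simp add: fsupp_add tsum_add mass_add distrib_right)
qed

lemmas fsupp_conv = fsupp_tsum_conv[THEN conjunct1] and tsum_conv = fsupp_tsum_conv[THEN conjunct2]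

lemma conv_fun_add: "conv Q (\<lambda>x. f x + g x) = (\<lambda>x. conv Q f x + conv Q g x)"
  by (auto simp: conv_def distrib_left sum.distrib)

lemma conv_fun_scale: "conv Q (\<lambda>x. k * f x) = (\<lambda>x. k * conv Q f x)"
  by (auto simp: conv_def sum_distrib_left algebra_simps)

text \<open>
  The value of a two-sided series as a rational function, made into a summation functional:
  \<open>reg g s\<close> states that some finitely supported convolution kernel with nonzero mass mass turns
  \<open>g\<close> into a finitely supported function whose sum is \<open>s\<close> times this mass. Thus
  \<open>\<Sum>n\<in>\<int>. r ^ n\<close> has the value \<open>0\<close> for \<open>r \<noteq> 1\<close>.
\<close>

definition reg :: "('g::ab_group_add \<Rightarrow> 'k::idom) \<Rightarrow> 'k \<Rightarrow> bool" where
  "reg g s \<longleftrightarrow> (\<exists>Q. mass Q \<noteq> 0 \<and> fsupp (conv Q g) \<and> tsum (conv Q g) = s * mass Q)"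

text \<open>Convolutions commute, so the value found with one kernel determines the outcome of every
  other. In particular \<open>s\<close> is unique, and \<open>Q\<close> itself may have mass
  zero.\<close>

lemma reg_kernel:
  assumes "reg g s" "fsupp (conv Q g)"
  shows "tsum (conv Q g) = s * mass Q"
proof -
  obtain P where P: "mass P \<noteq> 0" "fsupp (conv P g)" "tsum (conv P g) = s * mass P"
    using assms(1) by (auto simp: reg_def)
  have "mass P * tsum (conv Q g) = tsum (conv P (conv Q g))"
    using tsum_conv[OF assms(2)] by simp
  also have "conv P (conv Q g) = conv Q (conv P g)" by (rule conv_commute)
  also have "tsum \<dots> = mass Q * tsum (conv P g)" using tsum_conv[OF P(2)] by simp
  finally have "mass P * tsum (conv Q g) = mass P * (s * mass Q)"
    using P(3) by (simp add: algebra_simps)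
  then show ?thesis using P(1) by simp
qed

lemma reg_of_kernel:
  assumes "mass Q \<noteq> 0" "fsupp (conv Q g)"
  shows "\<exists>s. reg (g :: 'g::ab_group_add \<Rightarrow> 'k::field) s"
  by (rule exI[of _ "tsum (conv Q g) / mass Q"]) (use assms in \<open>auto simp: reg_def\<close>)

lemma reg_finite: "fsupp g \<Longrightarrow> reg g (tsum g)"
  unfolding reg_def by (intro exI[of _ 1]) (simp add: conv_one_fun)

lemma reg_scale: "reg g s \<Longrightarrow> reg (\<lambda>x. k * g x) (k * s)"
  unfolding reg_def by (auto simp: conv_fun_scale fsupp_scale tsum_scale mult.assoc)

text \<open>The product of the two kernels serves both summands; its mass is nonzero in a
  domain.\<close>

lemma reg_add:
  assumes "reg g s" "reg h s'"
  shows "reg (\<lambda>x. g x + h x) (s + s')"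
proof -
  obtain P where P: "mass P \<noteq> 0" "fsupp (conv P g)" "tsum (conv P g) = s * mass P"
    using assms(1) by (auto simp: reg_def)
  obtain Q where Q: "mass Q \<noteq> 0" "fsupp (conv Q h)" "tsum (conv Q h) = s' * mass Q"
    using assms(2) by (auto simp: reg_def)
  have 1: "fsupp (conv (P * Q) g)" "tsum (conv (P * Q) g) = s * mass (P * Q)"
    using P fsupp_tsum_conv[OF P(2), of Q] conv_mult[of Q P g] mass_mult[of P Q] by (simp_all add: mult.commute[of P])
  have 2: "fsupp (conv (P * Q) h)" "tsum (conv (P * Q) h) = s' * mass (P * Q)"
    using Q fsupp_tsum_conv[OF Q(2), of P] conv_mult[of P Q h] mass_mult[of P Q] by (simp_all add: algebra_simps)
  show ?thesis unfolding reg_def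
    by (rule exI[of _ "P * Q"]) (use P(1) Q(1) 1 2 in \<open>simp add: conv_fun_add fsupp_add tsum_add mass_mult distrib_right\<close>)
qed

lemma reg_shift:
  assumes "reg g s" shows "reg (\<lambda>x. g (x - m)) s"
proof -
  obtain P where P: "mass P \<noteq> 0" "fsupp (conv P g)" "tsum (conv P g) = s * mass P"
    using assms(1) by (auto simp: reg_def)
  have "conv P (\<lambda>x. g (x - m)) = (\<lambda>x. conv P g (x - m))" by (auto simp: conv_def algebra_simps)
  then show ?thesis unfolding reg_def using P fsupp_shift[OF P(2)] tsum_shift[of "conv P g" m]
    by (intro exI[of _ P]) simp
qed

lemma reg_conv_cancel:
  assumes "reg (conv Q g) s'" "mass Q \<noteq> 0" "s' = s * mass Q"
  shows "reg g s"
proof -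
  obtain P where P: "mass P \<noteq> 0" "fsupp (conv P (conv Q g))" "tsum (conv P (conv Q g)) = s' * mass P"
    using assms(1) by (auto simp: reg_def)
  show ?thesis unfolding reg_def
    by (rule exI[of _ "P * Q"]) (use P assms in \<open>auto simp: conv_mult mass_mult algebra_simps\<close>)
qed

text \<open>The geometric tail \<open>\<Sum>n\<ge>0. r ^ n\<close> contributes \<open>1 / (1 - r)\<close> at its first term.\<close>

lemma reg_geometric_tail:
  fixes w :: "'g::ab_group_add \<Rightarrow> 'k::field" and h :: "'g \<Rightarrow> int"
  assumes h: "\<And>x. h (x + v) = h x + 1" and r: "r \<noteq> 1"
    and w: "\<And>x. h x \<ge> H \<Longrightarrow> w (x + v) = r * w x"
    and s: "reg (\<lambda>x. if h x < H then w x else if h x = H then w x / (1 - r) else 0) s"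
    and s': "reg (\<lambda>x. if h x = H then w x else 0) s'"
  shows "reg w s"
proof -
  define E where "E x = (if h x = H then w x else 0)" for x
  \<comment> \<open>The defect of the truncation, that is, \<open>w\<close> minus the function
    summed in \<open>s\<close>; at level \<open>H\<close> it is
    \<open>w x - w x / (1 - r)\<close>.\<close>
  define d where "d x = (if h x < H then 0 else if h x = H then - r / (1 - r) * w x else w x)" for x
  \<comment> \<open>This kernel telescopes the tail. Only the two boundary layers remain, with
    opposite coefficients, and shifting does not change a value; so the defect has value
    \<open>0\<close>.\<close>
  let ?Q = "1 - single v r"
  have h': "h (x - v) = h x - 1" for x using h[of "x - v"] by simp
  have "conv ?Q d = (\<lambda>x. r / (1 - r) * E (x - v) + (- (r / (1 - r))) * E x)"
  proof
    fix x
    have *: "w x = r * w (x - v)" if "h x > H" using w[of "x - v"] that by (simp add: h')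
    consider "h x < H" | "h x = H" | "h x = H + 1" | "h x > H + 1" by linarith
    then show "conv ?Q d x = r / (1 - r) * E (x - v) + (- (r / (1 - r))) * E x"
    proof cases
      case 3
      then have "w x = r * w (x - v)" using * by simp
      then show ?thesis using 3 r by (simp add: conv_diff d_def E_def h' field_simps)
    next
      case 4
      then have "w x = r * w (x - v)" using * by simp
      then show ?thesis using 4 r by (simp add: conv_diff d_def E_def h' field_simps)
    qed (use r in \<open>simp_all add: conv_diff d_def E_def h' field_simps\<close>)
  qed
  moreover have "reg (\<lambda>x. r / (1 - r) * E (x - v) + (- (r / (1 - r))) * E x) (r / (1 - r) * s' + (- (r / (1 - r))) * s')"
  proof -
    have "E = (\<lambda>x. if h x = H then w x else 0)" by (simp add: E_def fun_eq_iff)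
    then have E: "reg E s'" using s' by simp
    have "reg (\<lambda>x. r / (1 - r) * E (x - v)) (r / (1 - r) * s')"
      using reg_scale[OF reg_shift[OF E, of v], of "r / (1 - r)"] .
    moreover have "reg (\<lambda>x. - (r / (1 - r)) * E x) (- (r / (1 - r)) * s')"
      using reg_scale[OF E, of "- (r / (1 - r))"] .
    ultimately show ?thesis using reg_add by fast
  qed
  ultimately have "reg (conv ?Q d) 0" by simp
  then have "reg d 0" by (rule reg_conv_cancel) (use r in \<open>auto simp: mass_diff\<close>)
  from reg_add[OF s this] have "reg (\<lambda>x. (if h x < H then w x else if h x = H then w x / (1 - r) else 0) + d x) s" by simp
  also have "(\<lambda>x. (if h x < H then w x else if h x = H then w x / (1 - r) else 0) + d x) = w"
  proof
    fix x
    have "w x / (1 - r) + - r / (1 - r) * w x = (w x * (1 - r)) / (1 - r)"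
      unfolding right_diff_distrib diff_divide_distrib by (simp add: mult.commute)
    then show "(if h x < H then w x else if h x = H then w x / (1 - r) else 0) + d x = w x"
      using r by (simp add: d_def)
  qed
  finally show ?thesis .
qed

text \<open>The kernel \<open>Q\<close> moves points only along the fibres of \<pi>, so convolving
  with it commutes with restricting to a fibre. After this step every fibre has an honest finite
  sum, which is zero, and a second kernel that makes everything finite only mixes shifted
  fibres.\<close>

lemma reg_fibrewise_null:
  fixes g :: "'g::ab_group_add \<Rightarrow> 'k::idom" and \<pi> :: "'g \<Rightarrow> 'g"
  assumes \<pi>: "\<And>x y. \<pi> (x - y) = \<pi> x - \<pi> y"
    and g: "reg g s"
    and Q: "mass Q \<noteq> 0" "\<And>m. m \<in> keys Q \<Longrightarrow> \<pi> m = 0"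
    and fin: "\<And>a. fsupp (conv Q (\<lambda>x. if \<pi> x = a then g x else 0))"
    and null: "\<And>a. reg (\<lambda>x. if \<pi> x = a then g x else 0) 0"
  shows "s = 0"
proof -
  define h where "h = conv Q g"
  define ha where "ha a x = (if \<pi> x = a then h x else 0)" for a x
  have "conv Q (\<lambda>x. if \<pi> x = a then g x else 0) = ha a" for a
    unfolding ha_def h_def conv_def by (rule ext) (auto simp: \<pi> Q(2))
  then have ha: "fsupp (ha a)" "tsum (ha a) = 0" for a
    using fin[of a] reg_kernel[OF null[of a] fin] by auto
  obtain P where P: "mass P \<noteq> 0" "fsupp (conv P g)" "tsum (conv P g) = s * mass P"
    using g by (auto simp: reg_def)
  define G where "G = conv P h"
  have G: "G = conv Q (conv P g)" unfolding G_def h_def by (rule conv_commute)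
  have finG: "fsupp G" unfolding G by (rule fsupp_conv[OF P(2)])
  \<comment> \<open>Each fibre of \<open>G\<close> collects finitely many shifted fibres of
    \<open>h\<close>, one for every key of \<open>P\<close>.\<close>
  have null_fibre: "tsum (\<lambda>x. if \<pi> x = a then G x else 0) = 0" for a
  proof -
    have eq: "(\<lambda>x. if \<pi> x = a then G x else 0) =
      (\<lambda>x. \<Sum>m\<in>keys P. lk P m * ha (a - \<pi> m) (x - m))"
      unfolding G_def conv_def ha_def by (rule ext) (auto simp: \<pi>)
    have "fsupp (\<lambda>x. \<Sum>m\<in>A. lk P m * ha (a - \<pi> m) (x - m)) \<and>
       tsum (\<lambda>x. \<Sum>m\<in>A. lk P m * ha (a - \<pi> m) (x - m)) = 0" if "finite A" for A
      using that
    proof (induction A)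
      case empty
      then show ?case by (simp add: fsupp_def tsum_def)
    next
      case (insert m A)
      have "fsupp (\<lambda>x. lk P m * ha (a - \<pi> m) (x - m))"
        using fsupp_scale[OF fsupp_shift[OF ha(1)[of "a - \<pi> m"], of m], of "lk P m"] by simp
      moreover have "tsum (\<lambda>x. lk P m * ha (a - \<pi> m) (x - m)) = 0"
        using tsum_scale[OF fsupp_shift[OF ha(1)[of "a - \<pi> m"], of m], of "lk P m"]
          tsum_shift[of "ha (a - \<pi> m)" m] ha(2)[of "a - \<pi> m"] by simp
      ultimately show ?case using insert by (simp add: fsupp_add tsum_add)
    qed
    then show ?thesis unfolding eq by simp
  qed
  have fib: "(\<Sum>x\<in>{x\<in>{x. G x \<noteq> 0}. \<pi> x = a}. G x) = 0" for a
  proof -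
    let ?A = "{x\<in>{x. G x \<noteq> 0}. \<pi> x = a}"
    have "finite ?A" using finG by (simp add: fsupp_def)
    then have "tsum (\<lambda>x. if \<pi> x = a then G x else 0) = (\<Sum>x\<in>?A. if \<pi> x = a then G x else 0)"
      by (rule tsum_superset) (simp split: if_splits)
    also have "\<dots> = (\<Sum>x\<in>?A. G x)" by (rule sum.cong) auto
    finally show ?thesis using null_fibre[of a] by simp
  qed
  have "tsum G = (\<Sum>a\<in>\<pi> ` {x. G x \<noteq> 0}. \<Sum>x\<in>{x\<in>{x. G x \<noteq> 0}. \<pi> x = a}. G x)"
    unfolding tsum_def by (rule sum.image_gen) (use finG in \<open>simp add: fsupp_def\<close>)
  also have "\<dots> = 0" unfolding fib by simp
  finally have "tsum (conv Q (conv P g)) = 0" using G by simp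
  then show ?thesis using tsum_conv[OF P(2), of Q] P Q(1) by auto
qed


section \<open>Kernels for functions that depend on the order of the coordinates\<close>

definition ind :: "'v set \<Rightarrow> ('v \<Rightarrow>\<^sub>0 int)" where
  "ind U = (\<Sum>v\<in>U. single v 1)"

lemma lookup_ind: "finite U \<Longrightarrow> lk (ind U) v = (if v \<in> U then 1 else 0)"
  by (simp add: ind_def lookup_sum lookup_single when_def)

text \<open>The factor of \<open>U\<close> kills a function that is multiplied by
  \<open>\<omega> U\<close> when all coordinates in \<open>U\<close> are raised by one. One factor
  per subset accounts for every group of coordinates that can escape to infinity together.\<close>

definition subset_kernel :: "'v set set \<Rightarrow> ('v set \<Rightarrow> 'k) \<Rightarrow> (('v \<Rightarrow>\<^sub>0 int) \<Rightarrow>\<^sub>0 'k::comm_ring_1)" where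
  "subset_kernel A \<omega> = (\<Prod>U\<in>A. (1 - single (ind U) (\<omega> U)))"

lemma mass_subset_kernel: "mass (subset_kernel A \<omega>) = (\<Prod>U\<in>A. (1 - \<omega> U))"
  by (simp add: subset_kernel_def mass_prod mass_diff)

text \<open>A factor shifts each coordinate by at most one, so the number of factors bounds the
  reach of the kernel and thereby the width of the gaps required below.\<close>

lemma keys_subset_kernel:
  assumes "finite I" "A \<subseteq> Pow I" "m \<in> keys (subset_kernel A \<omega>)"
  shows "0 \<le> lk m v \<and> lk m v \<le> int (card A) \<and>
    (v \<notin> I \<longrightarrow> lk m v = 0)"
proof -
  have "finite A" using assms by (meson finite_Pow_iff finite_subset)
  then show ?thesis using assms(2,3)
  proof (induction A arbitrary: m)
    case empty
    then show ?case by (simp add: subset_kernel_def)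
  next
    case (insert U A)
    let ?f = "1 - single (ind U) (\<omega> U)"
    have fU: "finite U" using insert.prems assms(1) by (auto intro: finite_subset)
    have "m \<in> keys (?f * subset_kernel A \<omega>)"
      using insert by (simp add: subset_kernel_def)
    then obtain a b where ab: "m = a + b" "a \<in> keys ?f" "b \<in> keys (subset_kernel A \<omega>)"
      using keys_mult by blast
    have "a = 0 \<or> a = ind U"
      using ab(2) keys_diff[of 1 "single (ind U) (\<omega> U)"] by (auto split: if_splits)
    then have "0 \<le> lk a v \<and> lk a v \<le> 1 \<and> (v \<notin> I \<longrightarrow> lk a v = 0)"
      using fU insert.prems by (auto simp: lookup_ind)
    moreover have "0 \<le> lk b v \<and> lk b v \<le> int (card A) \<and> (v \<notin> I \<longrightarrow> lk b v = 0)"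
      using insert ab by auto
    ultimately show ?case using insert(1,2) by (auto simp: ab(1) lookup_add)
  qed
qed

text \<open>Pigeonhole: above \<open>b\<close> there are \<open>card I\<close> consecutive windows
  of length \<open>G\<close>, and the coordinates other than \<open>u\<close> meet at most
  \<open>card I - 1\<close> of them. The set \<open>U\<close> consists of the coordinates above a
  free window.\<close>

lemma exists_gap:
  fixes h :: "'v \<Rightarrow> int"
  assumes "finite I" "u \<in> I" "G > 0" "h u \<ge> b + int (card I) * G"
  obtains \<theta> U where "\<theta> \<ge> b" "U \<subseteq> I" "u \<in> U" "\<And>v. v \<in> U \<Longrightarrow> h v \<ge> \<theta> + G" "\<And>v. v \<in> I - U \<Longrightarrow> h v < \<theta>"
proof -
  let ?f = "\<lambda>v. (h v - b) div G"
  have "card (?f ` (I - {u})) < card {0..<int (card I)}"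
    using card_image_le[of "I - {u}" ?f] assms card_Diff1_less[of I u] by simp
  then have "\<not> {0..<int (card I)} \<subseteq> ?f ` (I - {u})"
    using assms(1) by (metis card_mono finite_Diff finite_imageI not_le)
  then obtain k where k: "0 \<le> k" "k < int (card I)" "k \<notin> ?f ` (I - {u})"
    unfolding subset_iff atLeastLessThan_iff by blast
  let ?U = "{v\<in>I. h v \<ge> b + k * G + G}"
  have "(k + 1) * G \<le> int (card I) * G" using k assms(3) by (intro mult_right_mono) auto
  then have u: "u \<in> ?U" using assms by (auto simp: algebra_simps)
  have lt: "h v < b + k * G" if "v \<in> I - ?U" for v
  proof (rule ccontr)
    assume "\<not> h v < b + k * G"
    with that have "k * G \<le> h v - b" "h v - b < (k + 1) * G" by (auto simp: algebra_simps)
    then have "?f v = k" using assms(3) by (intro int_div_pos_eq[where r = "h v - b - k * G"]) (auto simp: algebra_simps)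
    then show False using k(3) that u by auto
  qed
  show thesis
  proof (rule that[of "b + k * G" ?U])
    show "h v < b + k * G" if "v \<in> I - ?U" for v using lt[OF that] .
  qed (use u k(1) assms(3) in auto)
qed

text \<open>
  If a coordinate of \<open>x\<close> is very large, there is a wide gap among the coordinates; moving the set
  \<open>U\<close> of coordinates above the gap changes \<open>g\<close> only by the factor \<open>\<omega> U\<close>, so the factor of the
  kernel that belongs to \<open>U\<close> kills \<open>g\<close> near \<open>x\<close>.
\<close>

lemma fsupp_conv_subset_kernel:
  fixes g :: "('v \<Rightarrow>\<^sub>0 int) \<Rightarrow> 'k::comm_ring_1"
  assumes fin: "finite I" and B: "B \<ge> 0"
    and up: "\<And>s U. U \<subseteq> I \<Longrightarrow> U \<noteq> {} \<Longrightarrow> (\<And>u. u \<in> U \<Longrightarrow> lk s u > B) \<Longrightarrow>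
      (\<And>u v. u \<in> U \<Longrightarrow> v \<in> I - U \<Longrightarrow> lk s u > lk s v) \<Longrightarrow> g (s + ind U) = \<omega> U * g s"
    and dn: "\<And>s U. U \<subseteq> I \<Longrightarrow> U \<noteq> {} \<Longrightarrow> (\<And>u. u \<in> U \<Longrightarrow> lk s u < - B) \<Longrightarrow>
      (\<And>u v. u \<in> U \<Longrightarrow> v \<in> I - U \<Longrightarrow> lk s u < lk s v) \<Longrightarrow> g s = \<omega> U * g (s - ind U)"
    and supp: "\<And>s v. g s \<noteq> 0 \<Longrightarrow> v \<notin> I \<Longrightarrow> lk s v = a v"
  shows "fsupp (conv (subset_kernel (Pow I - {{}}) \<omega>) g)"
proof -
  let ?A = "Pow I - {{}}"
  \<comment> \<open>\<open>M\<close> bounds the shift by a key of the kernel. The threshold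
    \<open>b\<close> keeps the coordinates in \<open>U\<close> beyond \<open>B\<close> after such a
    shift and one further unit step, and a gap of \<open>M + 2\<close> keeps them apart from the
    others.\<close>
  define M where "M = int (card ?A)"
  define b where "b = B + M + 1"
  define T where "T = b + int (card I) * (M + 2)"
  have M: "M \<ge> 0" by (simp add: M_def)
  \<comment> \<open>The factor of \<open>U\<close> alone produces the zero; the other factors only
    spread the point by at most \<open>M\<close> per coordinate.\<close>
  have null: "conv (subset_kernel ?A \<omega>) g x = 0"
    if U: "U \<in> ?A" and eq: "\<And>m. (\<And>v. 0 \<le> lk m v \<and> lk m v \<le> M \<and> (v \<notin> I \<longrightarrow> lk m v = 0)) \<Longrightarrow>
      g (x - m) = \<omega> U * g (x - m - ind U)" for x U
  proof -
    let ?f = "1 - single (ind U) (\<omega> U)"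
    have "subset_kernel ?A \<omega> = subset_kernel (?A - {U}) \<omega> * ?f"
      unfolding subset_kernel_def using fin U by (subst prod.remove[of _ U]) auto
    then have "conv (subset_kernel ?A \<omega>) g x = conv (subset_kernel (?A - {U}) \<omega>) (conv ?f g) x"
      by (simp add: conv_mult)
    also have "\<dots> = 0"
      unfolding conv_def[of "subset_kernel _ _"]
    proof (rule sum.neutral, rule ballI)
      fix m assume "m \<in> keys (subset_kernel (?A - {U}) \<omega>)"
      from keys_subset_kernel[OF fin _ this]
      have "0 \<le> lk m v \<and> lk m v \<le> int (card (?A - {U})) \<and> (v \<notin> I \<longrightarrow> lk m v = 0)" for v
        by auto
      moreover have "card (?A - {U}) \<le> card ?A" using fin by (intro card_mono) auto
      ultimately have "0 \<le> lk m v \<and> lk m v \<le> M \<and> (v \<notin> I \<longrightarrow> lk m v = 0)" for v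
        unfolding M_def by (meson of_nat_mono order_trans)
      then have "g (x - m) = \<omega> U * g (x - m - ind U)" by (rule eq)
      then show "lk (subset_kernel (?A - {U}) \<omega>) m * conv ?f g (x - m) = 0"
        by (simp add: conv_diff)
    qed
    finally show ?thesis .
  qed
  have upper: "lk x u < T" if x: "conv (subset_kernel ?A \<omega>) g x \<noteq> 0" and u: "u \<in> I" for x u
  proof (rule ccontr)
    assume "\<not> lk x u < T"
    then have "lk x u \<ge> b + int (card I) * (M + 2)" by (simp add: T_def)
    then obtain \<theta> U where U: "\<theta> \<ge> b" "U \<subseteq> I" "u \<in> U" "\<And>v. v \<in> U \<Longrightarrow> lk x v \<ge> \<theta> + (M + 2)"
       "\<And>v. v \<in> I - U \<Longrightarrow> lk x v < \<theta>"
      using M by (elim exists_gap[OF fin u, rotated]) auto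
    have fU: "finite U" using U fin finite_subset by auto
    have "conv (subset_kernel ?A \<omega>) g x = 0"
    proof (rule null)
      show "U \<in> ?A" using U by auto
      fix m assume m: "\<And>v. 0 \<le> lk m v \<and> lk m v \<le> M \<and> (v \<notin> I \<longrightarrow> lk m v = 0)"
      have "g (x - m - ind U + ind U) = \<omega> U * g (x - m - ind U)"
      proof (rule up)
        fix w assume w: "w \<in> U"
        show "B < lk (x - m - ind U) w"
          using U(4)[OF w] U(1) m[of w] w fU M by (simp add: lookup_minus lookup_ind b_def)
        fix v assume v: "v \<in> I - U"
        show "lk (x - m - ind U) v < lk (x - m - ind U) w"
          using U(4)[OF w] U(5)[OF v] m[of w] m[of v] w v fU M by (simp add: lookup_minus lookup_ind)
      qed (use U in auto)
      then show "g (x - m) = \<omega> U * g (x - m - ind U)" by simp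
    qed
    with x show False by simp
  qed
  have lower: "- lk x u < T" if x: "conv (subset_kernel ?A \<omega>) g x \<noteq> 0" and u: "u \<in> I" for x u
  proof (rule ccontr)
    assume "\<not> - lk x u < T"
    then have "- lk x u \<ge> b + int (card I) * (M + 2)" by (simp add: T_def)
    then obtain \<theta> U where U: "\<theta> \<ge> b" "U \<subseteq> I" "u \<in> U" "\<And>v. v \<in> U \<Longrightarrow> - lk x v \<ge> \<theta> + (M + 2)"
       "\<And>v. v \<in> I - U \<Longrightarrow> - lk x v < \<theta>"
      using M by (elim exists_gap[OF fin u, of _ _ "\<lambda>v. - lk x v", rotated]) auto
    have "conv (subset_kernel ?A \<omega>) g x = 0"
    proof (rule null)
      show "U \<in> ?A" using U by auto
      fix m assume m: "\<And>v. 0 \<le> lk m v \<and> lk m v \<le> M \<and> (v \<notin> I \<longrightarrow> lk m v = 0)"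
      show "g (x - m) = \<omega> U * g (x - m - ind U)"
      proof (rule dn)
        fix w assume w: "w \<in> U"
        show "lk (x - m) w < - B"
          using U(4)[OF w] U(1) m[of w] w M by (simp add: lookup_minus b_def)
        fix v assume v: "v \<in> I - U"
        show "lk (x - m) w < lk (x - m) v"
          using U(4)[OF w] U(5)[OF v] m[of w] m[of v] M by (simp add: lookup_minus)
      qed (use U in auto)
    qed
    with x show False by simp
  qed
  have off: "lk x v = a v" if x: "conv (subset_kernel ?A \<omega>) g x \<noteq> 0" and v: "v \<notin> I" for x v
  proof -
    from x obtain m where m: "m \<in> keys (subset_kernel ?A \<omega>)" "g (x - m) \<noteq> 0"
      unfolding conv_def by (metis (no_types, lifting) mult_zero_right sum.neutral)
    have "lk m v = 0" using keys_subset_kernel[OF fin _ m(1), of v] v by auto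
    then show ?thesis using supp[OF m(2) v] by (simp add: lookup_minus)
  qed
  let ?S = "{x. conv (subset_kernel ?A \<omega>) g x \<noteq> 0}"
  have "finite ((\<lambda>x. restrict (lk x) I) ` ?S)"
  proof (rule finite_subset)
    show "(\<lambda>x. restrict (lk x) I) ` ?S \<subseteq> (\<Pi>\<^sub>E v\<in>I. {-T..T})"
    proof (rule image_subsetI, rule PiE_I)
      fix x v assume "x \<in> ?S" "v \<in> I"
      then show "restrict (lk x) I v \<in> {-T..T}"
        using upper[of x v] lower[of x v] by simp
    qed simp
    show "finite (\<Pi>\<^sub>E v\<in>I. {-T..T})" using fin by (intro finite_PiE) auto
  qed
  moreover have "inj_on (\<lambda>x. restrict (lk x) I) ?S"
  proof (rule inj_onI)
    fix x y assume *: "x \<in> ?S" "y \<in> ?S" "restrict (lk x) I = restrict (lk y) I"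
    show "x = y"
    proof (rule poly_mapping_eqI)
      fix v show "lk x v = lk y v"
        using * off by (cases "v \<in> I") (auto dest: fun_cong[of _ _ v])
    qed
  qed
  ultimately show ?thesis unfolding fsupp_def by (rule finite_imageD)
qed

section \<open>Lattice paths and the Yang--Baxter relation\<close>

text \<open>The constant continuation on both sides makes a path a single function on the integers
  that is determined by finitely many values, so that paths can be compared by extensionality and
  form finite sets.\<close>

definition paths :: "(int \<Rightarrow> int set) \<Rightarrow> int \<Rightarrow> int \<Rightarrow> int \<Rightarrow> int \<Rightarrow> (int \<Rightarrow> int) set" where
  "paths S a H c v = {f. antimono f \<and> (\<forall>d>H. f d = a) \<and> (\<forall>d\<le>c. f d = v) \<and> (\<forall>d. c \<le> d \<and> d \<le> H \<longrightarrow> f d \<in> S d)}"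

text \<open>The transfer matrix product, read from the value \<open>H\<close> downwards: the vector
  after \<open>k\<close> factors, indexed by the height \<open>v\<close> reached, where
  \<open>w c u v\<close> is the weight of passing from height \<open>u\<close> at
  \<open>c + 1\<close> to height \<open>v\<close> at \<open>c\<close>.\<close>

fun path_amp :: "(int \<Rightarrow> int set) \<Rightarrow> (int \<Rightarrow> int \<Rightarrow> int \<Rightarrow> 'k::comm_ring_1) \<Rightarrow> int \<Rightarrow> int \<Rightarrow> nat \<Rightarrow> int \<Rightarrow> 'k" where
  "path_amp S w a H 0 v = (if v = a then 1 else 0)"
| "path_amp S w a H (Suc k) v = (if v \<in> S (H - int k)
     then \<Sum>u\<in>{u\<in>S (H + 1 - int k). u \<le> v}. path_amp S w a H k u * w (H - int k) u v else 0)"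

lemma paths_base: "paths S a H (H + 1) v = (if v = a then {\<lambda>_. a} else {})"
proof -
  have "f = (\<lambda>_. a)" if "\<forall>d>H. f d = a" "\<forall>d\<le>H+1. f d = a" for f :: "int \<Rightarrow> int"
    using that by (metis linorder_le_cases linorder_not_le order.strict_trans1 zless_add1_eq)
  moreover have "v = a" if "\<forall>d>H. f d = a" "\<forall>d\<le>H+1. f d = v" for f :: "int \<Rightarrow> int"
    using that(1)[rule_format, of "H + 1"] that(2)[rule_format, of "H + 1"] by simp
  moreover have "antimono (\<lambda>_::int. a)" by (simp add: antimono_def)
  ultimately show ?thesis unfolding paths_def by auto
qed

lemma paths_extend:
  assumes "c \<le> H" "v \<in> S c" "g \<in> paths S a H (c + 1) u" "u \<le> v"
  shows "(\<lambda>d. if d \<le> c then v else g d) \<in> paths S a H c v"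
proof -
  have g: "antimono g" "\<And>d. d > H \<Longrightarrow> g d = a" "\<And>d. d \<le> c + 1 \<Longrightarrow> g d = u" "\<And>d. c + 1 \<le> d \<Longrightarrow> d \<le> H \<Longrightarrow> g d \<in> S d"
    using assms(3) by (auto simp: paths_def)
  have "antimono (\<lambda>d. if d \<le> c then v else g d)"
  proof (rule antimonoI)
    fix x y :: int assume xy: "x \<le> y"
    have "g y \<le> g (c + 1)" if "y > c" using antimonoD[OF g(1), of "c + 1" y] that by simp
    then show "(if y \<le> c then v else g y) \<le> (if x \<le> c then v else g x)"
      using xy assms(4) g(3)[of "c + 1"] antimonoD[OF g(1) xy] by auto
  qed
  then show ?thesis using assms(1,2) g by (auto simp: paths_def)
qed

lemma paths_restrict:
  assumes "c \<le> H" "a \<in> S (H + 1)" "f \<in> paths S a H c v"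
  shows "(\<lambda>d. if d \<le> c + 1 then f (c + 1) else f d) \<in> paths S a H (c + 1) (f (c + 1))"
    "f (c + 1) \<in> {u \<in> S (c + 1). u \<le> v}"
proof -
  have f: "antimono f" "\<And>d. d > H \<Longrightarrow> f d = a" "\<And>d. d \<le> c \<Longrightarrow> f d = v" "\<And>d. c \<le> d \<Longrightarrow> d \<le> H \<Longrightarrow> f d \<in> S d"
    using assms(3) by (auto simp: paths_def)
  have "antimono (\<lambda>d. if d \<le> c + 1 then f (c + 1) else f d)"
  proof (rule antimonoI)
    fix x y :: int assume xy: "x \<le> y"
    show "(if y \<le> c + 1 then f (c + 1) else f y) \<le> (if x \<le> c + 1 then f (c + 1) else f x)"
      using xy antimonoD[OF f(1) xy] antimonoD[OF f(1), of "c + 1" y] by auto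
  qed
  then show "(\<lambda>d. if d \<le> c + 1 then f (c + 1) else f d) \<in> paths S a H (c + 1) (f (c + 1))"
    using f assms(1) by (auto simp: paths_def)
  have "f (c + 1) \<in> S (c + 1)" using f(2)[of "c + 1"] f(4)[of "c + 1"] assms(1,2) by (cases "c = H") auto
  moreover have "f (c + 1) \<le> v" using antimonoD[OF f(1), of c "c + 1"] f(3)[of c] by simp
  ultimately show "f (c + 1) \<in> {u \<in> S (c + 1). u \<le> v}" by simp
qed

text \<open>Splitting off the lowest value of a path leaves a path that ends in its previous height.
  The condition on \<open>a\<close> makes the starting height admissible as a predecessor in the
  first factor.\<close>

lemma path_sum:
  assumes S: "\<And>c. finite (S c)" "a \<in> S (H + 1)"
  shows "finite (paths S a H (H + 1 - int k) v) \<and>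
    (\<Sum>f\<in>paths S a H (H + 1 - int k) v. \<Prod>d\<in>{H + 1 - int k..H}. w d (f (d + 1)) (f d)) = path_amp S w a H k v"
proof (induction k arbitrary: v)
  case 0
  show ?case by (simp add: paths_base)
next
  case (Suc k)
  define c where "c = H - int k"
  have c: "c \<le> H" "H + 1 - int k = c + 1" "H + 1 - int (Suc k) = c" by (auto simp: c_def)
  define U where "U = {u\<in>S (c + 1). u \<le> v}"
  \<comment> \<open>\<open>res\<close> forgets the last height by continuing the preceding one
    downwards, and \<open>ext\<close> restores it.\<close>
  define ext where "ext g = (\<lambda>d. if d \<le> c then v else g d)" for g :: "int \<Rightarrow> int"
  define res where "res f = (\<lambda>d. if d \<le> c + 1 then f (c + 1) else f d)" for f :: "int \<Rightarrow> int"
  have fU: "finite U" using S(1)[of "c + 1"] by (simp add: U_def)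
  show ?case
  proof (cases "v \<in> S c")
    case False
    then have "paths S a H c v = {}" using c(1) by (auto simp: paths_def)
    then show ?thesis using False c by (simp add: c_def)
  next
    case True
    have IH: "finite (paths S a H (c + 1) u)"
      "(\<Sum>f\<in>paths S a H (c + 1) u. \<Prod>d\<in>{c + 1..H}. w d (f (d + 1)) (f d)) = path_amp S w a H k u" for u
      using Suc.IH[of u] unfolding c(2) by auto
    have e1: "ext (res f) = f" if "f \<in> paths S a H c v" for f
      using that by (auto simp: ext_def res_def paths_def fun_eq_iff intro: order_antisym)
         (metis add.commute linorder_not_le order_antisym zle_add1_eq_le)+
    have e2: "res (ext g) = g \<and> ext g (c + 1) = u" if "g \<in> paths S a H (c + 1) u" for g u
      using that by (auto simp: ext_def res_def paths_def fun_eq_iff)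
    have fin: "finite (paths S a H c v)"
    proof (rule finite_subset)
      show "paths S a H c v \<subseteq> ext ` (\<Union>u\<in>U. paths S a H (c + 1) u)"
      proof
        fix f assume f: "f \<in> paths S a H c v"
        note r = paths_restrict[OF c(1) S(2) f]
        have "res f \<in> (\<Union>u\<in>U. paths S a H (c + 1) u)" using r unfolding U_def res_def by blast
        then show "f \<in> ext ` (\<Union>u\<in>U. paths S a H (c + 1) u)" using e1[OF f] by (metis imageI)
      qed
      show "finite (ext ` (\<Union>u\<in>U. paths S a H (c + 1) u))" using IH(1) fU by blast
    qed
    have "(\<Sum>f\<in>paths S a H c v. \<Prod>d\<in>{c..H}. w d (f (d + 1)) (f d)) =
      (\<Sum>(u, g)\<in>Sigma U (paths S a H (c + 1)). (\<Prod>d\<in>{c + 1..H}. w d (g (d + 1)) (g d)) * w c u v)"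
    proof (rule sum.reindex_bij_witness[where j = "\<lambda>f. (f (c + 1), res f)" and i = "\<lambda>(u, g). ext g"])
      fix f assume f: "f \<in> paths S a H c v"
      show "(case (f (c + 1), res f) of (u, g) \<Rightarrow> ext g) = f" using e1[OF f] by simp
      show "(f (c + 1), res f) \<in> Sigma U (paths S a H (c + 1))"
        using paths_restrict[OF c(1) S(2) f] unfolding U_def res_def by auto
      have "{c..H} = insert c {c + 1..H}" using c(1) by auto
      then have "(\<Prod>d\<in>{c..H}. w d (f (d + 1)) (f d)) = w c (f (c + 1)) (f c) * (\<Prod>d\<in>{c + 1..H}. w d (f (d + 1)) (f d))"
        by simp
      also have "(\<Prod>d\<in>{c + 1..H}. w d (f (d + 1)) (f d)) = (\<Prod>d\<in>{c + 1..H}. w d (res f (d + 1)) (res f d))"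
        by (rule prod.cong) (auto simp: res_def intro: arg_cong2[where f = "w _"])
      also have "f c = v" using f by (simp add: paths_def)
      finally show "(case (f (c + 1), res f) of (u, g) \<Rightarrow> (\<Prod>d\<in>{c + 1..H}. w d (g (d + 1)) (g d)) * w c u v)
        = (\<Prod>d\<in>{c..H}. w d (f (d + 1)) (f d))" by (simp add: mult.commute)
    next
      fix b assume b: "b \<in> Sigma U (paths S a H (c + 1))"
      then obtain u g where ug: "b = (u, g)" "u \<in> U" "g \<in> paths S a H (c + 1) u" by auto
      show "((case b of (u, g) \<Rightarrow> ext g) (c + 1), res (case b of (u, g) \<Rightarrow> ext g)) = b"
        using e2[OF ug(3)] ug by simp
      show "(case b of (u, g) \<Rightarrow> ext g) \<in> paths S a H c v"
        using paths_extend[OF c(1) True ug(3)] ug(1,2) by (simp add: U_def ext_def)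
    qed
    also have "\<dots> = (\<Sum>u\<in>U. \<Sum>g\<in>paths S a H (c + 1) u. (\<Prod>d\<in>{c + 1..H}. w d (g (d + 1)) (g d)) * w c u v)"
      using fU IH(1) by (subst sum.Sigma) auto
    also have "\<dots> = (\<Sum>u\<in>U. path_amp S w a H k u * w c u v)"
      by (simp add: IH(2) flip: sum_distrib_right)
    finally show ?thesis using fin True unfolding c(3) by (simp add: U_def c_def algebra_simps)
  qed
qed

definition row_wt :: "'k::field \<Rightarrow> nat \<Rightarrow> nat \<Rightarrow> 'k" where
  "row_wt t k m = (if m = k + 1 then 1 - t ^ m else 1)"

text \<open>
  The Yang--Baxter relation. The heights \<open>a \<ge> b\<close> of two rows leave at most two heights for a row
  between them: \<open>a - 1\<close> and \<open>a\<close> if \<open>a = b + 1\<close>, and a single one if \<open>a = b\<close> or \<open>a = b + 2\<close>.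
  In the first case the \<open>2 \<times> 2\<close> matrix with rows \<open>((1 - t) z, t (z - 1))\<close> and \<open>(z - 1, 1 - t)\<close>,
  in the second case the scalar \<open>z - t\<close>, intertwines the two families of amplitudes.
\<close>

definition YB :: "'k::field \<Rightarrow> 'k \<Rightarrow> 'k \<Rightarrow> int \<Rightarrow> int \<Rightarrow> (int \<Rightarrow> 'k) \<Rightarrow> (int \<Rightarrow> 'k) \<Rightarrow> bool" where
  "YB t z C a b V V' \<longleftrightarrow>
    (a = b + 2 \<longrightarrow> (z - t) * V (a - 1) = C * V' (a - 1)) \<and>
    (a = b \<longrightarrow> (z - t) * V a = C * V' a) \<and>
    (a = b + 1 \<longrightarrow> (1 - t) * z * V (a - 1) + (z - 1) * V a = C * V' (a - 1) \<and>
       t * (z - 1) * V (a - 1) + (1 - t) * V a = C * V' a)"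

text \<open>Here \<open>a\<close> is the height of the row above and \<open>b\<close> that of the
  row below. Between consecutive rows the height drops by \<open>0\<close> or \<open>1\<close>, see
  \<open>interlaced_iff_rc\<close>.\<close>

definition mids :: "int \<Rightarrow> int \<Rightarrow> int set" where
  "mids a b = {a - 1, a} \<inter> {b, b + 1}"

lemma mids_simps:
  "mids (b + 2) b = {b + 1}" "mids b b = {b}" "mids (b + 1) b = {b, b + 1}"
  by (auto simp: mids_def)

lemma sum_mids:
  "(\<Sum>u\<in>{u\<in>mids (b + 2) b. u \<le> v}. f u) = (if b + 1 \<le> v then f (b + 1) else 0)"
  "(\<Sum>u\<in>{u\<in>mids b b. u \<le> v}. f u) = (if b \<le> v then f b else 0)"
  "(\<Sum>u\<in>{u\<in>mids (b + 1) b. u \<le> v}. f u) =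
    (if b + 1 \<le> v then f b + f (b + 1) else if b \<le> v then f b else 0)"
proof -
  have "{u\<in>{x}. u \<le> v} = (if x \<le> v then {x} else {})" for x by auto
  moreover have "{u\<in>{b, b + 1}. u \<le> v} = (if b + 1 \<le> v then {b, b + 1} else if b \<le> v then {b} else {})" by auto
  ultimately show "(\<Sum>u\<in>{u\<in>mids (b + 2) b. u \<le> v}. f u) = (if b + 1 \<le> v then f (b + 1) else 0)"
    "(\<Sum>u\<in>{u\<in>mids b b. u \<le> v}. f u) = (if b \<le> v then f b else 0)"
    "(\<Sum>u\<in>{u\<in>mids (b + 1) b. u \<le> v}. f u) =
      (if b + 1 \<le> v then f b + f (b + 1) else if b \<le> v then f b else 0)"
    unfolding mids_simps by simp_all
qed

lemma mids_empty: "a \<noteq> b \<Longrightarrow> a \<noteq> b + 1 \<Longrightarrow> a \<noteq> b + 2 \<Longrightarrow> mids a b = {}"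
  by (auto simp: mids_def)

text \<open>The contribution of a single value: it occurs \<open>k\<close> times in the row above,
  \<open>n\<close> times in the row below, and \<open>v - u\<close> times in the row between, since
  the rise of a height counts entries.\<close>

definition col_wt :: "'k::field \<Rightarrow> nat \<Rightarrow> nat \<Rightarrow> int \<Rightarrow> int \<Rightarrow> 'k" where
  "col_wt t k n u v = row_wt t k (nat (v - u)) * row_wt t (nat (v - u)) n"

lemma col_wt_eq: "v = u + int m \<Longrightarrow> col_wt t k n u v = row_wt t k m * row_wt t m n"
  by (simp add: col_wt_def)

text \<open>One transfer step preserves the relation. The primed side carries \<open>z\<close> to
  the reflected height, sum of the outer heights minus \<open>v\<close>. What is verified is an
  identity between small matrices whose sizes are the numbers of available heights before and after
  the step.\<close>

lemma YB_step:
  fixes t z :: "'k::field"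
  assumes YB: "YB t z C a b V V'" and z: "z \<noteq> 0"
    and W: "\<And>v. v \<in> mids (a + int k) (b + int n) \<Longrightarrow>
      W v = z powi v * (\<Sum>u\<in>{u\<in>mids a b. u \<le> v}. V u * col_wt t k n u v)"
    and W': "\<And>v. v \<in> mids (a + int k) (b + int n) \<Longrightarrow>
      W' v = z powi (a + int k + (b + int n) - v) * (\<Sum>u\<in>{u\<in>mids a b. u \<le> v}. V' u * col_wt t k n u v)"
  shows "YB t z C (a + int k) (b + int n) W W'"
proof -
  have z1: "z powi (x + 1) = z powi x * z" for x using z by (simp add: power_int_add)
  \<comment> \<open>Unless one of the two sets of heights is empty, the outer heights differ by
    \<open>0\<close>, \<open>1\<close> or \<open>2\<close> both before and after the step, which
    leaves nine combinations.\<close>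
  consider "mids a b = {}" | "mids (a + int k) (b + int n) = {}" | "a = b" "k = n" | "a = b" "k = n + 1" | "a = b" "k = n + 2"
    | "a = b + 1" "n = k + 1" | "a = b + 1" "k = n" | "a = b + 1" "k = n + 1"
    | "a = b + 2" "n = k + 2" | "a = b + 2" "n = k + 1" | "a = b + 2" "k = n"
  proof -
    have "mids (a + int k) (b + int n) = {}" if "a = b" "k \<noteq> n" "k \<noteq> n + 1" "k \<noteq> n + 2"
      using that by (intro mids_empty) linarith+
    moreover have "mids (a + int k) (b + int n) = {}" if "a = b + 1" "n \<noteq> k + 1" "k \<noteq> n" "k \<noteq> n + 1"
      using that by (intro mids_empty) linarith+
    moreover have "mids (a + int k) (b + int n) = {}" if "a = b + 2" "n \<noteq> k + 2" "n \<noteq> k + 1" "k \<noteq> n"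
      using that by (intro mids_empty) linarith+
    moreover note mids_empty[of a b]
    ultimately show thesis using that by blast
  qed
  then show ?thesis
  proof cases
    case 1
    then have "W v = 0 \<and> W' v = 0" if "v \<in> mids (a + int k) (b + int n)" for v
      using W[OF that] W'[OF that] by simp
    then show ?thesis unfolding YB_def by (auto simp: mids_def)
  next
    case 2
    then show ?thesis unfolding YB_def by (auto simp: mids_def)
  next
    case 3
    have m: "mids (a + int k) (b + int n) = {b + int n}" using 3 mids_simps(2) by simp
    have c: "col_wt t k n b (b + int n) = 1" by (subst col_wt_eq[where m = n]) (auto simp: row_wt_def 3)
    have "W (b + int n) = z powi (b + int n) * V b" "W' (b + int n) = z powi (b + int n) * V' b"
      using W[unfolded 3(1) sum_mids, of "b + int n"] W'[unfolded 3(1) sum_mids, of "b + int n"] m 3 c by (simp_all add: sum_mids)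
    moreover have "(z - t) * V b = C * V' b" using YB 3 by (simp add: YB_def)
    ultimately show ?thesis unfolding YB_def using 3 by simp
  next
    case 4
    have m: "mids (a + int k) (b + int n) = {b + int n, b + int n + 1}" using 4 mids_simps(3)[of "b + int n"] by (simp add: add_ac)
    have c: "col_wt t k n b (b + int n) = 1" "col_wt t k n b (b + int n + 1) = 1"
      by (subst col_wt_eq[where m = n], simp_all add: row_wt_def 4) (subst col_wt_eq[where m = "n + 1"], simp_all add: row_wt_def 4)
    have w: "W (b + int n) = z powi (b + int n) * V b" "W' (b + int n) = z powi (b + int n) * z * V' b"
      "W (b + int n + 1) = z powi (b + int n) * z * V b" "W' (b + int n + 1) = z powi (b + int n) * V' b"
      using W[unfolded 4(1) sum_mids, of "b + int n"] W'[unfolded 4(1) sum_mids, of "b + int n"] W[unfolded 4(1) sum_mids, of "b + int n + 1"] W'[unfolded 4(1) sum_mids, of "b + int n + 1"] m 4 c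
      by (simp_all add: z1[symmetric] add_ac)
    have e: "C * (x * V' b) = x * ((z - t) * V b)" for x using YB 4 by (simp add: YB_def mult.left_commute)
    \<comment> \<open>From one height to two: the matrix sends the vector \<open>(1, z)\<close> to
      \<open>z - t\<close> times \<open>(z, 1)\<close>.\<close>
    have g: "(1 - t) * z * W (b + int n) + (z - 1) * W (b + int n + 1) = C * W' (b + int n)"
      "t * (z - 1) * W (b + int n) + (1 - t) * W (b + int n + 1) = C * W' (b + int n + 1)"
      unfolding w e by (simp_all add: algebra_simps)
    have idx: "a + int k - 1 = b + int n" "a + int k = b + int n + 1" using 4 by simp_all
    show ?thesis unfolding YB_def idx using g by simp
  next
    case 5
    have m: "mids (a + int k) (b + int n) = {b + int n + 1}" using 5 mids_simps(1)[of "b + int n"] by (simp add: add_ac)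
    have c: "col_wt t k n b (b + int n + 1) = 1"
      by (subst col_wt_eq[where m = "n + 1"], simp_all add: row_wt_def 5)
    have "W (b + int n + 1) = z powi (b + int n + 1) * V b" "W' (b + int n + 1) = z powi (b + int n + 1) * V' b"
      using W[unfolded 5(1) sum_mids, of "b + int n + 1"] W'[unfolded 5(1) sum_mids, of "b + int n + 1"] m 5 c
      by (simp_all add: add_ac)
    moreover have "(z - t) * V b = C * V' b" using YB 5 by (simp add: YB_def)
    ultimately show ?thesis unfolding YB_def using 5
      by (simp add: add_ac)
  next
    case 6
    have m: "mids (a + int k) (b + int n) = {b + int k + 1}" using 6 mids_simps(2)[of "b + int k + 1"] by (simp add: add_ac)
    have c: "col_wt t k n b (b + int k + 1) = (1 - t ^ n)" "col_wt t k n (b + 1) (b + int k + 1) = (1 - t ^ n)"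
      by (subst col_wt_eq[where m = "k + 1"], simp_all add: row_wt_def 6) (subst col_wt_eq[where m = "k"], simp_all add: row_wt_def 6)
    have "W (b + int k + 1) = z powi (b + int k + 1) * (1 - t ^ n) * (V b + V (b + 1))"
      "W' (b + int k + 1) = z powi (b + int k + 1) * (1 - t ^ n) * (V' b + V' (b + 1))"
      using W[unfolded 6(1) sum_mids, of "b + int k + 1"] W'[unfolded 6(1) sum_mids, of "b + int k + 1"] m 6 c
      by (simp_all add: add_ac distrib_left distrib_right mult_ac)
    moreover have "(1 - t) * z * V b + (z - 1) * V (b + 1) = C * V' b" "t * (z - 1) * V b + (1 - t) * V (b + 1) = C * V' (b + 1)"
      using YB 6 by (simp_all add: YB_def)
    \<comment> \<open>From two heights to one: both column sums of the matrix equal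
      \<open>z - t\<close>, so adding the two relations gives the scalar one.\<close>
    then have "(z - t) * (V b + V (b + 1)) = C * (V' b + V' (b + 1))" unfolding distrib_left by (simp add: algebra_simps)
    ultimately show ?thesis unfolding YB_def using 6
      by (simp add: add_ac)
  next
    case 7
    \<comment> \<open>The genuine matrix case: the transfer matrix has rows
      \<open>(1, 1 - t ^ n)\<close> and \<open>(1 - t ^ (n + 1), 1)\<close>, and it is intertwined
      with the factors \<open>(1, z)\<close> and \<open>(z, 1)\<close> of the two sides.\<close>
    have m: "mids (a + int k) (b + int n) = {b + int n, b + int n + 1}" using 7 mids_simps(3)[of "b + int n"] by (simp add: add_ac)
    have c: "col_wt t k n b (b + int n) = 1" "col_wt t k n b (b + int n + 1) = 1 - t ^ (n + 1)"
      "col_wt t k n (b + 1) (b + int n + 1) = 1"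
      by (subst col_wt_eq[where m = n], simp_all add: row_wt_def 7)
        (subst col_wt_eq[where m = "n + 1"], simp_all add: row_wt_def 7,
         subst col_wt_eq[where m = "n"], simp_all add: row_wt_def 7)
    \<comment> \<open>For \<open>n = 0\<close> the path would have to descend, so this transition is
      absent; the entry \<open>1 - t ^ n\<close> is then zero and the formulas for \<open>W\<close>
      stay uniform.\<close>
    have c': "col_wt t k n (b + 1) (b + int n) = 1 - t ^ n" if "n > 0"
      using that by (subst col_wt_eq[where m = "n - 1"]) (auto simp: row_wt_def 7)
    have w1: "W (b + int n) = z powi (b + int n) * (V b + V (b + 1) * (1 - t ^ n))"
      "W' (b + int n) = z powi (b + int n) * z * (V' b + V' (b + 1) * (1 - t ^ n))"
      using W[unfolded 7(1) sum_mids, of "b + int n"] W'[unfolded 7(1) sum_mids, of "b + int n"] m 7 c c'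
      by (cases "n = 0"; simp add: z1[symmetric] add_ac)+
    have w2: "W (b + int n + 1) = z powi (b + int n) * z * (V b * (1 - t ^ (n + 1)) + V (b + 1))"
      "W' (b + int n + 1) = z powi (b + int n) * (V' b * (1 - t ^ (n + 1)) + V' (b + 1))"
      using W[unfolded 7(1) sum_mids, of "b + int n + 1"] W'[unfolded 7(1) sum_mids, of "b + int n + 1"] m 7 c
      by (simp_all add: z1[symmetric] add_ac)
    note w = w1 w2
    have YB': "C * V' b = (1 - t) * z * V b + (z - 1) * V (b + 1)" "C * V' (b + 1) = t * (z - 1) * V b + (1 - t) * V (b + 1)"
      using YB 7 by (simp_all add: YB_def)
    have e: "C * (x * (V' b + V' (b + 1) * y)) = x * (((1 - t) * z * V b + (z - 1) * V (b + 1)) + (t * (z - 1) * V b + (1 - t) * V (b + 1)) * y)"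
      "C * (x * (V' b * y + V' (b + 1))) = x * (((1 - t) * z * V b + (z - 1) * V (b + 1)) * y + (t * (z - 1) * V b + (1 - t) * V (b + 1)))" for x y
      unfolding YB'[symmetric] by (simp_all add: algebra_simps)
    have g: "(1 - t) * z * W (b + int n) + (z - 1) * W (b + int n + 1) = C * W' (b + int n)"
      "t * (z - 1) * W (b + int n) + (1 - t) * W (b + int n + 1) = C * W' (b + int n + 1)"
      unfolding w e by (simp_all add: algebra_simps)
    have idx: "a + int k - 1 = b + int n" "a + int k = b + int n + 1" using 7 by simp_all
    show ?thesis unfolding YB_def idx using g by simp
  next
    case 8
    have m: "mids (a + int k) (b + int n) = {b + int n + 1}" using 8 mids_simps(1)[of "b + int n"] by (simp add: add_ac)
    have c: "col_wt t k n b (b + int n + 1) = 1" "col_wt t k n (b + 1) (b + int n + 1) = 1"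
      by (subst col_wt_eq[where m = "n + 1"], simp_all add: row_wt_def 8) (subst col_wt_eq[where m = "n"], simp_all add: row_wt_def 8)
    have "W (b + int n + 1) = z powi (b + int n + 1) * (V b + V (b + 1))"
      "W' (b + int n + 1) = z powi (b + int n + 1) * (V' b + V' (b + 1))"
      using W[unfolded 8(1) sum_mids, of "b + int n + 1"] W'[unfolded 8(1) sum_mids, of "b + int n + 1"] m 8 c
      by (simp_all add: add_ac distrib_left distrib_right mult_ac)
    moreover have "(1 - t) * z * V b + (z - 1) * V (b + 1) = C * V' b" "t * (z - 1) * V b + (1 - t) * V (b + 1) = C * V' (b + 1)"
      using YB 8 by (simp_all add: YB_def)
    then have "(z - t) * (V b + V (b + 1)) = C * (V' b + V' (b + 1))" unfolding distrib_left by (simp add: algebra_simps)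
    ultimately show ?thesis unfolding YB_def using 8
      by (simp add: add_ac)
  next
    case 9
    have m: "mids (a + int k) (b + int n) = {b + int k + 2}" using 9 mids_simps(2)[of "b + int k + 2"] by (simp add: add_ac)
    have c: "col_wt t k n (b + 1) (b + int k + 2) = (1 - t ^ (k + 1)) * (1 - t ^ n)"
      by (subst col_wt_eq[where m = "k + 1"], simp_all add: row_wt_def 9)
    have "W (b + int k + 2) = z powi (b + int k + 2) * (1 - t ^ (k + 1)) * (1 - t ^ n) * V (b + 1)"
      "W' (b + int k + 2) = z powi (b + int k + 2) * (1 - t ^ (k + 1)) * (1 - t ^ n) * V' (b + 1)"
      using W[unfolded 9(1) sum_mids, of "b + int k + 2"] W'[unfolded 9(1) sum_mids, of "b + int k + 2"] m 9 c
      by (simp_all add: add_ac mult_ac)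
    moreover have "(z - t) * V (b + 1) = C * V' (b + 1)" using YB 9 by (simp add: YB_def add_ac)
    ultimately show ?thesis unfolding YB_def using 9
      by (simp add: add_ac)
  next
    case 10
    have m: "mids (a + int k) (b + int n) = {b + int n, b + int n + 1}" using 10 mids_simps(3)[of "b + int n"] by (simp add: add_ac)
    have c: "col_wt t k n (b + 1) (b + int n) = 1 - t ^ n" "col_wt t k n (b + 1) (b + int n + 1) = 1 - t ^ n"
      by (subst col_wt_eq[where m = k], simp_all add: row_wt_def 10) (subst col_wt_eq[where m = "k + 1"], simp_all add: row_wt_def 10)
    have w: "W (b + int n) = z powi (b + int n) * (1 - t ^ n) * V (b + 1)" "W' (b + int n) = z powi (b + int n) * z * (1 - t ^ n) * V' (b + 1)"
      "W (b + int n + 1) = z powi (b + int n) * z * (1 - t ^ n) * V (b + 1)" "W' (b + int n + 1) = z powi (b + int n) * (1 - t ^ n) * V' (b + 1)"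
      using W[unfolded 10(1) sum_mids, of "b + int n"] W'[unfolded 10(1) sum_mids, of "b + int n"] W[unfolded 10(1) sum_mids, of "b + int n + 1"] W'[unfolded 10(1) sum_mids, of "b + int n + 1"] m 10 c
      by (simp_all add: z1[symmetric] add_ac)
    have e: "C * (x * V' (b + 1)) = x * ((z - t) * V (b + 1))" for x using YB 10 by (simp add: YB_def mult.left_commute add_ac)
    have g: "(1 - t) * z * W (b + int n) + (z - 1) * W (b + int n + 1) = C * W' (b + int n)"
      "t * (z - 1) * W (b + int n) + (1 - t) * W (b + int n + 1) = C * W' (b + int n + 1)"
      unfolding w e by (simp_all add: algebra_simps)
    have idx: "a + int k - 1 = b + int n" "a + int k = b + int n + 1" using 10 by simp_all
    show ?thesis unfolding YB_def idx using g by simp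
  next
    case 11
    have m: "mids (a + int k) (b + int n) = {b + int n + 1}" using 11 mids_simps(1)[of "b + int n"] by (simp add: add_ac)
    have c: "col_wt t k n (b + 1) (b + int n + 1) = 1" by (subst col_wt_eq[where m = n]) (auto simp: row_wt_def 11)
    have "W (b + int n + 1) = z powi (b + int n + 1) * V (b + 1)" "W' (b + int n + 1) = z powi (b + int n + 1) * V' (b + 1)"
      using W[unfolded 11(1) sum_mids, of "b + int n + 1"] W'[unfolded 11(1) sum_mids, of "b + int n + 1"] m 11 c by (simp_all add: add_ac)
    moreover have "(z - t) * V (b + 1) = C * V' (b + 1)" using YB 11 by (simp add: YB_def add_ac)
    ultimately show ?thesis unfolding YB_def using 11 by (simp add: add_ac)
  qed
qed

text \<open>
  The entries \<open>H\<close> and \<open>L\<close> at the ends of the window of values stand for the geometric series of all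
  entries beyond.
\<close>

definition end_wt :: "'k::field \<Rightarrow> int \<Rightarrow> int \<Rightarrow> int \<Rightarrow> int \<Rightarrow> int \<Rightarrow> 'k" where
  "end_wt z L H c u v = (if c = H \<and> u \<noteq> v then 1 / (1 - z) else 1) * (if c = L \<and> u \<noteq> v then 1 / (1 - 1 / z) else 1)"

text \<open>For \<open>p2 = p - 1\<close> the left end is unbounded above, and the starting vector
  is, up to a power of \<open>z\<close>, \<open>(1, (1 - t) * z / (1 - z))\<close> with the
  geometric series in its second entry. The intertwining matrix sends it to \<open>(0, C)\<close>,
  where \<open>C\<close> is this constant. Otherwise there is one height and the scalar
  \<open>z - t\<close> applies.\<close>

definition C_top :: "'k::field \<Rightarrow> 'k \<Rightarrow> int \<Rightarrow> int \<Rightarrow> 'k" where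
  "C_top t z p p2 = (if p2 = p - 1 then (z - t) * (1 - t * z) / (1 - z) else z - t)"

text \<open>For \<open>q2 = q - 1\<close> the functional that closes the sum has the entries
  \<open>(1 - t) / (1 - 1 / z)\<close> and \<open>1\<close>; multiplied by \<open>z - 1\<close> it
  becomes the first row of the intertwining matrix.\<close>

definition C_bot :: "'k::field \<Rightarrow> 'k \<Rightarrow> int \<Rightarrow> int \<Rightarrow> 'k" where
  "C_bot t z q q2 = (if q2 = q then z - t else z - 1)"

lemma row_wt_0: "row_wt t 0 0 = 1" "row_wt t 0 (Suc 0) = 1 - t" "row_wt t (Suc 0) 0 = 1"
  by (simp_all add: row_wt_def)

text \<open>The starting vectors at \<open>H\<close> satisfy the relation with the constant
  \<open>C_top\<close>, \<open>YB_step\<close> carries it down to \<open>L + 1\<close>, and the last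
  step pairs it with the closing functional. The outer heights are constant near the ends of the
  window, so the transfers at \<open>H\<close> and \<open>L\<close> have
  \<open>k = n = 0\<close>.\<close>

lemma amplitude_identity:
  fixes t z :: "'k::field" and Pl Pn :: "int \<Rightarrow> int"
  assumes z: "z \<noteq> 0" "z \<noteq> 1" and LH: "L < H"
    and anti: "antimono Pl" "antimono Pn"
    and top: "\<And>c. c \<ge> H \<Longrightarrow> Pl c = p" "\<And>c. c \<ge> H \<Longrightarrow> Pn c = p2" "p2 = p - 1 \<or> p2 = p - 2"
    and bot: "\<And>c. c \<le> L + 1 \<Longrightarrow> Pl c = q + 1" "\<And>c. c \<le> L + 1 \<Longrightarrow> Pn c = q2 + 1" "q2 = q \<or> q2 = q - 1"
  defines "S \<equiv> \<lambda>c. mids (Pl c) (Pn c)"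
    and "wb \<equiv> \<lambda>c. col_wt t (nat (Pl c - Pl (c + 1))) (nat (Pn c - Pn (c + 1)))"
  shows "C_bot t z q q2 * path_amp S (\<lambda>c u v. z powi u * wb c u v * end_wt z L H c u v) (p - 1) H (nat (H + 1 - L)) (q + 1) =
    C_top t z p p2 * path_amp S (\<lambda>c u v. z powi (Pl (c + 1) + Pn (c + 1) - u) * wb c u v) (p2 + 1) H (nat (H + 1 - L)) (q2 + 1)"
proof -
  define A where "A = path_amp S (\<lambda>c u v. z powi u * wb c u v * end_wt z L H c u v) (p - 1) H"
  define A' where "A' = path_amp S (\<lambda>c u v. z powi (Pl (c + 1) + Pn (c + 1) - u) * wb c u v) (p2 + 1) H"
  \<comment> \<open>The power of \<open>z\<close> belonging to the next transfer step is attached to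
    the vector in advance, which is the normalization of \<open>YB_step\<close>.\<close>
  define V where "V k v = z powi v * A k v" for k v
  define V' where "V' k v = z powi (Pl (H + 1 - int k) + Pn (H + 1 - int k) - v) * A' k v" for k v
  let ?C = "C_top t z p p2"
  have A_Suc: "A (Suc k) v = (\<Sum>u\<in>{u\<in>S (H + 1 - int k). u \<le> v}. V k u * wb (H - int k) u v * end_wt z L H (H - int k) u v)"
    if "v \<in> S (H - int k)" for k v
    using that unfolding A_def V_def by (simp add: mult_ac)
  have A'_Suc: "A' (Suc k) v = (\<Sum>u\<in>{u\<in>S (H + 1 - int k). u \<le> v}. V' k u * wb (H - int k) u v)"
    if "v \<in> S (H - int k)" for k v
  proof -
    have hk: "H - int k + 1 = H + 1 - int k" by simp
    show ?thesis using that unfolding A'_def V'_def by (simp add: mult_ac hk)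
  qed
  have VS: "V (Suc k) v = z powi v * A (Suc k) v" "V' (Suc k) v = z powi (Pl (H - int k) + Pn (H - int k) - v) * A' (Suc k) v" for k v
    by (simp_all add: V_def V'_def)
  have z1: "z powi (x + 1) = z powi x * z" for x using z by (simp add: power_int_add)
  have YB: "YB t z ?C (Pl (H - int k)) (Pn (H - int k)) (V (Suc k)) (V' (Suc k))" if "H - int k > L" for k
    using that
  proof (induction k)
    case 0
    have S0: "S H = mids p p2" "S (H + 1) = mids p p2" by (simp_all add: S_def top)
    have V0: "V 0 u = (if u = p - 1 then z powi u else 0)" "V' 0 u = (if u = p2 + 1 then z powi (p + p2 - u) else 0)" for u
      by (simp_all add: V_def V'_def A_def A'_def top)
    have wb0: "wb H = col_wt t 0 0" by (simp add: wb_def top)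
    have a1: "A 1 v = (\<Sum>u\<in>{u\<in>mids p p2. u \<le> v}. V 0 u * col_wt t 0 0 u v * end_wt z L H H u v)"
      and a2: "A' 1 v = (\<Sum>u\<in>{u\<in>mids p p2. u \<le> v}. V' 0 u * col_wt t 0 0 u v)" if "v \<in> mids p p2" for v
      using A_Suc[of v 0] A'_Suc[of v 0] that by (simp_all add: S0 wb0)
    have v1: "V 1 v = z powi v * A 1 v" "V' 1 v = z powi (p + p2 - v) * A' 1 v" for v
      using VS[of 0 v] by (simp_all add: top)
    show ?case
    proof (cases "p2 = p - 1")
      case True
      \<comment> \<open>The unprimed paths start at the lower of the two heights and may rise at
        \<open>H\<close>, with the geometric factor; the primed ones start at the upper height and
        stay there, hence the zero in \<open>V'1\<close>.\<close>
      then have p: "p = p2 + 1" by simp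
      have c: "col_wt t 0 0 p2 p2 = 1" "col_wt t 0 0 p2 (p2 + 1) = 1 - t" "col_wt t 0 0 (p2 + 1) (p2 + 1) = 1"
        by (simp_all add: col_wt_def row_wt_0)
      have e: "end_wt z L H H p2 p2 = 1" "end_wt z L H H p2 (p2 + 1) = 1 / (1 - z)"
        using LH by (simp_all add: end_wt_def)
      have mem: "p2 \<in> mids p p2" "p2 + 1 \<in> mids p p2" using p by (auto simp: mids_def)
      have V1: "V 1 p2 = z powi p2 * z powi p2" "V 1 (p2 + 1) = z powi p2 * z * z powi p2 * (1 - t) / (1 - z)"
        unfolding v1 a1[OF mem(1)] a1[OF mem(2)] unfolding p sum_mids V0 z1[symmetric] by (simp_all add: p c e)
      have V'1: "V' 1 p2 = 0" "V' 1 (p2 + 1) = z powi p2 * z powi p2"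
        unfolding v1 a2[OF mem(1)] a2[OF mem(2)] unfolding p sum_mids V0 by (simp_all add: p c e)
      have C: "?C = (z - t) * (1 - t * z) / (1 - z)" using True by (simp add: C_top_def)
      have z': "1 - z \<noteq> 0" using z(2) by simp
      have "(1 - t) * z * V 1 p2 + (z - 1) * V 1 (p2 + 1) = ?C * V' 1 p2"
        unfolding V1 V'1 C using z' by (simp add: field_simps)
      moreover have "t * (z - 1) * V 1 p2 + (1 - t) * V 1 (p2 + 1) = ?C * V' 1 (p2 + 1)"
        unfolding V1 V'1 C using z' by (simp add: field_simps)
      ultimately show ?thesis unfolding YB_def by (simp add: top p)
    next
      case False
      then have p: "p = p2 + 2" using top(3) by simp
      have c: "col_wt t 0 0 (p2 + 1) (p2 + 1) = 1" "end_wt z L H H (p2 + 1) (p2 + 1) = 1"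
        by (simp_all add: col_wt_def row_wt_0 end_wt_def)
      have mem: "p2 + 1 \<in> mids p p2" using p by (auto simp: mids_def)
      have V1: "V 1 (p2 + 1) = z powi (p2 + 1) * z powi (p2 + 1)"
        unfolding v1 a1[OF mem] unfolding p sum_mids V0 by (simp add: p c)
      have V'1: "V' 1 (p2 + 1) = z powi (p2 + 1) * z powi (p2 + 1)"
        unfolding v1 a2[OF mem] unfolding p sum_mids V0 by (simp add: p c)
      have "(z - t) * V 1 (p2 + 1) = ?C * V' 1 (p2 + 1)" using False V1 V'1 by (simp add: C_top_def)
      then show ?thesis unfolding YB_def by (simp add: top p add.commute)
    qed
  next
    case (Suc k)
    define c where "c = H - int (Suc k)"
    have c: "H - int k = c + 1" "H + 1 - int (Suc k) = c + 1" "c \<noteq> H" "c \<noteq> L" using Suc.prems by (auto simp: c_def)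
    have IH: "YB t z ?C (Pl (c + 1)) (Pn (c + 1)) (V (Suc k)) (V' (Suc k))" using Suc c(1) by simp
    have k: "Pl (c + 1) + int (nat (Pl c - Pl (c + 1))) = Pl c" "Pn (c + 1) + int (nat (Pn c - Pn (c + 1))) = Pn c"
      using antimonoD[OF anti(1), of c "c + 1"] antimonoD[OF anti(2), of c "c + 1"] by auto
    have "YB t z ?C (Pl (c + 1) + int (nat (Pl c - Pl (c + 1)))) (Pn (c + 1) + int (nat (Pn c - Pn (c + 1)))) (V (Suc (Suc k))) (V' (Suc (Suc k)))"
    proof (rule YB_step[OF IH z(1)])
      fix v assume v: "v \<in> mids (Pl (c + 1) + int (nat (Pl c - Pl (c + 1)))) (Pn (c + 1) + int (nat (Pn c - Pn (c + 1))))"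
      then have v': "v \<in> S (H - int (Suc k))" unfolding k S_def by (simp only: flip: c_def)
      have "V (Suc (Suc k)) v = z powi v * A (Suc (Suc k)) v" by (rule VS)
      also have "A (Suc (Suc k)) v = (\<Sum>u\<in>{u\<in>S (c + 1). u \<le> v}. V (Suc k) u * wb c u v * end_wt z L H c u v)"
        using A_Suc[OF v'] unfolding c(2) by (simp only: flip: c_def)
      also have "\<dots> = (\<Sum>u\<in>{u\<in>S (c + 1). u \<le> v}. V (Suc k) u * wb c u v)" using c by (simp add: end_wt_def)
      finally show "V (Suc (Suc k)) v = z powi v * (\<Sum>u\<in>{u\<in>mids (Pl (c + 1)) (Pn (c + 1)). u \<le> v}. V (Suc k) u *
          col_wt t (nat (Pl c - Pl (c + 1))) (nat (Pn c - Pn (c + 1))) u v)"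
        unfolding S_def wb_def .
      have "V' (Suc (Suc k)) v = z powi (Pl c + Pn c - v) * A' (Suc (Suc k)) v" using VS(2)[of "Suc k" v] by (simp only: flip: c_def)
      also have "A' (Suc (Suc k)) v = (\<Sum>u\<in>{u\<in>S (c + 1). u \<le> v}. V' (Suc k) u * wb c u v)"
        using A'_Suc[OF v'] unfolding c(2) by (simp only: flip: c_def)
      finally show "V' (Suc (Suc k)) v = z powi (Pl (c + 1) + int (nat (Pl c - Pl (c + 1))) + (Pn (c + 1) + int (nat (Pn c - Pn (c + 1)))) - v) * (\<Sum>u\<in>{u\<in>mids (Pl (c + 1)) (Pn (c + 1)). u \<le> v}. V' (Suc k) u *
          col_wt t (nat (Pl c - Pl (c + 1))) (nat (Pn c - Pn (c + 1))) u v)"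
        unfolding S_def wb_def k .
    qed
    then show ?case unfolding k by (simp only: flip: c_def)
  qed
  define k where "k = nat (H - L)"
  have k: "H - int k = L" "H + 1 - int k = L + 1" "nat (H + 1 - L) = Suc k" using LH by (auto simp: k_def)
  obtain k' where k': "k = Suc k'" "H - int k' = L + 1" using LH by (cases k) (auto simp: k_def)
  have YBL: "YB t z ?C (q + 1) (q2 + 1) (V k) (V' k)"
    using YB[of k'] k' by (simp add: bot)
  have SL: "S L = mids (q + 1) (q2 + 1)" "S (L + 1) = mids (q + 1) (q2 + 1)" "wb L = col_wt t 0 0" by (simp_all add: S_def bot wb_def)
  have a1: "A (Suc k) v = (\<Sum>u\<in>{u\<in>mids (q + 1) (q2 + 1). u \<le> v}. V k u * col_wt t 0 0 u v * end_wt z L H L u v)"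
      and a2: "A' (Suc k) v = (\<Sum>u\<in>{u\<in>mids (q + 1) (q2 + 1). u \<le> v}. V' k u * col_wt t 0 0 u v)" if "v \<in> mids (q + 1) (q2 + 1)" for v
    using A_Suc[of v k] A'_Suc[of v k] that unfolding k by (simp_all add: SL)
  have "C_bot t z q q2 * A (Suc k) (q + 1) = ?C * A' (Suc k) (q2 + 1)"
  proof (cases "q2 = q")
    case True
    have mem: "q + 1 \<in> mids (q + 1) (q2 + 1)" "q2 + 1 \<in> mids (q + 1) (q2 + 1)" using True by (auto simp: mids_def)
    have "A (Suc k) (q + 1) = V k (q + 1)" unfolding a1[OF mem(1)] unfolding True sum_mids by (simp add: col_wt_def row_wt_0 end_wt_def)
    moreover have "A' (Suc k) (q2 + 1) = V' k (q + 1)" unfolding a2[OF mem(2)] unfolding True sum_mids by (simp add: col_wt_def row_wt_0)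
    ultimately show ?thesis using YBL True by (simp add: YB_def C_bot_def)
  next
    case False
    then have q: "q = q2 + 1" using bot(3) by simp
    have mem: "q + 1 \<in> mids (q + 1) (q2 + 1)" "q2 + 1 \<in> mids (q + 1) (q2 + 1)" using q by (auto simp: mids_def)
    have "A (Suc k) (q + 1) = V k (q2 + 1) * (1 - t) / (1 - 1 / z) + V k (q2 + 1 + 1)"
      unfolding a1[OF mem(1)] unfolding q sum_mids using LH by (simp add: col_wt_def row_wt_0 end_wt_def)
    moreover have "A' (Suc k) (q2 + 1) = V' k (q2 + 1)"
      unfolding a2[OF mem(2)] unfolding q sum_mids by (simp add: col_wt_def row_wt_0)
    moreover have "(1 - t) * z * V k (q2 + 1) + (z - 1) * V k (q2 + 1 + 1) = ?C * V' k (q2 + 1)"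
      using YBL by (simp add: YB_def q add.commute)
    moreover have "(z - 1) / (1 - 1 / z) = z" using z by (simp add: field_simps)
    then have "(z - 1) * (x * (1 - t) / (1 - 1 / z)) = (1 - t) * z * x" for x
      by (metis mult.assoc mult.commute times_divide_eq_left times_divide_eq_right)
    ultimately show ?thesis using False by (simp add: C_bot_def distrib_left)
  qed
  then show ?thesis unfolding k A_def A'_def .
qed

section \<open>Exchange of two steps\<close>

definition interlaced :: "int \<Rightarrow> int \<Rightarrow> int \<Rightarrow> int \<Rightarrow> (int \<Rightarrow> int) \<Rightarrow> (int \<Rightarrow> int) \<Rightarrow> bool" where
  "interlaced p q p' q' l m \<longleftrightarrow>
    (\<forall>j. p \<le> j \<and> j \<le> q \<and> p' \<le> j \<and> j \<le> q' \<longrightarrow> m j \<le> l j) \<and>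
    (\<forall>j. p' \<le> j \<and> j \<le> q' \<and> p \<le> j + 1 \<and> j + 1 \<le> q \<longrightarrow> l (j + 1) \<le> m j)"

text \<open>Only values of the lower row enter the product: for the others \<open>m = 0\<close>,
  where \<open>row_wt\<close> is \<open>1\<close>.\<close>

definition pair_wt :: "'k::field \<Rightarrow> int \<Rightarrow> int \<Rightarrow> int \<Rightarrow> int \<Rightarrow> (int \<Rightarrow> int) \<Rightarrow> (int \<Rightarrow> int) \<Rightarrow> 'k" where
  "pair_wt t p q p' q' l m = (if interlaced p q p' q' l m
    then \<Prod>c\<in>m ` {p'..q'}. row_wt t (card {j\<in>{p..q}. l j = c}) (card {j\<in>{p'..q'}. m j = c}) else 0)"

text \<open>The four ways in which consecutive rows of an ordinary subgraph can lie; the row grows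
  exactly for \<open>p' = p - 1\<close> and \<open>q' = q\<close>.\<close>

definition steps :: "int \<Rightarrow> int \<Rightarrow> int \<Rightarrow> int \<Rightarrow> bool" where
  "steps p q p' q' \<longleftrightarrow> (p' = p \<or> p' = p - 1) \<and> (q' = q \<or> q' = q - 1)"

definition dec_on :: "int \<Rightarrow> int \<Rightarrow> (int \<Rightarrow> int) \<Rightarrow> bool" where
  "dec_on p q l \<longleftrightarrow> (\<forall>j k. p \<le> j \<and> j \<le> k \<and> k \<le> q \<longrightarrow> l k \<le> l j)"

lemma dec_onI:
  assumes "\<And>j. p \<le> j \<Longrightarrow> j + 1 \<le> q \<Longrightarrow> l (j + 1) \<le> l j"
  shows "dec_on p q l"
  unfolding dec_on_def
proof (intro allI impI)
  fix j k assume *: "p \<le> j \<and> j \<le> k \<and> k \<le> q"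
  then have "j \<le> k" "p \<le> j" by auto
  then have "k \<le> q \<longrightarrow> l k \<le> l j"
  proof (induction k rule: int_ge_induct)
    case (step i)
    then show ?case using assms[of i] by auto
  qed simp
  then show "l k \<le> l j" using * by simp
qed

text \<open>Between two adjacent entries of either row lies an entry of the other one;
  \<open>steps\<close> guarantees that its column exists.\<close>

lemma interlaced_dec:
  assumes "steps p q p' q'" "interlaced p q p' q' l m"
  shows "dec_on p q l" "dec_on p' q' m"
proof -
  show "dec_on p q l"
  proof (rule dec_onI)
    fix j assume "p \<le> j" "j + 1 \<le> q"
    then have "m j \<le> l j" "l (j + 1) \<le> m j" using assms by (auto simp: interlaced_def steps_def)
    then show "l (j + 1) \<le> l j" by simp
  qed
  show "dec_on p' q' m"
  proof (rule dec_onI)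
    fix j assume "p' \<le> j" "j + 1 \<le> q'"
    then have "m (j + 1) \<le> l (j + 1)" "l (j + 1) \<le> m j" using assms by (auto simp: interlaced_def steps_def)
    then show "m (j + 1) \<le> m j" by simp
  qed
qed

section \<open>Rows encoded by heights\<close>

text \<open>
  A weakly decreasing row \<open>m\<close> on the columns \<open>p..q\<close> is encoded by its heights: \<open>rc p q m c\<close> is the
  first column whose entry is less than \<open>c\<close>. Two rows interlace iff their heights at every \<open>c\<close> differ
  by \<open>0\<close> or \<open>1\<close>, so that the row between two given ones is a path with at most two choices at each \<open>c\<close>.
\<close>

definition rc :: "int \<Rightarrow> int \<Rightarrow> (int \<Rightarrow> int) \<Rightarrow> int \<Rightarrow> int" where
  "rc p q m c = p + int (card {j\<in>{p..q}. m j \<ge> c})"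

lemma initial_segment:
  fixes A :: "int set"
  assumes "A \<subseteq> {p..q}" "\<And>j k. k \<in> A \<Longrightarrow> p \<le> j \<Longrightarrow> j \<le> k \<Longrightarrow> j \<in> A"
  shows "A = {p..<p + int (card A)}"
proof (cases "A = {}")
  case False
  have fin: "finite A" using assms(1) finite_subset by blast
  define M where "M = Max A"
  have A: "A = {p..M}"
  proof
    show "A \<subseteq> {p..M}" using fin assms(1) by (auto simp: M_def)
    show "{p..M} \<subseteq> A" using assms(2)[OF Max_in[OF fin False]] by (auto simp: M_def)
  qed
  have "p \<le> M" using Max_in[OF fin False] assms(1) by (auto simp: M_def)
  then have "{p..M} = {p..<p + int (card {p..M})}" by auto
  then show ?thesis by (simp only: flip: A)
qed simp

text \<open>The columns with entries at least \<open>c\<close> form an initial segment of a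
  decreasing row, so heights and entries determine each other by this adjunction.\<close>

lemma rc_less_iff:
  assumes "dec_on p q m" "p \<le> j" "j \<le> q"
  shows "j < rc p q m c \<longleftrightarrow> c \<le> m j"
proof -
  let ?A = "{j\<in>{p..q}. m j \<ge> c}"
  have "?A = {p..<rc p q m c}" unfolding rc_def
  proof (rule initial_segment)
    fix i k assume "k \<in> ?A" "p \<le> i" "i \<le> k"
    then show "i \<in> ?A" using assms(1) unfolding dec_on_def by (auto intro: order_trans)
  qed auto
  then have "j \<in> ?A \<longleftrightarrow> j \<in> {p..<rc p q m c}" by simp
  then show ?thesis using assms by auto
qed

lemma rc_bounds:
  assumes "p \<le> q + 1" shows "p \<le> rc p q m c \<and> rc p q m c \<le> q + 1"
proof -
  have "card {j\<in>{p..q}. m j \<ge> c} \<le> card {p..q}" by (rule card_mono) auto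
  then show ?thesis using assms by (simp add: rc_def)
qed

lemma rc_antimono: "antimono (rc p q m)"
proof (rule antimonoI)
  fix x y :: int assume "x \<le> y"
  then have "card {j\<in>{p..q}. m j \<ge> y} \<le> card {j\<in>{p..q}. m j \<ge> x}"
    by (intro card_mono finite_subset[of "{j\<in>{p..q}. m j \<ge> x}" "{p..q}"]) auto
  then show "rc p q m y \<le> rc p q m x" by (simp add: rc_def)
qed

lemma rc_top: "(\<And>j. p \<le> j \<Longrightarrow> j \<le> q \<Longrightarrow> m j < c) \<Longrightarrow> rc p q m c = p"
  unfolding rc_def by (auto simp: not_le[symmetric] card_eq_0_iff)

lemma rc_bot: "p \<le> q + 1 \<Longrightarrow> (\<And>j. p \<le> j \<Longrightarrow> j \<le> q \<Longrightarrow> m j \<ge> c) \<Longrightarrow> rc p q m c = q + 1"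
proof -
  assume "p \<le> q + 1" "\<And>j. p \<le> j \<Longrightarrow> j \<le> q \<Longrightarrow> m j \<ge> c"
  moreover from this have "{j\<in>{p..q}. m j \<ge> c} = {p..q}" by auto
  ultimately show ?thesis by (simp add: rc_def)
qed

lemma card_level: "card {j\<in>{p..q}. m j = c} = nat (rc p q m c - rc p q m (c + 1))"
proof -
  have "{j\<in>{p..q}. m j \<ge> c} = {j\<in>{p..q}. m j = c} \<union> {j\<in>{p..q}. m j \<ge> c + 1}" by auto
  moreover have "finite {j\<in>{p..q}. m j = c}" "finite {j\<in>{p..q}. m j \<ge> c + 1}"
    by (rule finite_subset[of _ "{p..q}"]; auto)+
  ultimately have "card {j\<in>{p..q}. m j \<ge> c} = card {j\<in>{p..q}. m j = c} + card {j\<in>{p..q}. m j \<ge> c + 1}"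
    using card_Un_disjoint[of "{j\<in>{p..q}. m j = c}" "{j\<in>{p..q}. m j \<ge> c + 1}"] by (simp add: disjoint_iff)
  then show ?thesis by (simp add: rc_def)
qed

text \<open>A wrong difference of heights exhibits a column in which an inequality fails, and
  \<open>steps\<close> keeps this column inside both rows. Conversely, choosing \<open>c\<close> as
  one of the entries turns the comparison of heights into the inequality for it.\<close>

lemma interlaced_iff_rc:
  assumes l: "dec_on p q l" and m: "dec_on p' q' m" and s: "steps p q p' q'" and pq: "p \<le> q + 1" "p' \<le> q' + 1"
  shows "interlaced p q p' q' l m \<longleftrightarrow> (\<forall>c. rc p' q' m c = rc p q l c - 1 \<or> rc p' q' m c = rc p q l c)"
proof
  assume i: "interlaced p q p' q' l m"
  show "\<forall>c. rc p' q' m c = rc p q l c - 1 \<or> rc p' q' m c = rc p q l c"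
  proof
    fix c
    let ?A = "rc p q l c" and ?B = "rc p' q' m c"
    note b = rc_bounds[OF pq(1), of l c] rc_bounds[OF pq(2), of m c]
    have "?B \<le> ?A"
    proof (rule ccontr)
      assume "\<not> ?B \<le> ?A"
      then have a: "?A < ?B" "p' \<le> ?A" "?A \<le> q'" "?A \<le> q" "p \<le> ?A" using b s by (auto simp: steps_def)
      then have "c \<le> m ?A" using rc_less_iff[OF m, of ?A c] by simp
      also have "m ?A \<le> l ?A" using i a by (simp add: interlaced_def)
      finally show False using rc_less_iff[OF l, of ?A c] a by simp
    qed
    moreover have "?A - 1 \<le> ?B"
    proof (rule ccontr)
      assume "\<not> ?A - 1 \<le> ?B"
      then have a: "?B + 1 < ?A" "p' \<le> ?B" "?B \<le> q'" "?B + 1 \<le> q" "p \<le> ?B + 1" using b s by (auto simp: steps_def)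
      then have "c \<le> l (?B + 1)" using rc_less_iff[OF l, of "?B + 1" c] by simp
      also have "l (?B + 1) \<le> m ?B" using i a by (simp add: interlaced_def)
      finally show False using rc_less_iff[OF m, of ?B c] a by simp
    qed
    ultimately show "?B = ?A - 1 \<or> ?B = ?A" by linarith
  qed
next
  assume r: "\<forall>c. rc p' q' m c = rc p q l c - 1 \<or> rc p' q' m c = rc p q l c"
  show "interlaced p q p' q' l m" unfolding interlaced_def
  proof (intro conjI allI impI)
    fix j assume j: "p \<le> j \<and> j \<le> q \<and> p' \<le> j \<and> j \<le> q'"
    then have "j < rc p' q' m (m j)" using rc_less_iff[OF m] by simp
    then have "j < rc p q l (m j)" using r[rule_format, of "m j"] by auto
    then show "m j \<le> l j" using rc_less_iff[OF l] j by simp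
  next
    fix j assume j: "p' \<le> j \<and> j \<le> q' \<and> p \<le> j + 1 \<and> j + 1 \<le> q"
    then have "j + 1 < rc p q l (l (j + 1))" using rc_less_iff[OF l] by simp
    then have "j < rc p' q' m (l (j + 1))" using r[rule_format, of "l (j + 1)"] by auto
    then show "l (j + 1) \<le> m j" using rc_less_iff[OF m] j by simp
  qed
qed

section \<open>Rows with entries in a window as lattice paths\<close>

definition bounded_rows :: "int \<Rightarrow> int \<Rightarrow> int \<Rightarrow> int \<Rightarrow> (int \<Rightarrow> int) set" where
  "bounded_rows p q L H = {m. (\<forall>j. j \<in> {p..q} \<longrightarrow> m j \<in> {L..H}) \<and> (\<forall>j. j \<notin> {p..q} \<longrightarrow> m j = 0)}"

text \<open>The inverse of \<open>rc\<close> on decreasing rows: an entry is recovered by counting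
  the values whose height lies beyond its column.\<close>

definition row_of :: "int \<Rightarrow> int \<Rightarrow> int \<Rightarrow> int \<Rightarrow> (int \<Rightarrow> int) \<Rightarrow> int \<Rightarrow> int" where
  "row_of p q L H f j = (if j \<in> {p..q} then L + int (card {c\<in>{L + 1..H}. j < f c}) else 0)"

lemma finite_bounded_rows: "finite (bounded_rows p q L H)"
  using finite_set_of_finite_funs[of "{p..q}" "{L..H}" 0] unfolding bounded_rows_def
  by (rule finite_subset[rotated]) auto

lemma row_of_ge_iff:
  assumes "antimono f" "\<And>c. c > H \<Longrightarrow> f c = p" "\<And>c. c \<le> L \<Longrightarrow> f c = q + 1" "L \<le> H" "p \<le> j" "j \<le> q"
  shows "c \<le> row_of p q L H f j \<longleftrightarrow> j < f c" "L \<le> row_of p q L H f j" "row_of p q L H f j \<le> H"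
proof -
  let ?A = "{c\<in>{L + 1..H}. j < f c}"
  have A: "?A = {L + 1..<L + 1 + int (card ?A)}"
  proof (rule initial_segment)
    fix d k assume "k \<in> ?A" "L + 1 \<le> d" "d \<le> k"
    then show "d \<in> ?A" using antimonoD[OF assms(1), of d k] by auto
  qed auto
  have r: "row_of p q L H f j = L + int (card ?A)" using assms by (simp add: row_of_def)
  have "card ?A \<le> card {L + 1..H}" by (rule card_mono) auto
  then show "L \<le> row_of p q L H f j" "row_of p q L H f j \<le> H" using r assms(4) by auto
  note this
  moreover have "c \<in> ?A \<longleftrightarrow> c \<in> {L + 1..<L + 1 + int (card ?A)}" using A by simp
  moreover have "c \<le> L \<Longrightarrow> j < f c" using assms by auto
  moreover have "c > H \<Longrightarrow> \<not> j < f c" using assms by auto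
  ultimately show "c \<le> row_of p q L H f j \<longleftrightarrow> j < f c" unfolding r by auto
qed

lemma row_of_path:
  assumes f: "antimono f" "\<And>c. c > H \<Longrightarrow> f c = p" "\<And>c. c \<le> L \<Longrightarrow> f c = q + 1" and "L \<le> H" "p \<le> q + 1"
  shows "row_of p q L H f \<in> bounded_rows p q L H" "dec_on p q (row_of p q L H f)" "rc p q (row_of p q L H f) = f"
proof -
  note ge = row_of_ge_iff[OF f \<open>L \<le> H\<close>]
  show "row_of p q L H f \<in> bounded_rows p q L H" using ge(2,3) by (auto simp: bounded_rows_def row_of_def)
  show "dec_on p q (row_of p q L H f)" unfolding dec_on_def
  proof (intro allI impI)
    fix j k assume jk: "p \<le> j \<and> j \<le> k \<and> k \<le> q"
    have "k < f (row_of p q L H f k)" using ge(1)[of k "row_of p q L H f k"] jk by simp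
    then show "row_of p q L H f k \<le> row_of p q L H f j" using ge(1)[of j "row_of p q L H f k"] jk by simp
  qed
  show "rc p q (row_of p q L H f) = f"
  proof
    fix c
    have fb: "p \<le> f c" "f c \<le> q + 1"
      using antimonoD[OF f(1), of c "max c (H + 1)"] antimonoD[OF f(1), of "min c L" c] f(2)[of "max c (H + 1)"] f(3)[of "min c L"] by auto
    have "{j\<in>{p..q}. row_of p q L H f j \<ge> c} = {p..<f c}" using ge(1) fb by auto
    then show "rc p q (row_of p q L H f) c = f c" using fb by (simp add: rc_def)
  qed
qed

lemma row_of_rc:
  assumes "m \<in> bounded_rows p q L H" "dec_on p q m" "L \<le> H"
  shows "row_of p q L H (rc p q m) = m"
proof
  fix j
  show "row_of p q L H (rc p q m) j = m j"
  proof (cases "j \<in> {p..q}")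
    case True
    then have "L \<le> m j" "m j \<le> H" using assms(1) by (auto simp: bounded_rows_def)
    moreover have iff: "j < rc p q m c \<longleftrightarrow> c \<le> m j" for c using rc_less_iff[OF assms(2)] True by simp
    ultimately have "{c\<in>{L + 1..H}. j < rc p q m c} = {L + 1..m j}" unfolding iff by auto
    then show ?thesis using True \<open>L \<le> m j\<close> by (simp add: row_of_def)
  qed (use assms(1) in \<open>auto simp: row_of_def bounded_rows_def\<close>)
qed

text \<open>The layer-cake formula. It turns \<open>z\<close> to the row sum into a product over
  values, as a transfer matrix requires.\<close>

lemma sum_row:
  assumes "\<And>j. p \<le> j \<Longrightarrow> j \<le> q \<Longrightarrow> L \<le> m j \<and> m j \<le> H" "L \<le> H" "p \<le> q + 1"
  shows "(\<Sum>j\<in>{p..q}. m j) = L * (q + 1 - p) + (\<Sum>c\<in>{L + 1..H}. rc p q m c - p)"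
proof -
  have "m j = L + (\<Sum>c\<in>{L + 1..H}. if c \<le> m j then 1 else 0)" if "j \<in> {p..q}" for j
  proof -
    have "L \<le> m j" "m j \<le> H" using that assms(1)[of j] by auto
    then have "{L + 1..H} \<inter> {c. c \<le> m j} = {L + 1..m j}" by auto
    then show ?thesis using \<open>L \<le> m j\<close> by (simp add: sum.If_cases)
  qed
  then have "(\<Sum>j\<in>{p..q}. m j) = (\<Sum>j\<in>{p..q}. L + (\<Sum>c\<in>{L + 1..H}. if c \<le> m j then 1 else 0))" by (rule sum.cong[OF refl])
  also have "\<dots> = L * (q + 1 - p) + (\<Sum>c\<in>{L + 1..H}. \<Sum>j\<in>{p..q}. if c \<le> m j then 1 else 0)"
    using assms(3) by (subst sum.distrib, subst sum.swap) (simp add: algebra_simps)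
  also have "(\<lambda>c. \<Sum>j\<in>{p..q}. if c \<le> m j then 1 else 0) = (\<lambda>c. rc p q m c - p)"
  proof
    fix c
    have "{p..q} \<inter> {j. c \<le> m j} = {j\<in>{p..q}. c \<le> m j}" by auto
    then show "(\<Sum>j\<in>{p..q}. if c \<le> m j then 1 else 0) = rc p q m c - p"
      by (simp add: rc_def sum.If_cases)
  qed
  finally show ?thesis .
qed

lemma pair_wt_window:
  assumes "\<And>j. p' \<le> j \<Longrightarrow> j \<le> q' \<Longrightarrow> L \<le> m j \<and> m j \<le> H" "interlaced p q p' q' l m"
  shows "pair_wt t p q p' q' l m = (\<Prod>c\<in>{L..H}. row_wt t (nat (rc p q l c - rc p q l (c + 1))) (nat (rc p' q' m c - rc p' q' m (c + 1))))"
proof -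
  have "pair_wt t p q p' q' l m = (\<Prod>c\<in>m ` {p'..q'}. row_wt t (card {j\<in>{p..q}. l j = c}) (card {j\<in>{p'..q'}. m j = c}))"
    using assms(2) by (simp add: pair_wt_def)
  also have "\<dots> = (\<Prod>c\<in>{L..H}. row_wt t (card {j\<in>{p..q}. l j = c}) (card {j\<in>{p'..q'}. m j = c}))"
  proof (rule prod.mono_neutral_left)
    show "\<forall>c\<in>{L..H} - m ` {p'..q'}. row_wt t (card {j \<in> {p..q}. l j = c}) (card {j \<in> {p'..q'}. m j = c}) = 1"
    proof
      fix c assume "c \<in> {L..H} - m ` {p'..q'}"
      then have "{j \<in> {p'..q'}. m j = c} = {}" by auto
      then show "row_wt t (card {j \<in> {p..q}. l j = c}) (card {j \<in> {p'..q'}. m j = c}) = 1" by (simp only: row_wt_def card.empty) simp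
    qed
  qed (use assms(1) in auto)
  finally show ?thesis unfolding card_level .
qed

text \<open>Passing to heights is a bijection onto the paths inside \<open>mids\<close>. The factor
  \<open>G\<close> is left arbitrary so that both sides of the exchange are covered, with and
  without geometric end factors.\<close>

lemma row_sum_eq_path_sum:
  fixes G :: "(int \<Rightarrow> int) \<Rightarrow> 'k::field"
  assumes dec: "dec_on p q l" "dec_on p2 q2 n"
    and st: "steps p q pm qm" "steps pm qm p2 q2" and pq: "p \<le> q + 1" "pm \<le> qm + 1" "p2 \<le> q2 + 1"
    and LH: "L \<le> H"
    and l: "\<And>j. p \<le> j \<Longrightarrow> j \<le> q \<Longrightarrow> L \<le> l j \<and> l j \<le> H"
    and n: "\<And>j. p2 \<le> j \<Longrightarrow> j \<le> q2 \<Longrightarrow> L \<le> n j \<and> n j \<le> H"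
  defines "Pl \<equiv> rc p q l" and "Pn \<equiv> rc p2 q2 n"
  shows "(\<Sum>m\<in>bounded_rows pm qm L H. pair_wt t p q pm qm l m * pair_wt t pm qm p2 q2 m n * G (rc pm qm m)) =
    (\<Sum>f\<in>paths (\<lambda>c. mids (Pl c) (Pn c)) pm H L (qm + 1).
      (\<Prod>d\<in>{L..H}. col_wt t (nat (Pl d - Pl (d + 1))) (nat (Pn d - Pn (d + 1))) (f (d + 1)) (f d)) * G f)"
proof -
  let ?S = "\<lambda>c. mids (Pl c) (Pn c)"
  let ?R = "{m\<in>bounded_rows pm qm L H. interlaced p q pm qm l m \<and> interlaced pm qm p2 q2 m n}"
  have "(\<Sum>m\<in>bounded_rows pm qm L H. pair_wt t p q pm qm l m * pair_wt t pm qm p2 q2 m n * G (rc pm qm m)) =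
    (\<Sum>m\<in>?R. pair_wt t p q pm qm l m * pair_wt t pm qm p2 q2 m n * G (rc pm qm m))"
    by (rule sum.mono_neutral_right) (auto simp: finite_bounded_rows pair_wt_def)
  also have "\<dots> = (\<Sum>f\<in>paths ?S pm H L (qm + 1).
      (\<Prod>d\<in>{L..H}. col_wt t (nat (Pl d - Pl (d + 1))) (nat (Pn d - Pn (d + 1))) (f (d + 1)) (f d)) * G f)"
  proof (rule sum.reindex_bij_witness[where j = "rc pm qm" and i = "row_of pm qm L H"])
    fix m assume "m \<in> ?R"
    then have m: "m \<in> bounded_rows pm qm L H" "interlaced p q pm qm l m" "interlaced pm qm p2 q2 m n" by auto
    have d: "dec_on pm qm m" using interlaced_dec(2)[OF st(1) m(2)] .
    show "row_of pm qm L H (rc pm qm m) = m" by (rule row_of_rc[OF m(1) d LH])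
    have mw: "L \<le> m j \<and> m j \<le> H" if "pm \<le> j" "j \<le> qm" for j using m(1) that by (auto simp: bounded_rows_def)
    have i1: "rc pm qm m c = Pl c - 1 \<or> rc pm qm m c = Pl c" for c
      using interlaced_iff_rc[OF dec(1) d st(1) pq(1,2)] m(2) by (simp add: Pl_def)
    have i2: "Pn c = rc pm qm m c - 1 \<or> Pn c = rc pm qm m c" for c
      using interlaced_iff_rc[OF d dec(2) st(2) pq(2,3)] m(3) by (simp add: Pn_def)
    have "rc pm qm m c \<in> ?S c" for c using i1[of c] i2[of c] by (auto simp: mids_def)
    moreover have "rc pm qm m c = pm" if "c > H" for c using mw that by (intro rc_top) fastforce
    moreover have "rc pm qm m c = qm + 1" if "c \<le> L" for c using mw that pq(2) by (intro rc_bot) fastforce+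
    ultimately show "rc pm qm m \<in> paths ?S pm H L (qm + 1)" by (simp add: paths_def rc_antimono)
    have w: "pair_wt t p q pm qm l m = (\<Prod>d\<in>{L..H}. row_wt t (nat (Pl d - Pl (d + 1))) (nat (rc pm qm m d - rc pm qm m (d + 1))))"
      using pair_wt_window[OF mw m(2), where t = t] by (simp add: Pl_def)
    have w': "pair_wt t pm qm p2 q2 m n = (\<Prod>d\<in>{L..H}. row_wt t (nat (rc pm qm m d - rc pm qm m (d + 1))) (nat (Pn d - Pn (d + 1))))"
      using pair_wt_window[OF n m(3), where t = t] by (simp add: Pn_def)
    show "(\<Prod>d\<in>{L..H}. col_wt t (nat (Pl d - Pl (d + 1))) (nat (Pn d - Pn (d + 1))) (rc pm qm m (d + 1)) (rc pm qm m d)) * G (rc pm qm m) =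
       pair_wt t p q pm qm l m * pair_wt t pm qm p2 q2 m n * G (rc pm qm m)"
      unfolding w w' col_wt_def by (simp add: prod.distrib)
  next
    fix f assume "f \<in> paths ?S pm H L (qm + 1)"
    then have f: "antimono f" "\<And>c. c > H \<Longrightarrow> f c = pm" "\<And>c. c \<le> L \<Longrightarrow> f c = qm + 1" "\<And>d. L \<le> d \<Longrightarrow> d \<le> H \<Longrightarrow> f d \<in> ?S d"
      by (auto simp: paths_def)
    have r: "row_of pm qm L H f \<in> bounded_rows pm qm L H" "dec_on pm qm (row_of pm qm L H f)" "rc pm qm (row_of pm qm L H f) = f"
      using row_of_path[OF f(1) _ _ LH pq(2)] f(2,3) by blast+
    show "rc pm qm (row_of pm qm L H f) = f" by (rule r(3))
    have t: "Pl c = p" "Pn c = p2" if "c > H" for c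
      using l n that unfolding Pl_def Pn_def by (auto intro!: rc_top intro: le_less_trans)
    have b: "Pl c = q + 1" "Pn c = q2 + 1" if "c \<le> L" for c
      using l n that pq unfolding Pl_def Pn_def by (auto intro!: rc_bot intro: order_trans)
    \<comment> \<open>Beyond the window this is not part of the definition of \<open>paths\<close>;
      there all three heights are constant and \<open>steps\<close> supplies it.\<close>
    have c: "f c \<in> ?S c" for c
    proof (cases "c > H \<or> c < L")
      case True
      then show ?thesis using t[of c] b[of c] f(2,3)[of c] st by (auto simp: mids_def steps_def)
    qed (use f(4) in auto)
    have "f c = Pl c - 1 \<or> f c = Pl c" "Pn c = f c - 1 \<or> Pn c = f c" for c using c[of c] by (auto simp: mids_def)
    note fP = this
    have "interlaced p q pm qm l (row_of pm qm L H f)"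
      by (rule iffD2[OF interlaced_iff_rc[OF dec(1) r(2) st(1) pq(1,2)]]) (unfold r(3), fold Pl_def, use fP(1) in blast)
    moreover have "interlaced pm qm p2 q2 (row_of pm qm L H f) n"
      by (rule iffD2[OF interlaced_iff_rc[OF r(2) dec(2) st(2) pq(2,3)]]) (unfold r(3), fold Pn_def, use fP(2) in blast)
    ultimately show "row_of pm qm L H f \<in> ?R" using r(1) by simp
  qed
  finally show ?thesis .
qed

lemma prod_power_int: "(\<Prod>d\<in>A. z powi g d) = (z::'k::field) powi (\<Sum>d\<in>A. g d)" if "z \<noteq> 0"
  by (induction A rule: infinite_finite_induct) (auto simp: power_int_add that)

lemma sum_shift_interval:
  fixes g :: "int \<Rightarrow> int"
  assumes "L \<le> H"
  shows "(\<Sum>d\<in>{L..H}. g (d + 1)) = (\<Sum>c\<in>{L + 1..H}. g c) + g (H + 1)"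
proof -
  have "(\<Sum>d\<in>{L..H}. g (d + 1)) = (\<Sum>c\<in>{L + 1..H + 1}. g c)"
    by (rule sum.reindex_bij_witness[where j = "\<lambda>d. d + 1" and i = "\<lambda>c. c - 1"]) auto
  also have "{L + 1..H + 1} = insert (H + 1) {L + 1..H}" using assms by auto
  finally show ?thesis by simp
qed

lemma prod_end_wt:
  assumes "L < H"
  shows "(\<Prod>d\<in>{L..H}. end_wt z L H d (f (d + 1)) (f d)) =
    (if f (H + 1) \<noteq> f H then 1 / (1 - z) else 1) * (if f (L + 1) \<noteq> f L then 1 / (1 - 1 / z) else 1)"
proof -
  have "(\<Prod>d\<in>{L..H}. end_wt z L H d (f (d + 1)) (f d)) =
    (\<Prod>d\<in>{L..H}. if H = d then (if f (d + 1) \<noteq> f d then 1 / (1 - z) else 1) else 1) *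
    (\<Prod>d\<in>{L..H}. if L = d then (if f (d + 1) \<noteq> f d then 1 / (1 - 1 / z) else 1) else 1)"
    unfolding prod.distrib[symmetric] end_wt_def by (rule prod.cong) auto
  then show ?thesis using assms by (simp add: prod.delta)
qed

text \<open>The left row makes the first of its two steps the enlarging one, the right row the
  second. If \<open>p2 > q2\<close>, both neighbours are empty and the right row would have length
  \<open>-1\<close>: no path rises from \<open>p2 + 1\<close> to \<open>q2 + 1\<close>, and the
  two-sided geometric series on the left gets the value \<open>0\<close>.\<close>

lemma row_exchange:
  fixes t z :: "'k::field"
  assumes z: "z \<noteq> 0" "z \<noteq> 1" and LH: "L < H"
    and pq: "p \<le> q + 1" "p2 \<le> q2 + 1" "p2 = p - 1 \<or> p2 = p - 2" "q2 = q \<or> q2 = q - 1"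
    and l: "\<And>j. p \<le> j \<Longrightarrow> j \<le> q \<Longrightarrow> L < l j \<and> l j < H"
    and n: "\<And>j. p2 \<le> j \<Longrightarrow> j \<le> q2 \<Longrightarrow> L < n j \<and> n j < H"
  shows "C_bot t z q q2 * (\<Sum>m\<in>bounded_rows (p - 1) q L H. pair_wt t p q (p - 1) q l m * pair_wt t (p - 1) q p2 q2 m n *
      (z powi (\<Sum>j\<in>{p - 1..q}. m j) * ((if m (p - 1) = H then 1 / (1 - z) else 1) * (if m q = L then 1 / (1 - 1 / z) else 1)))) =
    C_top t z p p2 * (if p2 \<le> q2 then \<Sum>m\<in>bounded_rows (p2 + 1) q2 L H. pair_wt t p q (p2 + 1) q2 l m * pair_wt t (p2 + 1) q2 p2 q2 m n *
      z powi ((\<Sum>j\<in>{p..q}. l j) + (\<Sum>j\<in>{p2..q2}. n j) - (\<Sum>j\<in>{p2 + 1..q2}. m j)) else 0)"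
    (is "_ * ?SL = _ * (if _ then ?SR else 0)")
proof -
  have st: "steps p q (p - 1) q" "steps (p - 1) q p2 q2" "steps p q (p2 + 1) q2" "steps (p2 + 1) q2 p2 q2"
    using pq by (auto simp: steps_def)
  show ?thesis
  proof (cases "dec_on p q l \<and> dec_on p2 q2 n")
    case False
    have 1: "pair_wt t p q (p - 1) q l m * pair_wt t (p - 1) q p2 q2 m n = 0" for m
      using False interlaced_dec(1)[OF st(1), of l m] interlaced_dec(2)[OF st(2), of m n] by (auto simp: pair_wt_def)
    have 2: "pair_wt t p q (p2 + 1) q2 l m * pair_wt t (p2 + 1) q2 p2 q2 m n = 0" for m
      using False interlaced_dec(1)[OF st(3), of l m] interlaced_dec(2)[OF st(4), of m n] by (auto simp: pair_wt_def)
    show ?thesis unfolding 1 2 by simp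
  next
    case True
    then have dec: "dec_on p q l" "dec_on p2 q2 n" by auto
    define Pl where "Pl = rc p q l"
    define Pn where "Pn = rc p2 q2 n"
    define S where "S = (\<lambda>c. mids (Pl c) (Pn c))"
    define wb where "wb = (\<lambda>c. col_wt t (nat (Pl c - Pl (c + 1))) (nat (Pn c - Pn (c + 1))))"
    \<comment> \<open>The offset between the row sum and the sum of the heights at
      \<open>L + 1..H + 1\<close>: \<open>L\<close> times the length of the row, minus
      \<open>p - 1\<close> for each of these heights. The reflected exponent on the other side leads
      to the same offset.\<close>
    define K where "K = L * (q + 2 - p) - (H - L) * (p - 1) - (p - 1)"
    have top: "Pl c = p" "Pn c = p2" if "c \<ge> H" for c
      using l n that unfolding Pl_def Pn_def by (auto intro!: rc_top intro: less_le_trans)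
    have bot: "Pl c = q + 1" "Pn c = q2 + 1" if "c \<le> L + 1" for c
    proof -
      show "Pl c = q + 1" unfolding Pl_def by (rule rc_bot[OF pq(1)]) (use l that in fastforce)
      show "Pn c = q2 + 1" unfolding Pn_def by (rule rc_bot[OF pq(2)]) (use n that in fastforce)
    qed
    have fS: "finite (S c)" for c by (simp add: S_def mids_def)
    have k: "H + 1 - int (nat (H + 1 - L)) = L" using LH by simp
    have LH': "L \<le> H" using LH by simp
    have lw: "L \<le> l j \<and> l j \<le> H" if "p \<le> j" "j \<le> q" for j using l[OF that] by simp
    have nw: "L \<le> n j \<and> n j \<le> H" if "p2 \<le> j" "j \<le> q2" for j using n[OF that] by simp
    have sub: "(\<Sum>c\<in>{L + 1..H}. f c - a) = (\<Sum>c\<in>{L + 1..H}. f c) - (H - L) * a" for f :: "int \<Rightarrow> int" and a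
      using LH by (simp add: sum_subtractf)
    define G where "G f = z powi (K + (\<Sum>d\<in>{L..H}. f (d + 1))) *
        ((if f (H + 1) \<noteq> f H then 1 / (1 - z) else 1) * (if f (L + 1) \<noteq> f L then 1 / (1 - 1 / z) else 1))" for f
    have "?SL = (\<Sum>m\<in>bounded_rows (p - 1) q L H. pair_wt t p q (p - 1) q l m * pair_wt t (p - 1) q p2 q2 m n * G (rc (p - 1) q m))"
    proof (rule sum.cong[OF refl])
      fix m assume m: "m \<in> bounded_rows (p - 1) q L H"
      have mw: "L \<le> m j \<and> m j \<le> H" if "p - 1 \<le> j" "j \<le> q" for j using m that by (auto simp: bounded_rows_def)
      show "pair_wt t p q (p - 1) q l m * pair_wt t (p - 1) q p2 q2 m n *
        (z powi (\<Sum>j\<in>{p - 1..q}. m j) * ((if m (p - 1) = H then 1 / (1 - z) else 1) * (if m q = L then 1 / (1 - 1 / z) else 1))) =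
        pair_wt t p q (p - 1) q l m * pair_wt t (p - 1) q p2 q2 m n * G (rc (p - 1) q m)"
      proof (cases "interlaced p q (p - 1) q l m")
        case True
        then have d: "dec_on (p - 1) q m" using interlaced_dec(2)[OF st(1)] by simp
        let ?f = "rc (p - 1) q m"
        have fH: "?f (H + 1) = p - 1" by (rule rc_top) (use mw in fastforce)
        have fL: "?f L = q + 1" by (rule rc_bot) (use mw pq in auto)
        have b: "p - 1 \<le> ?f c \<and> ?f c \<le> q + 1" for c using rc_bounds[of "p - 1" q m c] pq by simp
        have 1: "m (p - 1) = H \<longleftrightarrow> ?f (H + 1) \<noteq> ?f H"
          using rc_less_iff[OF d, of "p - 1" H] mw[of "p - 1"] b[of H] pq fH by auto
        have 2: "m q = L \<longleftrightarrow> ?f (L + 1) \<noteq> ?f L"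
          using rc_less_iff[OF d, of q "L + 1"] mw[of q] b[of "L + 1"] pq fL by auto
        have "(\<Sum>j\<in>{p - 1..q}. m j) = K + (\<Sum>d\<in>{L..H}. ?f (d + 1))"
          using sum_row[of "p - 1" q L m H, OF mw LH'] pq unfolding sum_shift_interval[OF LH'] fH K_def sub by (simp add: algebra_simps)
        then show ?thesis by (simp add: G_def 1 2)
      qed (simp add: pair_wt_def)
    qed
    also have "\<dots> = (\<Sum>f\<in>paths S (p - 1) H L (q + 1). (\<Prod>d\<in>{L..H}. wb d (f (d + 1)) (f d)) * G f)"
      unfolding S_def wb_def Pl_def Pn_def
      by (rule row_sum_eq_path_sum[OF dec st(1,2) _ _ _ LH']) (use pq lw nw in auto)
    also have "\<dots> = (\<Sum>f\<in>paths S (p - 1) H L (q + 1). z powi K * (\<Prod>d\<in>{L..H}. z powi f (d + 1) * wb d (f (d + 1)) (f d) * end_wt z L H d (f (d + 1)) (f d)))"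
      unfolding prod.distrib prod_end_wt[OF LH] prod_power_int[OF z(1)] G_def
      using z(1) by (intro sum.cong refl) (simp add: power_int_add mult_ac)
    also have "\<dots> = z powi K * path_amp S (\<lambda>c u v. z powi u * wb c u v * end_wt z L H c u v) (p - 1) H (nat (H + 1 - L)) (q + 1)"
      unfolding sum_distrib_left[symmetric]
      using path_sum[where S = S and a = "p - 1" and H = H and k = "nat (H + 1 - L)" and v = "q + 1" and w = "\<lambda>c u v. z powi u * wb c u v * end_wt z L H c u v", OF fS]
      unfolding k using pq(3) top[of "H + 1"] by (auto simp: S_def mids_def)
    finally have SL: "?SL = z powi K * path_amp S (\<lambda>c u v. z powi u * wb c u v * end_wt z L H c u v) (p - 1) H (nat (H + 1 - L)) (q + 1)" .
    let ?A' = "path_amp S (\<lambda>c u v. z powi (Pl (c + 1) + Pn (c + 1) - u) * wb c u v) (p2 + 1) H (nat (H + 1 - L)) (q2 + 1)"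
    have A': "(\<Sum>f\<in>paths S (p2 + 1) H L (q2 + 1). (\<Prod>d\<in>{L..H}. z powi (Pl (d + 1) + Pn (d + 1) - f (d + 1)) * wb d (f (d + 1)) (f d))) = ?A'"
      using path_sum[where S = S and a = "p2 + 1" and H = H and k = "nat (H + 1 - L)" and v = "q2 + 1" and w = "\<lambda>c u v. z powi (Pl (c + 1) + Pn (c + 1) - u) * wb c u v", OF fS]
      unfolding k using pq(3) top[of "H + 1"] by (auto simp: S_def mids_def)
    have SR: "(if p2 \<le> q2 then ?SR else 0) = z powi K * ?A'"
    proof (cases "p2 \<le> q2")
      case True
      define G' where "G' f = z powi (K + (\<Sum>d\<in>{L..H}. Pl (d + 1) + Pn (d + 1) - f (d + 1)))" for f
      have "?SR = (\<Sum>m\<in>bounded_rows (p2 + 1) q2 L H. pair_wt t p q (p2 + 1) q2 l m * pair_wt t (p2 + 1) q2 p2 q2 m n * G' (rc (p2 + 1) q2 m))"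
      proof (rule sum.cong[OF refl])
        fix m assume m: "m \<in> bounded_rows (p2 + 1) q2 L H"
        have mw: "L \<le> m j \<and> m j \<le> H" if "p2 + 1 \<le> j" "j \<le> q2" for j using m that by (auto simp: bounded_rows_def)
        have fH: "rc (p2 + 1) q2 m (H + 1) = p2 + 1" by (rule rc_top) (use mw in fastforce)
        have "(\<Sum>j\<in>{p..q}. l j) + (\<Sum>j\<in>{p2..q2}. n j) - (\<Sum>j\<in>{p2 + 1..q2}. m j) =
          K + (\<Sum>d\<in>{L..H}. Pl (d + 1) + Pn (d + 1) - rc (p2 + 1) q2 m (d + 1))"
          using sum_row[of "p2 + 1" q2 L m H, OF mw LH'] sum_row[of p q L l H, OF lw LH' pq(1)]
            sum_row[of p2 q2 L n H, OF nw LH' pq(2)] True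
          unfolding sum_subtractf[of "\<lambda>d. Pl (d + 1) + Pn (d + 1)"] sum.distrib sum_shift_interval[OF LH'] fH K_def sub Pl_def[symmetric] Pn_def[symmetric]
          by (simp add: top algebra_simps)
        then show "pair_wt t p q (p2 + 1) q2 l m * pair_wt t (p2 + 1) q2 p2 q2 m n *
            z powi ((\<Sum>j\<in>{p..q}. l j) + (\<Sum>j\<in>{p2..q2}. n j) - (\<Sum>j\<in>{p2 + 1..q2}. m j)) =
          pair_wt t p q (p2 + 1) q2 l m * pair_wt t (p2 + 1) q2 p2 q2 m n * G' (rc (p2 + 1) q2 m)"
          by (simp add: G'_def)
      qed
      also have "\<dots> = (\<Sum>f\<in>paths S (p2 + 1) H L (q2 + 1). (\<Prod>d\<in>{L..H}. wb d (f (d + 1)) (f d)) * G' f)"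
        unfolding S_def wb_def Pl_def Pn_def
        by (rule row_sum_eq_path_sum[OF dec st(3,4) _ _ _ LH']) (use pq True lw nw in auto)
      also have "\<dots> = (\<Sum>f\<in>paths S (p2 + 1) H L (q2 + 1). z powi K * (\<Prod>d\<in>{L..H}. z powi (Pl (d + 1) + Pn (d + 1) - f (d + 1)) * wb d (f (d + 1)) (f d)))"
        unfolding prod.distrib prod_power_int[OF z(1)] G'_def
        using z(1) by (intro sum.cong refl) (simp add: power_int_add mult_ac)
      also have "\<dots> = z powi K * ?A'" unfolding sum_distrib_left[symmetric] A' ..
      finally show ?thesis using True by simp
    next
      case False
      have "paths S (p2 + 1) H L (q2 + 1) = {}"
      proof (rule ccontr)
        assume "paths S (p2 + 1) H L (q2 + 1) \<noteq> {}"
        then obtain f where "antimono f" "f (H + 1) = p2 + 1" "f L = q2 + 1" by (auto simp: paths_def)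
        then show False using antimonoD[of f L "H + 1"] LH False by simp
      qed
      then show ?thesis using A' False by simp
    qed
    have "C_bot t z q q2 * path_amp S (\<lambda>c u v. z powi u * wb c u v * end_wt z L H c u v) (p - 1) H (nat (H + 1 - L)) (q + 1) = C_top t z p p2 * ?A'"
      unfolding S_def wb_def
      by (rule amplitude_identity[OF z LH _ _ _ _ pq(3) _ _ pq(4)]) (use top bot in \<open>auto simp: Pl_def Pn_def rc_antimono\<close>)
    then show ?thesis unfolding SL SR by (simp add: mult.left_commute)
  qed
qed

section \<open>Summation over one row of an array\<close>

text \<open>Indexing by pairs of level sets instead of values shows that only coincidences of
  entries matter.\<close>

lemma prod_levels:
  "(\<Prod>c\<in>m ` A'. F {j\<in>A. l j = c} {j\<in>A'. m j = c}) =
   (\<Prod>X\<in>(\<lambda>k. ({j\<in>A. l j = m k}, {j\<in>A'. m j = m k})) ` A'. F (fst X) (snd X))"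
proof -
  let ?h = "\<lambda>c. ({j\<in>A. l j = c}, {j\<in>A'. m j = c})"
  have "(\<lambda>k. ({j\<in>A. l j = m k}, {j\<in>A'. m j = m k})) ` A' = ?h ` (m ` A')" by (simp add: image_image)
  moreover have "inj_on ?h (m ` A')" by (rule inj_onI) auto
  ultimately show ?thesis by (simp add: prod.reindex)
qed

text \<open>The weight sees only comparisons between entries. This is the source of the periodicity
  that tails and kernels rely on.\<close>

lemma pair_wt_pattern:
  assumes "\<And>j. j \<in> {p..q} \<Longrightarrow> j \<in> {p'..q'} \<Longrightarrow> m j \<le> l j \<longleftrightarrow> m' j \<le> l' j"
    and "\<And>j. j \<in> {p'..q'} \<Longrightarrow> j + 1 \<in> {p..q} \<Longrightarrow> l (j + 1) \<le> m j \<longleftrightarrow> l' (j + 1) \<le> m' j"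
    and lm: "\<And>j k. j \<in> {p..q} \<Longrightarrow> k \<in> {p'..q'} \<Longrightarrow> l j = m k \<longleftrightarrow> l' j = m' k"
    and mm: "\<And>j k. j \<in> {p'..q'} \<Longrightarrow> k \<in> {p'..q'} \<Longrightarrow> m j = m k \<longleftrightarrow> m' j = m' k"
  shows "pair_wt t p q p' q' l m = pair_wt t p q p' q' l' m'"
proof -
  have 1: "interlaced p q p' q' l m \<longleftrightarrow> interlaced p q p' q' l' m'"
    unfolding interlaced_def using assms(1,2) by (simp add: conj_ac)
  have 2: "(\<lambda>k. ({j\<in>{p..q}. l j = m k}, {j\<in>{p'..q'}. m j = m k})) ` {p'..q'} =
    (\<lambda>k. ({j\<in>{p..q}. l' j = m' k}, {j\<in>{p'..q'}. m' j = m' k})) ` {p'..q'}"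
    by (rule image_cong) (use lm mm in auto)
  show ?thesis
    unfolding pair_wt_def prod_levels[where F = "\<lambda>X Y. row_wt t (card X) (card Y)"] 1 2 ..
qed

definition ins_row :: "int \<Rightarrow> int \<Rightarrow> int \<Rightarrow> (vertex \<Rightarrow>\<^sub>0 int) \<Rightarrow> (int \<Rightarrow> int) \<Rightarrow> (vertex \<Rightarrow>\<^sub>0 int)" where
  "ins_row r p q b m = b + (\<Sum>j\<in>{p..q}. single (r, j) (m j))"

lemma lookup_ins_row:
  "lk (ins_row r p q b m) (i, j) = lk b (i, j) + (if i = r \<and> j \<in> {p..q} then m j else 0)"
proof -
  have "(\<Sum>k\<in>{p..q}. lk (single (r, k) (m k)) (i, j)) = (\<Sum>k\<in>{p..q}. if k = j then (if i = r then m j else 0) else 0)"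
    by (rule sum.cong) (auto simp: lookup_single when_def)
  then show ?thesis by (simp add: ins_row_def lookup_add lookup_sum)
qed

text \<open>The array \<open>b\<close> prescribes all rows but \<open>r\<close>. \<open>Z\<close> is
  the variable of row \<open>r\<close> together with an extra exponent, which absorbs the power
  gained by the two neighbouring rows when variables are swapped.\<close>

definition fibre_wt :: "'k::field \<Rightarrow> ('k \<times> int) \<Rightarrow> int \<Rightarrow> (int \<times> int) \<Rightarrow> (int \<times> int) \<Rightarrow> (int \<times> int) \<Rightarrow>
    (vertex \<Rightarrow>\<^sub>0 int) \<Rightarrow> (vertex \<Rightarrow>\<^sub>0 int) \<Rightarrow> 'k" where
  "fibre_wt t Z r P M P2 b s = (if (\<forall>i j. i \<noteq> r \<longrightarrow> lk s (i, j) = lk b (i, j)) \<and> (\<forall>j. j \<notin> {fst M..snd M} \<longrightarrow> lk s (r, j) = 0)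
    then pair_wt t (fst P) (snd P) (fst M) (snd M) (\<lambda>j. lk b (r - 1, j)) (\<lambda>j. lk s (r, j)) *
      pair_wt t (fst M) (snd M) (fst P2) (snd P2) (\<lambda>j. lk s (r, j)) (\<lambda>j. lk b (r + 1, j)) *
      fst Z powi (snd Z + (\<Sum>j\<in>{fst M..snd M}. lk s (r, j))) else 0)"

lemma tsum_fibre_rows:
  fixes w :: "(vertex \<Rightarrow>\<^sub>0 int) \<Rightarrow> 'k::comm_ring_1"
  assumes b: "\<And>j. lk b (r, j) = 0"
    and w: "\<And>s. w s \<noteq> 0 \<Longrightarrow> (\<forall>i j. i \<noteq> r \<longrightarrow> lk s (i, j) = lk b (i, j)) \<and> (\<lambda>j. lk s (r, j)) \<in> bounded_rows p q L H"
  shows "fsupp w" "tsum w = (\<Sum>m\<in>bounded_rows p q L H. w (ins_row r p q b m))"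
proof -
  have lr: "(\<lambda>j. lk (ins_row r p q b m) (r, j)) = m" if "m \<in> bounded_rows p q L H" for m
    using that by (auto simp: lookup_ins_row b bounded_rows_def)
  have fin: "finite (ins_row r p q b ` bounded_rows p q L H)" using finite_bounded_rows by blast
  have mem: "s \<in> ins_row r p q b ` bounded_rows p q L H" if "w s \<noteq> 0" for s
  proof (rule image_eqI)
    show "(\<lambda>j. lk s (r, j)) \<in> bounded_rows p q L H" using w[OF that] by simp
    show "s = ins_row r p q b (\<lambda>j. lk s (r, j))"
    proof (rule poly_mapping_eqI)
      fix v :: vertex
      obtain i j where v: "v = (i, j)" by (cases v)
      show "lk s v = lk (ins_row r p q b (\<lambda>j. lk s (r, j))) v"
        using w[OF that] unfolding v by (cases "i = r") (auto simp: lookup_ins_row b bounded_rows_def)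
    qed
  qed
  show "fsupp w" by (rule fsuppI[OF fin mem])
  have "inj_on (ins_row r p q b) (bounded_rows p q L H)" by (rule inj_on_inverseI[where g = "\<lambda>s j. lk s (r, j)"]) (use lr in simp)
  then show "tsum w = (\<Sum>m\<in>bounded_rows p q L H. w (ins_row r p q b m))"
    using tsum_superset[OF fin mem] by (simp add: sum.reindex)
qed

text \<open>After the exchange every entry of row \<open>r\<close> lies between two entries of the
  row below, so the fibre is finite and ordinary summation applies.\<close>

lemma fibre_wt_lower_row:
  fixes t z :: "'k::field"
  assumes b: "\<And>j. lk b (r, j) = 0"
    and n: "\<And>j. p2 \<le> j \<Longrightarrow> j \<le> q2 \<Longrightarrow> L < lk b (r + 1, j) \<and> lk b (r + 1, j) < H"
  shows "fsupp (fibre_wt t (z, e) r (p, q) (p2 + 1, q2) (p2, q2) b)"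
    "tsum (fibre_wt t (z, e) r (p, q) (p2 + 1, q2) (p2, q2) b) =
      (\<Sum>m\<in>bounded_rows (p2 + 1) q2 L H. pair_wt t p q (p2 + 1) q2 (\<lambda>j. lk b (r - 1, j)) m *
        pair_wt t (p2 + 1) q2 p2 q2 m (\<lambda>j. lk b (r + 1, j)) * z powi (e + (\<Sum>j\<in>{p2 + 1..q2}. m j)))"
proof -
  let ?w = "fibre_wt t (z, e) r (p, q) (p2 + 1, q2) (p2, q2) b"
  have w: "(\<forall>i j. i \<noteq> r \<longrightarrow> lk s (i, j) = lk b (i, j)) \<and> (\<lambda>j. lk s (r, j)) \<in> bounded_rows (p2 + 1) q2 L H" if "?w s \<noteq> 0" for s
  proof -
    have 1: "\<forall>i j. i \<noteq> r \<longrightarrow> lk s (i, j) = lk b (i, j)" "\<forall>j. j \<notin> {p2 + 1..q2} \<longrightarrow> lk s (r, j) = 0"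
      and i: "interlaced (p2 + 1) q2 p2 q2 (\<lambda>j. lk s (r, j)) (\<lambda>j. lk b (r + 1, j))"
      using that by (auto simp: fibre_wt_def pair_wt_def split: if_splits)
    have "L \<le> lk s (r, j) \<and> lk s (r, j) \<le> H" if j: "j \<in> {p2 + 1..q2}" for j
    proof -
      have "lk b (r + 1, j) \<le> lk s (r, j)" using i j by (auto simp: interlaced_def)
      moreover have "lk s (r, j - 1 + 1) \<le> lk b (r + 1, j - 1)"
        using i[unfolded interlaced_def, THEN conjunct2, THEN spec, of "j - 1"] j by auto
      ultimately show ?thesis using n[of j] n[of "j - 1"] j by auto
    qed
    then show ?thesis using 1 by (auto simp: bounded_rows_def)
  qed
  show "fsupp ?w" by (rule tsum_fibre_rows[OF b w])
  have "tsum ?w = (\<Sum>m\<in>bounded_rows (p2 + 1) q2 L H. ?w (ins_row r (p2 + 1) q2 b m))"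
    by (rule tsum_fibre_rows[OF b w])
  also have "\<dots> = (\<Sum>m\<in>bounded_rows (p2 + 1) q2 L H. pair_wt t p q (p2 + 1) q2 (\<lambda>j. lk b (r - 1, j)) m *
        pair_wt t (p2 + 1) q2 p2 q2 m (\<lambda>j. lk b (r + 1, j)) * z powi (e + (\<Sum>j\<in>{p2 + 1..q2}. m j)))"
  proof (rule sum.cong[OF refl])
    fix m assume m: "m \<in> bounded_rows (p2 + 1) q2 L H"
    have "(\<lambda>j. lk (ins_row r (p2 + 1) q2 b m) (r, j)) = m" using m by (auto simp: lookup_ins_row b bounded_rows_def)
    note * = this fun_cong[OF this]
    show "?w (ins_row r (p2 + 1) q2 b m) = pair_wt t p q (p2 + 1) q2 (\<lambda>j. lk b (r - 1, j)) m *
        pair_wt t (p2 + 1) q2 p2 q2 m (\<lambda>j. lk b (r + 1, j)) * z powi (e + (\<Sum>j\<in>{p2 + 1..q2}. m j))"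
      unfolding fibre_wt_def fst_conv snd_conv * using m by (auto simp: lookup_ins_row bounded_rows_def)
  qed
  finally show "tsum ?w = (\<Sum>m\<in>bounded_rows (p2 + 1) q2 L H. pair_wt t p q (p2 + 1) q2 (\<lambda>j. lk b (r - 1, j)) m *
        pair_wt t (p2 + 1) q2 p2 q2 m (\<lambda>j. lk b (r + 1, j)) * z powi (e + (\<Sum>j\<in>{p2 + 1..q2}. m j)))" .
qed

text \<open>Only the left end of the row can exceed all neighbouring entries and only the right end
  can fall below them. Beyond the window such an entry moves without affecting any comparison, so
  only the power of \<open>z\<close> changes.\<close>

lemma fibre_wt_tails:
  fixes t z :: "'k::field"
  assumes z: "z \<noteq> 0" and LH: "L < H"
    and pq: "p \<le> q + 1" "p2 = p - 1 \<or> p2 = p - 2" "q2 = q \<or> q2 = q - 1"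
    and l: "\<And>j. p \<le> j \<Longrightarrow> j \<le> q \<Longrightarrow> L < lk b (r - 1, j) \<and> lk b (r - 1, j) < H"
    and n: "\<And>j. p2 \<le> j \<Longrightarrow> j \<le> q2 \<Longrightarrow> L < lk b (r + 1, j) \<and> lk b (r + 1, j) < H"
  defines "w \<equiv> fibre_wt t (z, 0) r (p, q) (p - 1, q) (p2, q2) b"
  shows "lk s (r, p - 1) \<ge> H \<Longrightarrow> w (s + single (r, p - 1) 1) = z * w s"
    and "lk s (r, q) \<le> L \<Longrightarrow> w (s - single (r, q) 1) = 1 / z * w s"
    and "w s \<noteq> 0 \<Longrightarrow> p \<le> j \<Longrightarrow> j \<le> q \<Longrightarrow> lk s (r, j) < H"
    and "w s \<noteq> 0 \<Longrightarrow> p - 1 \<le> j \<Longrightarrow> j < q \<Longrightarrow> L < lk s (r, j)"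
proof -
  let ?l = "\<lambda>j. lk b (r - 1, j)" and ?n = "\<lambda>j. lk b (r + 1, j)"
  have up: "lk s (r, j) < H" if "interlaced p q (p - 1) q ?l (\<lambda>j. lk s (r, j))" "p \<le> j" "j \<le> q" for s j
    using that l[of j] by (force simp: interlaced_def)
  have lo: "L < lk s (r, j)" if "interlaced p q (p - 1) q ?l (\<lambda>j. lk s (r, j))" "p - 1 \<le> j" "j < q" for s j
    using that l[of "j + 1"] by (force simp: interlaced_def)
  have wi: "interlaced p q (p - 1) q ?l (\<lambda>j. lk s (r, j))" if "w s \<noteq> 0" for s
    using that by (auto simp: w_def fibre_wt_def pair_wt_def split: if_splits)
  show "w s \<noteq> 0 \<Longrightarrow> p \<le> j \<Longrightarrow> j \<le> q \<Longrightarrow> lk s (r, j) < H" using up[OF wi] .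
  show "w s \<noteq> 0 \<Longrightarrow> p - 1 \<le> j \<Longrightarrow> j < q \<Longrightarrow> L < lk s (r, j)" using lo[OF wi] .
  \<comment> \<open>The general principle: if coincidences within row \<open>r\<close> and
    comparisons with all values inside the window are kept, the weight changes by \<open>z\<close>
    to the change of the row sum.\<close>
  have change: "w s' = z powi (\<Sum>j\<in>{p - 1..q}. lk s' (r, j) - lk s (r, j)) * w s"
    if same: "\<And>i j. i \<noteq> r \<or> j \<notin> {p - 1..q} \<Longrightarrow> lk s' (i, j) = lk s (i, j)"
      and order: "\<And>j k. j \<in> {p - 1..q} \<Longrightarrow> k \<in> {p - 1..q} \<Longrightarrow> lk s' (r, j) = lk s' (r, k) \<longleftrightarrow> lk s (r, j) = lk s (r, k)"
      and out: "\<And>j x. j \<in> {p - 1..q} \<Longrightarrow> L < x \<Longrightarrow> x < H \<Longrightarrow> (lk s' (r, j) \<le> x \<longleftrightarrow> lk s (r, j) \<le> x) \<and> (x \<le> lk s' (r, j) \<longleftrightarrow> x \<le> lk s (r, j))"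
    for s s'
  proof -
    have eq: "(lk s' (r, j) = x \<longleftrightarrow> lk s (r, j) = x) \<and> (x = lk s' (r, j) \<longleftrightarrow> x = lk s (r, j))" if "j \<in> {p - 1..q}" "L < x" "x < H" for j x
      using out[OF that] by auto
    have 1: "pair_wt t p q (p - 1) q ?l (\<lambda>j. lk s' (r, j)) = pair_wt t p q (p - 1) q ?l (\<lambda>j. lk s (r, j))"
    proof (rule pair_wt_pattern)
      fix j assume "j \<in> {p..q}" "j \<in> {p - 1..q}"
      then show "lk s' (r, j) \<le> ?l j \<longleftrightarrow> lk s (r, j) \<le> ?l j" using out[of j "?l j"] l[of j] by auto
    next
      fix j assume "j + 1 \<in> {p..q}" "j \<in> {p - 1..q}"
      then show "?l (j + 1) \<le> lk s' (r, j) \<longleftrightarrow> ?l (j + 1) \<le> lk s (r, j)" using out[of j "?l (j + 1)"] l[of "j + 1"] by auto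
    next
      fix j k assume "j \<in> {p..q}" "k \<in> {p - 1..q}"
      then show "?l j = lk s' (r, k) \<longleftrightarrow> ?l j = lk s (r, k)" using eq[of k "?l j"] l[of j] by auto
    qed (rule order)
    have 2: "pair_wt t (p - 1) q p2 q2 (\<lambda>j. lk s' (r, j)) ?n = pair_wt t (p - 1) q p2 q2 (\<lambda>j. lk s (r, j)) ?n"
    proof (rule pair_wt_pattern)
      fix j assume "j \<in> {p - 1..q}" "j \<in> {p2..q2}"
      then show "?n j \<le> lk s' (r, j) \<longleftrightarrow> ?n j \<le> lk s (r, j)" using out[of j "?n j"] n[of j] by auto
    next
      fix j assume "j + 1 \<in> {p - 1..q}" "j \<in> {p2..q2}"
      then show "lk s' (r, j + 1) \<le> ?n j \<longleftrightarrow> lk s (r, j + 1) \<le> ?n j" using out[of "j + 1" "?n j"] n[of j] by auto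
    next
      fix j k assume "j \<in> {p - 1..q}" "k \<in> {p2..q2}"
      then show "lk s' (r, j) = ?n k \<longleftrightarrow> lk s (r, j) = ?n k" using eq[of j "?n k"] n[of k] by auto
    qed simp
    have 3: "(\<forall>i j. i \<noteq> r \<longrightarrow> lk s' (i, j) = lk b (i, j)) \<and> (\<forall>j. j \<notin> {p - 1..q} \<longrightarrow> lk s' (r, j) = 0) \<longleftrightarrow>
      (\<forall>i j. i \<noteq> r \<longrightarrow> lk s (i, j) = lk b (i, j)) \<and> (\<forall>j. j \<notin> {p - 1..q} \<longrightarrow> lk s (r, j) = 0)"
      using same by simp
    have 4: "z powi (\<Sum>j\<in>{p - 1..q}. lk s' (r, j)) = z powi (\<Sum>j\<in>{p - 1..q}. lk s' (r, j) - lk s (r, j)) * z powi (\<Sum>j\<in>{p - 1..q}. lk s (r, j))"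
      using z by (simp add: sum_subtractf flip: power_int_add)
    show ?thesis unfolding w_def fibre_wt_def fst_conv snd_conv 1 2 3 add_0 4 if_distrib[of "\<lambda>x. _ * x"] mult_zero_right
      by (rule if_cong) (simp_all only: mult_ac)
  qed
  show "w (s + single (r, p - 1) 1) = z * w s" if H: "lk s (r, p - 1) \<ge> H"
  proof -
    let ?s = "s + single (r, p - 1) 1"
    have lk': "lk ?s (i, j) = lk s (i, j) + (if i = r \<and> j = p - 1 then 1 else 0)" for i j
      by (auto simp: lookup_add lookup_single when_def)
    show ?thesis
    proof (cases "\<forall>j. p \<le> j \<longrightarrow> j \<le> q \<longrightarrow> lk s (r, j) < H")
      case False
      then obtain j where j: "p \<le> j" "j \<le> q" "\<not> lk s (r, j) < H" by auto
      have "w s = 0" using up[OF wi j(1,2)] j(3) by auto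
      moreover have "w ?s = 0" using up[OF wi[of ?s] j(1,2)] j by (auto simp: lk')
      ultimately show ?thesis by simp
    next
      case True
      then have lt: "lk s (r, j) < H" if "j \<in> {p - 1..q}" "j \<noteq> p - 1" for j using that by auto
      have "w ?s = z powi (\<Sum>j\<in>{p - 1..q}. lk ?s (r, j) - lk s (r, j)) * w s"
      proof (rule change)
        fix j k assume "j \<in> {p - 1..q}" "k \<in> {p - 1..q}"
        then show "lk ?s (r, j) = lk ?s (r, k) \<longleftrightarrow> lk s (r, j) = lk s (r, k)"
          using lt[of j] lt[of k] H by (auto simp: lk')
      qed (use H pq in \<open>auto simp: lk'\<close>)
      also have "(\<Sum>j\<in>{p - 1..q}. lk ?s (r, j) - lk s (r, j)) = 1" using pq(1) by (simp add: lk')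
      finally show ?thesis by simp
    qed
  qed
  show "w (s - single (r, q) 1) = 1 / z * w s" if H: "lk s (r, q) \<le> L"
  proof -
    let ?s = "s - single (r, q) 1"
    have lk': "lk ?s (i, j) = lk s (i, j) - (if i = r \<and> j = q then 1 else 0)" for i j
      by (auto simp: lookup_minus lookup_single when_def)
    show ?thesis
    proof (cases "\<forall>j. p - 1 \<le> j \<longrightarrow> j < q \<longrightarrow> L < lk s (r, j)")
      case False
      then obtain j where j: "p - 1 \<le> j" "j < q" "\<not> L < lk s (r, j)" by auto
      have "w s = 0" using lo[OF wi j(1,2)] j(3) by auto
      moreover have "w ?s = 0" using lo[OF wi[of ?s] j(1,2)] j by (auto simp: lk')
      ultimately show ?thesis by simp
    next
      case True
      then have lt: "L < lk s (r, j)" if "j \<in> {p - 1..q}" "j \<noteq> q" for j using that by auto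
      have "w ?s = z powi (\<Sum>j\<in>{p - 1..q}. lk ?s (r, j) - lk s (r, j)) * w s"
      proof (rule change)
        fix j k assume "j \<in> {p - 1..q}" "k \<in> {p - 1..q}"
        then show "lk ?s (r, j) = lk ?s (r, k) \<longleftrightarrow> lk s (r, j) = lk s (r, k)"
          using lt[of j] lt[of k] H by (auto simp: lk')
      qed (use H pq in \<open>auto simp: lk'\<close>)
      also have "(\<Sum>j\<in>{p - 1..q}. lk ?s (r, j) - lk s (r, j)) = -1" using pq(1) by (simp add: lk' sum_negf)
      finally show ?thesis by (simp add: power_int_minus divide_inverse)
    qed
  qed
qed

text \<open>The tail at the left end is removed first, by \<open>reg_geometric_tail\<close> with
  ratio \<open>z\<close>; the truncated function and its boundary layer then have a downward tail at
  the right end, with ratio \<open>1 / z\<close>.\<close>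

lemma reg_fibre_wt_upper_row:
  fixes t z :: "'k::field"
  assumes z: "z \<noteq> 0" "z \<noteq> 1" and LH: "L < H"
    and pq: "p \<le> q + 1" "p2 = p - 1 \<or> p2 = p - 2" "q2 = q \<or> q2 = q - 1"
    and b: "\<And>j. lk b (r, j) = 0"
    and l: "\<And>j. p \<le> j \<Longrightarrow> j \<le> q \<Longrightarrow> L < lk b (r - 1, j) \<and> lk b (r - 1, j) < H"
    and n: "\<And>j. p2 \<le> j \<Longrightarrow> j \<le> q2 \<Longrightarrow> L < lk b (r + 1, j) \<and> lk b (r + 1, j) < H"
  shows "reg (fibre_wt t (z, 0) r (p, q) (p - 1, q) (p2, q2) b)
    (\<Sum>m\<in>bounded_rows (p - 1) q L H. pair_wt t p q (p - 1) q (\<lambda>j. lk b (r - 1, j)) m *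
      pair_wt t (p - 1) q p2 q2 m (\<lambda>j. lk b (r + 1, j)) * (z powi (\<Sum>j\<in>{p - 1..q}. m j) *
      ((if m (p - 1) = H then 1 / (1 - z) else 1) * (if m q = L then 1 / (1 - 1 / z) else 1))))"
    (is "reg _ ?SUM")
proof -
  define w where "w = fibre_wt t (z, 0) r (p, q) (p - 1, q) (p2, q2) b"
  have top: "w (s + single (r, p - 1) 1) = z * w s" if "lk s (r, p - 1) \<ge> H" for s
    unfolding w_def by (rule fibre_wt_tails(1)[OF z(1) LH pq]) (use l n that in auto)
  have bot: "w (s - single (r, q) 1) = 1 / z * w s" if "lk s (r, q) \<le> L" for s
    unfolding w_def by (rule fibre_wt_tails(2)[OF z(1) LH pq]) (use l n that in auto)
  have up: "lk s (r, j) < H" if "w s \<noteq> 0" "p \<le> j" "j \<le> q" for s j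
    by (rule fibre_wt_tails(3)[OF z(1) LH pq _ _ that(1)[unfolded w_def]]) (use l n that in auto)
  have lo: "L < lk s (r, j)" if "w s \<noteq> 0" "p - 1 \<le> j" "j < q" for s j
    by (rule fibre_wt_tails(4)[OF z(1) LH pq _ _ that(1)[unfolded w_def]]) (use l n that in auto)
  have wb: "(\<forall>i j. i \<noteq> r \<longrightarrow> lk s (i, j) = lk b (i, j))" "\<forall>j. j \<notin> {p - 1..q} \<longrightarrow> lk s (r, j) = 0" if "w s \<noteq> 0" for s
    using that by (auto simp: w_def fibre_wt_def split: if_splits)
  \<comment> \<open>The signs turn the downward tail at the right end into an upward one, as
    \<open>reg_geometric_tail\<close> expects.\<close>
  define cut where "cut f s = (if - lk s (r, q) < - L then f s else if - lk s (r, q) = - L then f s / (1 - 1 / z) else (0::'k))" for f s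
  have z': "1 / z \<noteq> 1" using z by (simp add: divide_eq_1_iff)
  have cut: "reg f (tsum (cut f)) \<and> tsum (cut f) = (\<Sum>m\<in>bounded_rows (p - 1) q L H. cut f (ins_row r (p - 1) q b m))"
    if f0: "\<And>s. f s \<noteq> 0 \<Longrightarrow> w s \<noteq> 0 \<and> lk s (r, p - 1) \<le> H"
      and f1: "\<And>s. lk s (r, q) \<le> L \<Longrightarrow> f (s - single (r, q) 1) = 1 / z * f s" for f
  proof -
    have mem: "(\<forall>i j. i \<noteq> r \<longrightarrow> lk s (i, j) = lk b (i, j)) \<and> (\<lambda>j. lk s (r, j)) \<in> bounded_rows (p - 1) q L H"
      if "f s \<noteq> 0" "lk s (r, q) \<ge> L" for s
    proof -
      have w: "w s \<noteq> 0" "lk s (r, p - 1) \<le> H" using f0[OF that(1)] by auto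
      have "L \<le> lk s (r, j) \<and> lk s (r, j) \<le> H" if j: "j \<in> {p - 1..q}" for j
      proof
        show "L \<le> lk s (r, j)" using lo[OF w(1), of j] \<open>lk s (r, q) \<ge> L\<close> j by (cases "j = q") auto
        show "lk s (r, j) \<le> H" using up[OF w(1), of j] w(2) j by (cases "j = p - 1") auto
      qed
      then show ?thesis using wb[OF w(1)] by (auto simp: bounded_rows_def)
    qed
    have c: "(\<forall>i j. i \<noteq> r \<longrightarrow> lk s (i, j) = lk b (i, j)) \<and> (\<lambda>j. lk s (r, j)) \<in> bounded_rows (p - 1) q L H"
      if "cut f s \<noteq> 0" for s
      using that by (intro mem) (auto simp: cut_def split: if_splits)
    have c': "(\<forall>i j. i \<noteq> r \<longrightarrow> lk s (i, j) = lk b (i, j)) \<and> (\<lambda>j. lk s (r, j)) \<in> bounded_rows (p - 1) q L H"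
      if "(if - lk s (r, q) = - L then f s else 0) \<noteq> 0" for s
      using that by (intro mem) (auto split: if_splits)
    have "reg f (tsum (cut f))"
    proof (rule reg_geometric_tail[where h = "\<lambda>s. - lk s (r, q)" and v = "- single (r, q) 1" and r = "1 / z" and H = "- L"])
      show "reg (\<lambda>s. if - lk s (r, q) < - L then f s else if - lk s (r, q) = - L then f s / (1 - 1 / z) else 0) (tsum (cut f))"
        using reg_finite[OF tsum_fibre_rows(1)[OF b c]] unfolding cut_def .
      show "reg (\<lambda>s. if - lk s (r, q) = - L then f s else 0) (tsum (\<lambda>s. if - lk s (r, q) = - L then f s else 0))"
        by (rule reg_finite[OF tsum_fibre_rows(1)[OF b c']])
    qed (use z' f1 in \<open>auto simp: lookup_add lookup_minus lookup_single\<close>)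
    then show ?thesis using tsum_fibre_rows(2)[OF b c] by simp
  qed
  define w1 where "w1 s = (if lk s (r, p - 1) < H then w s else if lk s (r, p - 1) = H then w s / (1 - z) else 0)" for s
  define E where "E s = (if lk s (r, p - 1) = H then w s else 0)" for s
  \<comment> \<open>A row with a single entry has both tails on the same coordinate; as
    \<open>L < H\<close>, the lower tail stays away from the truncation at \<open>H\<close>.\<close>
  have shift: "lk s (r, q) \<le> L \<Longrightarrow> (p - 1 = q \<and> lk s (r, p - 1) < H \<and> lk (s - single (r, q) 1) (r, p - 1) < H) \<or>
      lk (s - single (r, q) 1) (r, p - 1) = lk s (r, p - 1)" for s
    using LH by (auto simp: lookup_minus lookup_single when_def)
  have w1: "reg w1 (tsum (cut w1)) \<and> tsum (cut w1) = (\<Sum>m\<in>bounded_rows (p - 1) q L H. cut w1 (ins_row r (p - 1) q b m))"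
  proof (rule cut)
    fix s assume s: "lk s (r, q) \<le> L"
    show "w1 (s - single (r, q) 1) = 1 / z * w1 s"
      using shift[OF s] bot[OF s] by (auto simp: w1_def)
  qed (auto simp: w1_def split: if_splits)
  have E: "reg E (tsum (cut E)) \<and> tsum (cut E) = (\<Sum>m\<in>bounded_rows (p - 1) q L H. cut E (ins_row r (p - 1) q b m))"
  proof (rule cut)
    fix s assume s: "lk s (r, q) \<le> L"
    show "E (s - single (r, q) 1) = 1 / z * E s"
      using shift[OF s] bot[OF s] by (auto simp: E_def)
  qed (auto simp: E_def split: if_splits)
  have "reg w (tsum (cut w1))"
  proof (rule reg_geometric_tail[where h = "\<lambda>s. lk s (r, p - 1)" and v = "single (r, p - 1) 1" and r = z and H = H])
    show "reg (\<lambda>s. if lk s (r, p - 1) < H then w s else if lk s (r, p - 1) = H then w s / (1 - z) else 0) (tsum (cut w1))"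
      using w1[THEN conjunct1] unfolding w1_def .
    show "reg (\<lambda>s. if lk s (r, p - 1) = H then w s else 0) (tsum (cut E))"
      using E[THEN conjunct1] unfolding E_def .
  qed (use z top in \<open>auto simp: lookup_add lookup_minus lookup_single\<close>)
  moreover have "tsum (cut w1) = ?SUM" unfolding w1[THEN conjunct2]
  proof (rule sum.cong[OF refl])
    fix m assume m: "m \<in> bounded_rows (p - 1) q L H"
    have "(\<lambda>j. lk (ins_row r (p - 1) q b m) (r, j)) = m" using m by (auto simp: lookup_ins_row b bounded_rows_def)
    note * = this fun_cong[OF this]
    have 0: "w (ins_row r (p - 1) q b m) = pair_wt t p q (p - 1) q (\<lambda>j. lk b (r - 1, j)) m *
      pair_wt t (p - 1) q p2 q2 m (\<lambda>j. lk b (r + 1, j)) * z powi (\<Sum>j\<in>{p - 1..q}. m j)"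
      unfolding w_def fibre_wt_def fst_conv snd_conv * using m by (auto simp: lookup_ins_row bounded_rows_def)
    have mw: "L \<le> m q" "m (p - 1) \<le> H" using m pq by (auto simp: bounded_rows_def)
    show "cut w1 (ins_row r (p - 1) q b m) = pair_wt t p q (p - 1) q (\<lambda>j. lk b (r - 1, j)) m *
      pair_wt t (p - 1) q p2 q2 m (\<lambda>j. lk b (r + 1, j)) * (z powi (\<Sum>j\<in>{p - 1..q}. m j) *
      ((if m (p - 1) = H then 1 / (1 - z) else 1) * (if m q = L then 1 / (1 - 1 / z) else 1)))"
      unfolding cut_def w1_def * 0 using mw by simp
  qed
  ultimately show ?thesis unfolding w_def by simp
qed

section \<open>Diagrams\<close>

text \<open>
  Row \<open>i\<close> consists of the columns \<open>p i..q i\<close>. Rows may be empty, and an empty row \<open>n\<close> is added at the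
  bottom, so that an enlarging step can be moved down to the very end.
\<close>

definition diagram :: "int \<Rightarrow> int \<Rightarrow> (int \<Rightarrow> int) \<Rightarrow> (int \<Rightarrow> int) \<Rightarrow> bool" where
  "diagram a n p q \<longleftrightarrow> a \<le> n \<and> (\<forall>i. a \<le> i \<and> i < n \<longrightarrow> steps (p i) (q i) (p (i + 1)) (q (i + 1))) \<and>
    (\<forall>i. a \<le> i \<and> i \<le> n \<longrightarrow> p i \<le> q i + 1) \<and> p n = q n + 1"

definition cells :: "int \<Rightarrow> int \<Rightarrow> (int \<Rightarrow> int) \<Rightarrow> (int \<Rightarrow> int) \<Rightarrow> vertex set" where
  "cells a n p q = (SIGMA i:{a..n}. {p i..q i})"

definition diagram_wt :: "'k::field \<Rightarrow> int \<Rightarrow> int \<Rightarrow> (int \<Rightarrow> int) \<Rightarrow> (int \<Rightarrow> int) \<Rightarrow> (int \<Rightarrow> int) \<Rightarrow> (vertex \<Rightarrow>\<^sub>0 int) \<Rightarrow> 'k" where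
  "diagram_wt t a n p q \<beta> s = (if (\<forall>v. v \<notin> cells a n p q \<longrightarrow> lk s v = 0) \<and> (\<forall>j\<in>{p a..q a}. lk s (a, j) = \<beta> j)
    then \<Prod>i\<in>{a..<n}. pair_wt t (p i) (q i) (p (i + 1)) (q (i + 1)) (\<lambda>j. lk s (i, j)) (\<lambda>j. lk s (i + 1, j)) else 0)"

definition row_mon :: "(int \<Rightarrow> 'k::field) \<Rightarrow> int \<Rightarrow> int \<Rightarrow> (int \<Rightarrow> int) \<Rightarrow> (int \<Rightarrow> int) \<Rightarrow> (vertex \<Rightarrow>\<^sub>0 int) \<Rightarrow> 'k" where
  "row_mon x a n p q s = (\<Prod>i\<in>{a..n}. (x (i + 1) / x i) powi (\<Sum>j\<in>{p i..q i}. lk s (i, j)))"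

definition diagram_series :: "'k::field \<Rightarrow> (int \<Rightarrow> 'k) \<Rightarrow> int \<Rightarrow> int \<Rightarrow> (int \<Rightarrow> int) \<Rightarrow> (int \<Rightarrow> int) \<Rightarrow> (int \<Rightarrow> int) \<Rightarrow> (vertex \<Rightarrow>\<^sub>0 int) \<Rightarrow> 'k" where
  "diagram_series t x a n p q \<beta> s = diagram_wt t a n p q \<beta> s * row_mon x a n p q s"

text \<open>Multiplicative independence of the \<open>x i\<close> keeps the masses of the kernels
  nonzero; \<open>x i \<noteq> t * x j\<close> keeps \<open>z - t\<close> nonzero, by which the
  exchange divides. The conditions treat all indices alike and therefore survive
  permutations.\<close>

definition generic :: "'k::field \<Rightarrow> (int \<Rightarrow> 'k) \<Rightarrow> bool" where
  "generic t x \<longleftrightarrow> (\<forall>i. x i \<noteq> 0) \<and> (\<forall>i j. i \<noteq> j \<longrightarrow> x i \<noteq> t * x j) \<and>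
    (\<forall>A e. finite A \<longrightarrow> (\<exists>i\<in>A. e i \<noteq> 0) \<longrightarrow> (\<Prod>i\<in>A. x i powi e i) \<noteq> 1)"

lemma finite_cells [simp]: "finite (cells a n p q)"
  by (simp add: cells_def)

lemma mem_cells: "(i, j) \<in> cells a n p q \<longleftrightarrow> a \<le> i \<and> i \<le> n \<and> p i \<le> j \<and> j \<le> q i"
  by (auto simp: cells_def)

lemma generic_prod_neq_1:
  assumes "generic t x" "finite A" "\<exists>i\<in>A. e i \<noteq> 0"
  shows "(\<Prod>i\<in>A. x i powi e i) \<noteq> 1"
  using assms(1)[unfolded generic_def, THEN conjunct2, THEN conjunct2, rule_format, OF assms(2,3)] .

lemma generic_swap:
  assumes "generic t x"
  shows "generic t (x \<circ> Transposition.transpose r r')"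
proof -
  let ?\<sigma> = "Transposition.transpose r r'"
  have prod: "(\<Prod>i\<in>A. x (?\<sigma> i) powi e i) \<noteq> 1" if "finite A" "\<exists>i\<in>A. e i \<noteq> 0" for A e
  proof -
    have inj: "inj_on ?\<sigma> A" by (rule inj_on_inverseI[where g = ?\<sigma>]) simp
    have "(\<Prod>k\<in>?\<sigma> ` A. x k powi e (?\<sigma> k)) = (\<Prod>i\<in>A. x (?\<sigma> i) powi e (?\<sigma> (?\<sigma> i)))"
      unfolding prod.reindex[OF inj] o_def ..
    then have "(\<Prod>i\<in>A. x (?\<sigma> i) powi e i) = (\<Prod>k\<in>?\<sigma> ` A. x k powi e (?\<sigma> k))"
      unfolding transpose_involutory by (rule sym)
    also have "\<dots> \<noteq> 1"
    proof -
      have "\<exists>k\<in>?\<sigma> ` A. e (?\<sigma> k) \<noteq> 0" using that(2) by auto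
      moreover have "finite (?\<sigma> ` A)" using that(1) by simp
      ultimately show ?thesis by (intro generic_prod_neq_1[OF assms])
    qed
    finally show ?thesis .
  qed
  have inj: "?\<sigma> i \<noteq> ?\<sigma> j" if "i \<noteq> j" for i j using that by (auto simp: transpose_eq_iff)
  show ?thesis unfolding generic_def o_def
  proof (intro conjI allI impI)
    show "x (?\<sigma> i) \<noteq> 0" for i using assms by (simp add: generic_def)
    show "x (?\<sigma> i) \<noteq> t * x (?\<sigma> j)" if "i \<noteq> j" for i j using assms inj[OF that] by (simp add: generic_def)
  qed (rule prod)
qed

lemma row_mon_add:
  assumes "\<And>i. x i \<noteq> 0"
  shows "row_mon x a n p q (s + s') = row_mon x a n p q s * row_mon x a n p q s'"
  unfolding row_mon_def prod.distrib[symmetric]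
  by (rule prod.cong) (auto simp: lookup_add sum.distrib power_int_add assms)

text \<open>If row \<open>i\<close> contains \<open>u i\<close> cells of \<open>U\<close>, then
  \<open>x i\<close> occurs with exponent \<open>u (i - 1) - u i\<close>. If all of these vanish,
  then \<open>u\<close> is zero from the top row on and \<open>U\<close> is empty. The last row is
  empty, so \<open>x (n + 1)\<close> does not occur.\<close>

lemma row_mon_ind_neq_1:
  assumes x: "generic t x" and U: "U \<subseteq> cells a n p q" "U \<noteq> {}" and an: "a \<le> n" and n: "p n = q n + 1"
  shows "row_mon x a n p q (ind U) \<noteq> 1"
proof -
  have fU: "finite U" using U(1) finite_cells by (rule finite_subset)
  define u where "u i = (if a \<le> i \<and> i < n then int (card {j. (i, j) \<in> U}) else 0)" for i
  have x0: "x i \<noteq> 0" for i using x by (simp add: generic_def)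
  have un: "U \<subseteq> {a..<n} \<times> UNIV"
  proof
    fix v assume v: "v \<in> U"
    obtain i j where ij: "v = (i, j)" by (cases v)
    have "(i, j) \<in> cells a n p q" using v U(1) ij by auto
    then have "a \<le> i" "i \<le> n" "p i \<le> j" "j \<le> q i" by (auto simp: mem_cells)
    then show "v \<in> {a..<n} \<times> UNIV" using n ij by (cases "i = n") auto
  qed
  have e: "(\<Sum>j\<in>{p i..q i}. lk (ind U) (i, j)) = u i" if "i \<in> {a..n}" for i
  proof -
    have "{j. (i, j) \<in> U} = {p i..q i} \<inter> {j. (i, j) \<in> U}" using U(1) by (auto simp: cells_def)
    then have "(\<Sum>j\<in>{p i..q i}. lk (ind U) (i, j)) = int (card {j. (i, j) \<in> U})"
      using fU by (simp add: lookup_ind sum.If_cases)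
    moreover have "{j. (i, j) \<in> U} = {}" if "\<not> i < n" using un that by auto
    ultimately show ?thesis using that by (auto simp: u_def)
  qed
  have "row_mon x a n p q (ind U) = (\<Prod>i\<in>{a..n}. x (i + 1) powi u i * x i powi (- u i))"
    unfolding row_mon_def by (rule prod.cong) (auto simp: e power_int_minus divide_inverse power_int_mult_distrib power_int_inverse)
  also have "\<dots> = (\<Prod>i\<in>{a..n}. x (i + 1) powi u i) * (\<Prod>i\<in>{a..n}. x i powi (- u i))" by (rule prod.distrib)
  also have "(\<Prod>i\<in>{a..n}. x (i + 1) powi u i) = (\<Prod>i\<in>{a + 1..n + 1}. x i powi u (i - 1))"
    by (rule prod.reindex_bij_witness[where j = "\<lambda>i. i + 1" and i = "\<lambda>i. i - 1"]) auto
  also have "\<dots> = (\<Prod>i\<in>{a..n + 1}. x i powi u (i - 1))"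
    by (rule prod.mono_neutral_left) (auto simp: u_def)
  also have "\<dots> = (\<Prod>i\<in>{a..n}. x i powi u (i - 1))"
    by (rule prod.mono_neutral_right) (auto simp: u_def)
  also have "\<dots> * (\<Prod>i\<in>{a..n}. x i powi (- u i)) = (\<Prod>i\<in>{a..n}. x i powi (u (i - 1) - u i))"
    unfolding prod.distrib[symmetric] by (rule prod.cong) (auto simp: x0 simp flip: power_int_add)
  also have "\<dots> \<noteq> 1"
  proof -
    have "\<exists>i\<in>{a..n}. u (i - 1) - u i \<noteq> 0"
    proof (rule ccontr)
      assume *: "\<not> ?thesis"
      have u0: "i \<le> n \<longrightarrow> u i = 0" if "a - 1 \<le> i" for i using that
      proof (induction i rule: int_ge_induct)
        case base
        then show ?case by (simp add: u_def)
      next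
        case (step i)
        then show ?case using * by (auto dest!: bspec[of _ _ "i + 1"])
      qed
      obtain i j where ij: "(i, j) \<in> U" using U(2) by auto
      have "finite {j. (i, j) \<in> U}" using finite_imageI[OF fU, of snd] by (rule finite_subset[rotated]) force
      then have "card {j. (i, j) \<in> U} \<noteq> 0" using ij by auto
      moreover have "a \<le> i" "i < n" using un ij by auto
      ultimately show False using u0[of i] by (simp add: u_def)
    qed
    then show ?thesis by (rule generic_prod_neq_1[OF x finite_atLeastAtMost_int])
  qed
  finally show ?thesis .
qed

section \<open>Kernels for the series of a diagram\<close>

lemma diagram_wt_pattern:
  assumes d: "diagram a n p q"
    and order: "\<And>u v. u \<in> cells a n p q \<Longrightarrow> v \<in> cells a n p q \<Longrightarrow> lk s u \<le> lk s v \<longleftrightarrow> lk s' u \<le> lk s' v"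
    and off: "\<And>v. v \<notin> cells a n p q \<Longrightarrow> lk s v = 0 \<longleftrightarrow> lk s' v = 0"
    and top: "\<And>j. j \<in> {p a..q a} \<Longrightarrow> lk s (a, j) = lk s' (a, j)"
  shows "diagram_wt t a n p q \<beta> s = diagram_wt t a n p q \<beta> s'"
proof -
  have eq: "lk s u = lk s v \<longleftrightarrow> lk s' u = lk s' v" if "u \<in> cells a n p q" "v \<in> cells a n p q" for u v
    using order[OF that] order[OF that(2,1)] by auto
  have "pair_wt t (p i) (q i) (p (i + 1)) (q (i + 1)) (\<lambda>j. lk s (i, j)) (\<lambda>j. lk s (i + 1, j)) =
    pair_wt t (p i) (q i) (p (i + 1)) (q (i + 1)) (\<lambda>j. lk s' (i, j)) (\<lambda>j. lk s' (i + 1, j))" if "i \<in> {a..<n}" for i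
    by (rule pair_wt_pattern; (rule order | rule eq)) (use that in \<open>auto simp: mem_cells\<close>)
  then show ?thesis unfolding diagram_wt_def using off top by (auto intro!: prod.cong)
qed

text \<open>\<open>I\<close> holds the free cells, the rest being frozen to \<open>b\<close>. The
  function \<open>g\<close> has its own coefficient ring because the lemma serves the specialized
  series, where \<omega> is a monomial, and also the original series over the polynomials in
  \<open>t\<close>, where \<omega> is \<open>1\<close>.\<close>

lemma diagram_kernel:
  fixes b :: "vertex \<Rightarrow> int" and g :: "(vertex \<Rightarrow>\<^sub>0 int) \<Rightarrow> 'c::comm_ring_1" and t :: "'k::field"
  assumes d: "diagram a n p q" and I: "I \<subseteq> cells a n p q" "\<And>j. (a, j) \<notin> I"
    and supp: "\<And>s v. g s \<noteq> 0 \<Longrightarrow> v \<notin> I \<Longrightarrow> lk s v = b v"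
    and shift: "\<And>s U. U \<subseteq> I \<Longrightarrow> \<forall>v. v \<notin> I \<longrightarrow> lk s v = b v \<Longrightarrow>
      diagram_wt t a n p q \<beta> (s + ind U) = diagram_wt t a n p q \<beta> s \<Longrightarrow> g (s + ind U) = \<omega> U * g s"
  shows "fsupp (conv (subset_kernel (Pow I - {{}}) \<omega>) g)"
proof -
  \<comment> \<open>An entry of absolute value greater than \<open>B\<close> lies beyond all frozen
    entries.\<close>
  define B where "B = (\<Sum>v\<in>cells a n p q. \<bar>b v\<bar>)"
  have B: "\<bar>b v\<bar> \<le> B" if "v \<in> cells a n p q" for v unfolding B_def
    using that by (intro member_le_sum) auto
  have B0: "B \<ge> 0" by (simp add: B_def sum_nonneg)
  have fI: "finite I" using I(1) finite_cells by (rule finite_subset)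
  \<comment> \<open>Raising \<open>U\<close> by one keeps its comparison with another entry if it
    was already greater, or smaller by at least two; the second case arises when a low group moves
    up.\<close>
  have step: "g (s + ind U) = \<omega> U * g s"
    if U: "U \<subseteq> I" and order: "\<And>u v. (\<And>v. v \<notin> I \<Longrightarrow> lk s v = b v) \<Longrightarrow> u \<in> U \<Longrightarrow> v \<in> cells a n p q \<Longrightarrow> v \<notin> U \<Longrightarrow> lk s u > lk s v \<or> lk s u + 1 < lk s v" for s U
  proof -
    have fU: "finite U" using U fI finite_subset by auto
    have lks: "lk (s + ind U) v = lk s v + (if v \<in> U then 1 else 0)" for v
      using fU by (simp add: lookup_add lookup_ind)
    show ?thesis
    proof (cases "\<forall>v. v \<notin> I \<longrightarrow> lk s v = b v")
      case True
      have "diagram_wt t a n p q \<beta> (s + ind U) = diagram_wt t a n p q \<beta> s"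
      proof (rule diagram_wt_pattern[OF d])
        fix u v assume uv: "u \<in> cells a n p q" "v \<in> cells a n p q"
        show "lk (s + ind U) u \<le> lk (s + ind U) v \<longleftrightarrow> lk s u \<le> lk s v"
          using order[of u v] order[of v u] True uv by (auto simp: lks)
      next
        fix v assume "v \<notin> cells a n p q"
        then show "lk (s + ind U) v = 0 \<longleftrightarrow> lk s v = 0" using U I by (auto simp: lks)
      next
        fix j show "lk (s + ind U) (a, j) = lk s (a, j)" using U I(2)[of j] by (auto simp: lks)
      qed
      then show ?thesis by (rule shift[OF U True])
    next
      case False
      then obtain v where v: "v \<notin> I" "lk s v \<noteq> b v" by blast
      moreover have "lk (s + ind U) v = lk s v" using v U by (auto simp: lks)
      ultimately have "g s = 0" "g (s + ind U) = 0" using supp[of s v] supp[of "s + ind U" v] by auto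
      then show ?thesis by simp
    qed
  qed
  show ?thesis
  proof (rule fsupp_conv_subset_kernel[OF fI B0])
    fix s U assume U: "U \<subseteq> I" "U \<noteq> {}" "\<And>u. u \<in> U \<Longrightarrow> B < lk s u" "\<And>u v. u \<in> U \<Longrightarrow> v \<in> I - U \<Longrightarrow> lk s v < lk s u"
    show "g (s + ind U) = \<omega> U * g s"
    proof (rule step[OF U(1)])
      fix u v assume *: "\<And>v. v \<notin> I \<Longrightarrow> lk s v = b v" "u \<in> U" "v \<in> cells a n p q" "v \<notin> U"
      show "lk s u > lk s v \<or> lk s u + 1 < lk s v"
        using U(3)[OF *(2)] U(4)[OF *(2), of v] *(1)[of v] B[OF *(3)] *(4) by (cases "v \<in> I") auto
    qed
  next
    fix s U assume U: "U \<subseteq> I" "U \<noteq> {}" "\<And>u. u \<in> U \<Longrightarrow> lk s u < - B" "\<And>u v. u \<in> U \<Longrightarrow> v \<in> I - U \<Longrightarrow> lk s u < lk s v"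
    have fU: "finite U" using U(1) fI finite_subset by auto
    have "g (s - ind U + ind U) = \<omega> U * g (s - ind U)"
    proof (rule step[OF U(1)])
      fix u v assume *: "\<And>v. v \<notin> I \<Longrightarrow> lk (s - ind U) v = b v" "u \<in> U" "v \<in> cells a n p q" "v \<notin> U"
      have "lk s u < lk s v"
        using U(3)[OF *(2)] U(4)[OF *(2), of v] *(1)[of v] B[OF *(3)] *(4) fU by (cases "v \<in> I") (auto simp: lookup_minus lookup_ind)
      then show "lk (s - ind U) u > lk (s - ind U) v \<or> lk (s - ind U) u + 1 < lk (s - ind U) v"
        using fU *(2,4) by (simp add: lookup_minus lookup_ind)
    qed
    then show "g s = \<omega> U * g (s - ind U)" unfolding diff_add_cancel .
  qed (rule supp)
qed

lemma diagram_series_kernel: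
  fixes b :: "vertex \<Rightarrow> int"
  assumes d: "diagram a n p q" and x: "generic t x"
    and I: "I \<subseteq> cells a n p q" "\<And>j. (a, j) \<notin> I"
  shows "fsupp (conv (subset_kernel (Pow I - {{}}) (\<lambda>U. row_mon x a n p q (ind U)))
    (\<lambda>s. if \<forall>v. v \<notin> I \<longrightarrow> lk s v = b v then diagram_series t x a n p q \<beta> s else 0))"
proof (rule diagram_kernel[OF d I, where b = b and t = t and \<beta> = \<beta>])
  have x0: "x i \<noteq> 0" for i using x by (simp add: generic_def)
  fix s U assume U: "U \<subseteq> I" and s: "\<forall>v. v \<notin> I \<longrightarrow> lk s v = b v"
    and w: "diagram_wt t a n p q \<beta> (s + ind U) = diagram_wt t a n p q \<beta> s"
  have fU: "finite U" using U I(1) by (meson finite_cells finite_subset)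
  have s': "\<forall>v. v \<notin> I \<longrightarrow> lk (s + ind U) v = b v" using s U fU by (auto simp: lookup_add lookup_ind)
  have "diagram_series t x a n p q \<beta> (s + ind U) = row_mon x a n p q (ind U) * diagram_series t x a n p q \<beta> s"
    by (simp add: diagram_series_def w row_mon_add[OF x0] mult_ac)
  then show "(if \<forall>v. v \<notin> I \<longrightarrow> lk (s + ind U) v = b v then diagram_series t x a n p q \<beta> (s + ind U) else 0) =
    row_mon x a n p q (ind U) * (if \<forall>v. v \<notin> I \<longrightarrow> lk s v = b v then diagram_series t x a n p q \<beta> s else 0)"
    unfolding if_P[OF s] if_P[OF s'] .
qed (metis (mono_tags, lifting))

lemma diagram_wt_support:
  assumes "diagram_wt t a n p q \<beta> s \<noteq> 0" "v \<notin> cells a n p q - {a} \<times> UNIV"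
  shows "lk s v = (if v \<in> cells a n p q then \<beta> (snd v) else 0)"
proof -
  have *: "\<forall>v. v \<notin> cells a n p q \<longrightarrow> lk s v = 0" "\<forall>j\<in>{p a..q a}. lk s (a, j) = \<beta> j"
    using assms(1) by (auto simp: diagram_wt_def split: if_splits)
  obtain i j where v: "v = (i, j)" by (cases v)
  show ?thesis
  proof (cases "v \<in> cells a n p q")
    case True
    then have "i = a" "j \<in> {p a..q a}" using assms(2) by (auto simp: v mem_cells)
    then show ?thesis using * True by (simp add: v)
  qed (use *(1)[rule_format, of v] in simp)
qed

text \<open>All cells below the top row are free. The mass is the product of the numbers
  \<open>1 - row_mon x a n p q (ind U)\<close>, which are nonzero by genericity.\<close>

lemma reg_diagram_series:
  assumes d: "diagram a n p q" and x: "generic t x"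
  shows "\<exists>s. reg (diagram_series t x a n p q \<beta>) s"
proof -
  let ?I = "cells a n p q - {a} \<times> UNIV"
  let ?b = "\<lambda>v. if v \<in> cells a n p q then \<beta> (snd v) else 0"
  let ?Q = "subset_kernel (Pow ?I - {{}}) (\<lambda>U. row_mon x a n p q (ind U))"
  have "lk s v = ?b v" if "diagram_series t x a n p q \<beta> s \<noteq> 0" "v \<notin> ?I" for s v
    using that by (intro diagram_wt_support[of t a n p q \<beta>]) (auto simp: diagram_series_def)
  then have "(\<lambda>s. if \<forall>v. v \<notin> ?I \<longrightarrow> lk s v = ?b v then diagram_series t x a n p q \<beta> s else 0) = diagram_series t x a n p q \<beta>"
    by fastforce
  then have "fsupp (conv ?Q (diagram_series t x a n p q \<beta>))"
    using diagram_series_kernel[OF d x, of ?I ?b \<beta>] by auto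
  moreover have "row_mon x a n p q (ind U) \<noteq> 1" if "U \<in> Pow ?I - {{}}" for U
    using that d by (intro row_mon_ind_neq_1[OF x]) (auto simp: diagram_def)
  then have "mass ?Q \<noteq> 0" by (auto simp: mass_subset_kernel)
  ultimately show ?thesis by (intro reg_of_kernel)
qed

section \<open>Freezing all rows but one\<close>

text \<open>An additive projection whose fibres consist of the arrays that agree outside row
  \<open>r\<close>, in the form required by \<open>reg_fibrewise_null\<close>.\<close>

definition zero_row :: "int \<Rightarrow> (vertex \<Rightarrow>\<^sub>0 int) \<Rightarrow> (vertex \<Rightarrow>\<^sub>0 int)" where
  "zero_row r s = Poly_Mapping.mapp (\<lambda>v k. if fst v = r then 0 else k) s"

lemma lookup_zero_row: "lk (zero_row r s) (i, j) = (if i = r then 0 else lk s (i, j))"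
  by (auto simp: zero_row_def lookup_mapp when_def in_keys_iff)

lemma zero_row_diff: "zero_row r (s - s') = zero_row r s - zero_row r s'"
proof (rule poly_mapping_eqI)
  fix v :: vertex
  show "lk (zero_row r (s - s')) v = lk (zero_row r s - zero_row r s') v"
    by (cases v) (simp add: lookup_zero_row lookup_minus)
qed

lemma zero_row_eq_iff:
  assumes "\<And>j. lk b (r, j) = 0"
  shows "zero_row r s = b \<longleftrightarrow> (\<forall>i j. i \<noteq> r \<longrightarrow> lk s (i, j) = lk b (i, j))"
proof
  show "zero_row r s = b \<Longrightarrow> \<forall>i j. i \<noteq> r \<longrightarrow> lk s (i, j) = lk b (i, j)"
    by (auto simp: lookup_zero_row)
  assume *: "\<forall>i j. i \<noteq> r \<longrightarrow> lk s (i, j) = lk b (i, j)"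
  show "zero_row r s = b"
  proof (rule poly_mapping_eqI)
    fix v :: vertex
    show "lk (zero_row r s) v = lk b v" using * assms by (cases v) (auto simp: lookup_zero_row)
  qed
qed

definition rest_wt :: "'k::field \<Rightarrow> (int \<Rightarrow> 'k) \<Rightarrow> int \<Rightarrow> int \<Rightarrow> (int \<Rightarrow> int) \<Rightarrow> (int \<Rightarrow> int) \<Rightarrow> (int \<Rightarrow> int) \<Rightarrow> int \<Rightarrow> (vertex \<Rightarrow>\<^sub>0 int) \<Rightarrow> 'k" where
  "rest_wt t x a n p q \<beta> r b = (if (\<forall>i j. (i, j) \<notin> cells a n p q \<and> i \<noteq> r \<longrightarrow> lk b (i, j) = 0) \<and> (\<forall>j\<in>{p a..q a}. lk b (a, j) = \<beta> j)
    then (\<Prod>i\<in>{a..<n} - {r - 1, r}. pair_wt t (p i) (q i) (p (i + 1)) (q (i + 1)) (\<lambda>j. lk b (i, j)) (\<lambda>j. lk b (i + 1, j))) *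
      (\<Prod>i\<in>{a..n} - {r}. (x (i + 1) / x i) powi (\<Sum>j\<in>{p i..q i}. lk b (i, j))) else 0)"

lemma diagram_series_fibre:
  assumes r: "a < r" "r < n" and b: "\<And>j. lk b (r, j) = 0"
  shows "(if zero_row r s = b then diagram_series t x a n p q \<beta> s else 0) =
    rest_wt t x a n p q \<beta> r b * fibre_wt t (x (r + 1) / x r, 0) r (p (r - 1), q (r - 1)) (p r, q r) (p (r + 1), q (r + 1)) b s"
proof (cases "\<forall>i j. i \<noteq> r \<longrightarrow> lk s (i, j) = lk b (i, j)")
  case False
  then have "zero_row r s \<noteq> b" using zero_row_eq_iff[OF b] by blast
  moreover have "fibre_wt t (x (r + 1) / x r, 0) r (p (r - 1), q (r - 1)) (p r, q r) (p (r + 1), q (r + 1)) b s = 0"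
    unfolding fibre_wt_def using False by (intro if_not_P) blast
  ultimately show ?thesis by simp
next
  case True
  then have s: "lk s (i, j) = lk b (i, j)" if "i \<noteq> r" for i j using that by simp
  let ?P = "\<lambda>s i. pair_wt t (p i) (q i) (p (i + 1)) (q (i + 1)) (\<lambda>j. lk s (i, j)) (\<lambda>j. lk s (i + 1, j))"
  let ?Y = "\<lambda>s i. (x (i + 1) / x i) powi (\<Sum>j\<in>{p i..q i}. lk s (i, j))"
  have c: "(\<forall>v. v \<notin> cells a n p q \<longrightarrow> lk s v = 0) \<longleftrightarrow>
    (\<forall>i j. (i, j) \<notin> cells a n p q \<and> i \<noteq> r \<longrightarrow> lk b (i, j) = 0) \<and> (\<forall>j. j \<notin> {p r..q r} \<longrightarrow> lk s (r, j) = 0)"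
    (is "?A \<longleftrightarrow> ?B \<and> ?C")
  proof (intro iffI conjI)
    assume A: ?A
    show ?B
    proof (intro allI impI)
      fix i j assume "(i, j) \<notin> cells a n p q \<and> i \<noteq> r"
      then show "lk b (i, j) = 0" using A[rule_format, of "(i, j)"] s[of i j] by simp
    qed
    show ?C using A r by (auto simp: mem_cells)
  next
    assume BC: "?B \<and> ?C"
    show ?A
    proof (intro allI impI)
      fix v assume v: "v \<notin> cells a n p q"
      obtain i j where ij: "v = (i, j)" by (cases v)
      show "lk s v = 0"
      proof (cases "i = r")
        case True
        then have "j \<notin> {p r..q r}" using v r ij by (auto simp: mem_cells)
        then show ?thesis using BC True ij by simp
      next
        case False
        then show ?thesis using BC[THEN conjunct1, rule_format, of i j] v ij s[of i j] by simp
      qed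
    qed
  qed
  have t: "(\<forall>j\<in>{p a..q a}. lk s (a, j) = \<beta> j) \<longleftrightarrow> (\<forall>j\<in>{p a..q a}. lk b (a, j) = \<beta> j)"
    using r s[of a] by simp
  have "{a..<n} = insert (r - 1) (insert r ({a..<n} - {r - 1, r}))" using r by auto
  then have "(\<Prod>i\<in>{a..<n}. ?P s i) = (\<Prod>i\<in>insert (r - 1) (insert r ({a..<n} - {r - 1, r})). ?P s i)" by (rule arg_cong)
  also have "\<dots> = ?P s (r - 1) * (?P s r * (\<Prod>i\<in>{a..<n} - {r - 1, r}. ?P s i))" by simp
  also have "(\<Prod>i\<in>{a..<n} - {r - 1, r}. ?P s i) = (\<Prod>i\<in>{a..<n} - {r - 1, r}. ?P b i)"
    by (rule prod.cong) (auto simp: s)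
  also have "?P s (r - 1) = pair_wt t (p (r - 1)) (q (r - 1)) (p r) (q r) (\<lambda>j. lk b (r - 1, j)) (\<lambda>j. lk s (r, j))"
    by (simp add: s)
  also have "?P s r = pair_wt t (p r) (q r) (p (r + 1)) (q (r + 1)) (\<lambda>j. lk s (r, j)) (\<lambda>j. lk b (r + 1, j))"
    by (simp add: s)
  finally have P: "(\<Prod>i\<in>{a..<n}. ?P s i) = pair_wt t (p (r - 1)) (q (r - 1)) (p r) (q r) (\<lambda>j. lk b (r - 1, j)) (\<lambda>j. lk s (r, j)) *
    (pair_wt t (p r) (q r) (p (r + 1)) (q (r + 1)) (\<lambda>j. lk s (r, j)) (\<lambda>j. lk b (r + 1, j)) * (\<Prod>i\<in>{a..<n} - {r - 1, r}. ?P b i))" .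
  have "(\<Prod>i\<in>{a..n}. ?Y s i) = ?Y s r * (\<Prod>i\<in>{a..n} - {r}. ?Y s i)"
    using r by (intro prod.remove) auto
  also have "(\<Prod>i\<in>{a..n} - {r}. ?Y s i) = (\<Prod>i\<in>{a..n} - {r}. ?Y b i)"
    by (rule prod.cong) (auto simp: s)
  finally have Y: "(\<Prod>i\<in>{a..n}. ?Y s i) = ?Y s r * (\<Prod>i\<in>{a..n} - {r}. ?Y b i)" .
  define B where "B \<longleftrightarrow> (\<forall>i j. (i, j) \<notin> cells a n p q \<and> i \<noteq> r \<longrightarrow> lk b (i, j) = 0)"
  define C where "C \<longleftrightarrow> (\<forall>j. j \<notin> {p r..q r} \<longrightarrow> lk s (r, j) = 0)"
  define D where "D \<longleftrightarrow> (\<forall>j\<in>{p a..q a}. lk b (a, j) = \<beta> j)"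
  have 1: "diagram_series t x a n p q \<beta> s = (if (B \<and> C) \<and> D then (\<Prod>i\<in>{a..<n}. ?P s i) else 0) * (\<Prod>i\<in>{a..n}. ?Y s i)"
    unfolding diagram_series_def diagram_wt_def row_mon_def c t B_def C_def D_def ..
  have 2: "rest_wt t x a n p q \<beta> r b = (if B \<and> D then (\<Prod>i\<in>{a..<n} - {r - 1, r}. ?P b i) * (\<Prod>i\<in>{a..n} - {r}. ?Y b i) else 0)"
    unfolding rest_wt_def B_def D_def ..
  have 3: "fibre_wt t (x (r + 1) / x r, 0) r (p (r - 1), q (r - 1)) (p r, q r) (p (r + 1), q (r + 1)) b s =
    (if C then pair_wt t (p (r - 1)) (q (r - 1)) (p r) (q r) (\<lambda>j. lk b (r - 1, j)) (\<lambda>j. lk s (r, j)) *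
      pair_wt t (p r) (q r) (p (r + 1)) (q (r + 1)) (\<lambda>j. lk s (r, j)) (\<lambda>j. lk b (r + 1, j)) * ?Y s r else 0)"
    unfolding fibre_wt_def C_def fst_conv snd_conv add_0 by (rule if_cong) (use True in auto)
  have 4: "zero_row r s = b" using True zero_row_eq_iff[OF b] by blast
  show ?thesis unfolding 1 2 3 P Y using 4 by (cases B; cases C; cases D) (simp_all only: if_True if_False simp_thms mult_ac mult_zero_left mult_zero_right)
qed

text \<open>\<open>x r\<close> stands in the numerator of the factor of row \<open>r - 1\<close> and
  \<open>x (r + 1)\<close> in the denominator of that of row \<open>r + 1\<close>, so the swap
  multiplies both bases by \<open>z\<close>. This is the reflection of exponents in
  \<open>row_exchange\<close>.\<close>

lemma rest_wt_swap:
  fixes x :: "int \<Rightarrow> 'k::field"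
  assumes r: "a < r" "r < n" and x: "\<And>i. x i \<noteq> 0"
    and p: "\<And>i. i \<noteq> r \<Longrightarrow> p' i = p i" and q: "\<And>i. i \<noteq> r \<Longrightarrow> q' i = q i"
  shows "rest_wt t (x \<circ> Transposition.transpose r (r + 1)) a n p' q' \<beta> r b = rest_wt t x a n p q \<beta> r b *
    (x (r + 1) / x r) powi ((\<Sum>j\<in>{p (r - 1)..q (r - 1)}. lk b (r - 1, j)) + (\<Sum>j\<in>{p (r + 1)..q (r + 1)}. lk b (r + 1, j)))"
proof -
  let ?x = "x \<circ> Transposition.transpose r (r + 1)" and ?z = "x (r + 1) / x r"
  let ?S = "\<lambda>i. \<Sum>j\<in>{p i..q i}. lk b (i, j)"
  have c: "(i, j) \<notin> cells a n p' q' \<and> i \<noteq> r \<longleftrightarrow> (i, j) \<notin> cells a n p q \<and> i \<noteq> r" for i j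
    by (auto simp: mem_cells p q)
  have P: "(\<Prod>i\<in>{a..<n} - {r - 1, r}. pair_wt t (p' i) (q' i) (p' (i + 1)) (q' (i + 1)) (\<lambda>j. lk b (i, j)) (\<lambda>j. lk b (i + 1, j))) =
    (\<Prod>i\<in>{a..<n} - {r - 1, r}. pair_wt t (p i) (q i) (p (i + 1)) (q (i + 1)) (\<lambda>j. lk b (i, j)) (\<lambda>j. lk b (i + 1, j)))"
    by (rule prod.cong) (auto simp: p q)
  have "(\<Prod>i\<in>{a..n} - {r}. (?x (i + 1) / ?x i) powi (\<Sum>j\<in>{p' i..q' i}. lk b (i, j))) =
    (\<Prod>i\<in>{a..n} - {r}. (x (i + 1) / x i) powi ?S i * (if i = r - 1 \<or> i = r + 1 then ?z powi ?S i else 1))"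
  proof (rule prod.cong[OF refl])
    fix i assume i: "i \<in> {a..n} - {r}"
    then have eq: "?x (i + 1) / ?x i = x (i + 1) / x i * (if i = r - 1 \<or> i = r + 1 then ?z else 1)"
      using x[of r] x[of "r + 1"] x[of i] by (auto simp: transpose_def)
    have pq: "p' i = p i" "q' i = q i" using i p q by auto
    show "(?x (i + 1) / ?x i) powi (\<Sum>j\<in>{p' i..q' i}. lk b (i, j)) = (x (i + 1) / x i) powi ?S i * (if i = r - 1 \<or> i = r + 1 then ?z powi ?S i else 1)"
      unfolding eq pq power_int_mult_distrib by simp
  qed
  also have "\<dots> = (\<Prod>i\<in>{a..n} - {r}. (x (i + 1) / x i) powi ?S i) * (\<Prod>i\<in>{a..n} - {r}. if i = r - 1 \<or> i = r + 1 then ?z powi ?S i else 1)"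
    by (rule prod.distrib)
  also have "(\<Prod>i\<in>{a..n} - {r}. if i = r - 1 \<or> i = r + 1 then ?z powi ?S i else 1) =
      (\<Prod>i\<in>{r - 1, r + 1}. if i = r - 1 \<or> i = r + 1 then ?z powi ?S i else 1)"
    by (rule prod.mono_neutral_right) (use r in auto)
  also have "\<dots> = ?z powi (?S (r - 1) + ?S (r + 1))" using x by (simp add: power_int_add)
  finally have Y: "(\<Prod>i\<in>{a..n} - {r}. (?x (i + 1) / ?x i) powi (\<Sum>j\<in>{p' i..q' i}. lk b (i, j))) =
    (\<Prod>i\<in>{a..n} - {r}. (x (i + 1) / x i) powi ?S i) * ?z powi (?S (r - 1) + ?S (r + 1))" .
  have pa: "p' a = p a" "q' a = q a" using p q r by auto
  show ?thesis unfolding rest_wt_def c P Y pa if_distrib[of "\<lambda>u. u * _"] mult_zero_left mult.assoc ..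
qed

lemma fibre_wt_exponent:
  assumes "z \<noteq> (0::'k::field)"
  shows "z powi e * fibre_wt t (1 / z, 0) r P M P2 b s = fibre_wt t (1 / z, - e) r P M P2 b s"
proof -
  have inv: "(1 / z) powi k = z powi (- k)" for k
    by (simp add: power_int_minus divide_inverse power_int_inverse)
  have "z powi e * (c * (1 / z) powi (0 + k)) = c * (1 / z) powi (- e + k)" for k c
  proof -
    have "z powi e * z powi (- (0 + k)) = z powi (- (- e + k))" using power_int_add[of z e "- k"] assms by simp
    then show ?thesis unfolding inv by (metis mult.left_commute)
  qed
  then show ?thesis unfolding fibre_wt_def fst_conv snd_conv if_distrib[of "\<lambda>u. z powi e * u"] by (simp only: mult_zero_right)
qed

lemma generic_z:
  assumes "generic t x"
  shows "x (r + 1) / x r \<noteq> 0" "x (r + 1) / x r \<noteq> 1" "x (r + 1) / x r \<noteq> t"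
proof -
  have x: "x i \<noteq> 0" for i using assms by (simp add: generic_def)
  then show "x (r + 1) / x r \<noteq> 0" by simp
  have "x (r + 1) \<noteq> t * x r" using assms by (simp add: generic_def)
  then show "x (r + 1) / x r \<noteq> t" using x[of r] by (auto simp: field_simps)
  have "(\<Prod>i\<in>{r, r + 1}. x i powi (if i = r then -1 else 1)) \<noteq> 1"
    by (rule generic_prod_neq_1[OF assms]) auto
  then show "x (r + 1) / x r \<noteq> 1" by (simp add: power_int_minus field_simps)
qed

lemma exists_window:
  fixes b :: "vertex \<Rightarrow>\<^sub>0 int"
  obtains L H where "L < H" "\<And>v. L < lk b v \<and> lk b v < H"
proof -
  define H where "H = 1 + (\<Sum>v\<in>keys b. \<bar>lk b v\<bar>)"
  have "\<bar>lk b v\<bar> < H" for v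
  proof (cases "v \<in> keys b")
    case True
    then have "\<bar>lk b v\<bar> \<le> (\<Sum>v\<in>keys b. \<bar>lk b v\<bar>)" by (intro member_le_sum) auto
    then show ?thesis by (simp add: H_def)
  next
    case False
    have "0 \<le> (\<Sum>v\<in>keys b. \<bar>lk b v\<bar>)" by (intro sum_nonneg) auto
    moreover have "lk b v = 0" using False by (simp add: in_keys_iff)
    ultimately show ?thesis unfolding H_def by linarith
  qed
  then have "- H < lk b v \<and> lk b v < H" for v by (smt (verit))
  moreover from this[of undefined] have "- H < H" by simp
  ultimately show thesis using that by blast
qed

text \<open>The constant \<open>C\<close> is independent of \<open>b\<close>, so it can be pulled
  out of the sum over all fibres. The new row \<open>r\<close> is chosen such that the enlarging
  step now leads from \<open>r\<close> to \<open>r + 1\<close>.\<close>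

lemma flip_fibre:
  fixes x :: "int \<Rightarrow> 'k::field"
  assumes d: "diagram a n p q" and x: "generic t x" and r: "a < r" "r < n"
    and out: "p r = p (r - 1) - 1" "q r = q (r - 1)" and b: "\<And>j. lk b (r, j) = 0"
  defines "C \<equiv> C_top t (x (r + 1) / x r) (p (r - 1)) (p (r + 1)) / C_bot t (x (r + 1) / x r) (q (r - 1)) (q (r + 1))"
    and "x' \<equiv> x \<circ> Transposition.transpose r (r + 1)" and "p' \<equiv> p(r := p (r + 1) + 1)" and "q' \<equiv> q(r := q (r + 1))"
  shows "fsupp (\<lambda>s. if zero_row r s = b then diagram_series t x' a n p' q' \<beta> s else 0)"
    and "reg (\<lambda>s. if zero_row r s = b then diagram_series t x a n p q \<beta> s else 0)
      (C * (if p (r + 1) \<le> q (r + 1) then tsum (\<lambda>s. if zero_row r s = b then diagram_series t x' a n p' q' \<beta> s else 0) else 0))"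
proof -
  define z where "z = x (r + 1) / x r"
  have z: "z \<noteq> 0" "z \<noteq> 1" "z \<noteq> t" unfolding z_def by (rule generic_z[OF x])+
  have x0: "x i \<noteq> 0" for i using x by (simp add: generic_def)
  obtain L H where LH: "L < H" "\<And>v. L < lk b v \<and> lk b v < H" using exists_window by blast
  define e where "e = (\<Sum>j\<in>{p (r - 1)..q (r - 1)}. lk b (r - 1, j)) + (\<Sum>j\<in>{p (r + 1)..q (r + 1)}. lk b (r + 1, j))"
  define R where "R = rest_wt t x a n p q \<beta> r b"
  define f1 where "f1 = fibre_wt t (z, 0) r (p (r - 1), q (r - 1)) (p (r - 1) - 1, q (r - 1)) (p (r + 1), q (r + 1)) b"
  define f2 where "f2 = fibre_wt t (1 / z, - e) r (p (r - 1), q (r - 1)) (p (r + 1) + 1, q (r + 1)) (p (r + 1), q (r + 1)) b"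
  have pq: "p (r - 1) \<le> q (r - 1) + 1" "p (r + 1) \<le> q (r + 1) + 1"
    "p (r + 1) = p (r - 1) - 1 \<or> p (r + 1) = p (r - 1) - 2" "q (r + 1) = q (r - 1) \<or> q (r + 1) = q (r - 1) - 1"
  proof -
    have "steps (p r) (q r) (p (r + 1)) (q (r + 1))" using d r by (simp add: diagram_def)
    then show "p (r + 1) = p (r - 1) - 1 \<or> p (r + 1) = p (r - 1) - 2" "q (r + 1) = q (r - 1) \<or> q (r + 1) = q (r - 1) - 1"
      using out by (auto simp: steps_def)
  qed (use d r in \<open>simp_all add: diagram_def\<close>)
  have 1: "(\<lambda>s. if zero_row r s = b then diagram_series t x a n p q \<beta> s else 0) = (\<lambda>s. R * f1 s)"
    unfolding R_def f1_def z_def diagram_series_fibre[OF r b] out ..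
  have x': "x' (r + 1) / x' r = 1 / z" by (simp add: x'_def z_def)
  have p': "p' r = p (r + 1) + 1" "p' (r - 1) = p (r - 1)" "p' (r + 1) = p (r + 1)"
    "q' r = q (r + 1)" "q' (r - 1) = q (r - 1)" "q' (r + 1) = q (r + 1)" by (simp_all add: p'_def q'_def)
  have R': "rest_wt t x' a n p' q' \<beta> r b = R * z powi e"
    unfolding R_def z_def e_def x'_def by (rule rest_wt_swap[OF r x0]) (auto simp: p'_def q'_def)
  have 2: "(\<lambda>s. if zero_row r s = b then diagram_series t x' a n p' q' \<beta> s else 0) = (\<lambda>s. R * f2 s)"
    unfolding f2_def diagram_series_fibre[OF r b] x' p' R' mult.assoc fibre_wt_exponent[OF z(1)] ..
  define SR where "SR = (\<Sum>m\<in>bounded_rows (p (r + 1) + 1) (q (r + 1)) L H. pair_wt t (p (r - 1)) (q (r - 1)) (p (r + 1) + 1) (q (r + 1)) (\<lambda>j. lk b (r - 1, j)) m *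
        pair_wt t (p (r + 1) + 1) (q (r + 1)) (p (r + 1)) (q (r + 1)) m (\<lambda>j. lk b (r + 1, j)) * (1 / z) powi (- e + (\<Sum>j\<in>{p (r + 1) + 1..q (r + 1)}. m j)))"
  have "fsupp f2" unfolding f2_def by (rule fibre_wt_lower_row(1)[OF b, where L = L and H = H]) (use LH in simp)
  moreover have "tsum f2 = SR" unfolding f2_def SR_def by (rule fibre_wt_lower_row(2)[OF b]) (use LH in simp)
  ultimately have f2: "fsupp f2" "tsum f2 = SR" .
  show "fsupp (\<lambda>s. if zero_row r s = b then diagram_series t x' a n p' q' \<beta> s else 0)"
    unfolding 2 by (rule fsupp_scale[OF f2(1)])
  have t2: "tsum (\<lambda>s. if zero_row r s = b then diagram_series t x' a n p' q' \<beta> s else 0) = R * SR"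
    unfolding 2 tsum_scale[OF f2(1)] f2(2) ..
  define SL where "SL = (\<Sum>m\<in>bounded_rows (p (r - 1) - 1) (q (r - 1)) L H. pair_wt t (p (r - 1)) (q (r - 1)) (p (r - 1) - 1) (q (r - 1)) (\<lambda>j. lk b (r - 1, j)) m *
      pair_wt t (p (r - 1) - 1) (q (r - 1)) (p (r + 1)) (q (r + 1)) m (\<lambda>j. lk b (r + 1, j)) * (z powi (\<Sum>j\<in>{p (r - 1) - 1..q (r - 1)}. m j) *
      ((if m (p (r - 1) - 1) = H then 1 / (1 - z) else 1) * (if m (q (r - 1)) = L then 1 / (1 - 1 / z) else 1))))"
  have f1: "reg f1 SL"
    unfolding f1_def SL_def by (rule reg_fibre_wt_upper_row[OF z(1,2) LH(1) pq(1,3,4) b]; use LH in simp)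
  have SR: "SR = (\<Sum>m\<in>bounded_rows (p (r + 1) + 1) (q (r + 1)) L H. pair_wt t (p (r - 1)) (q (r - 1)) (p (r + 1) + 1) (q (r + 1)) (\<lambda>j. lk b (r - 1, j)) m *
        pair_wt t (p (r + 1) + 1) (q (r + 1)) (p (r + 1)) (q (r + 1)) m (\<lambda>j. lk b (r + 1, j)) *
        z powi ((\<Sum>j\<in>{p (r - 1)..q (r - 1)}. lk b (r - 1, j)) + (\<Sum>j\<in>{p (r + 1)..q (r + 1)}. lk b (r + 1, j)) - (\<Sum>j\<in>{p (r + 1) + 1..q (r + 1)}. m j)))"
  proof -
    have "(1 / z) powi k = z powi (- k)" for k by (simp add: power_int_minus divide_inverse power_int_inverse)
    then show ?thesis unfolding SR_def by (simp add: e_def add.commute)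
  qed
  have "C_bot t z (q (r - 1)) (q (r + 1)) * SL = C_top t z (p (r - 1)) (p (r + 1)) * (if p (r + 1) \<le> q (r + 1) then SR else 0)"
    unfolding SL_def SR by (rule row_exchange[OF z(1,2) LH(1) pq]; use LH in simp)
  moreover have "C_bot t z (q (r - 1)) (q (r + 1)) \<noteq> 0" using z by (simp add: C_bot_def)
  ultimately have SL: "SL = C * (if p (r + 1) \<le> q (r + 1) then SR else 0)"
    unfolding C_def z_def[symmetric] by (simp add: field_simps)
  show "reg (\<lambda>s. if zero_row r s = b then diagram_series t x a n p q \<beta> s else 0)
      (C * (if p (r + 1) \<le> q (r + 1) then tsum (\<lambda>s. if zero_row r s = b then diagram_series t x' a n p' q' \<beta> s else 0) else 0))"
    unfolding 1 t2 using reg_scale[OF f1, of R] unfolding SL by (cases "p (r + 1) \<le> q (r + 1)") (simp_all add: mult.left_commute)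
qed

text \<open>Only subsets of row \<open>r\<close> contribute factors, so the keys vanish under
  \<open>zero_row\<close>. The kernel does not depend on \<open>b\<close>, although the range
  outside which it annihilates the fibre does.\<close>

lemma row_kernel:
  fixes x :: "int \<Rightarrow> 'k::field"
  assumes d: "diagram a n p q" and x: "generic t x" and r: "a < r" "r < n"
  shows "\<exists>Q. mass Q \<noteq> 0 \<and> (\<forall>m\<in>keys Q. zero_row r m = 0) \<and>
    (\<forall>b. fsupp (conv Q (\<lambda>s. if zero_row r s = b then diagram_series t x a n p q \<beta> s else 0)))"
proof -
  let ?I = "{r} \<times> {p r..q r}"
  let ?Q = "subset_kernel (Pow ?I - {{}}) (\<lambda>U. row_mon x a n p q (ind U))"
  have I: "?I \<subseteq> cells a n p q" "finite ?I" using r by (auto simp: mem_cells)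
  show ?thesis
  proof (intro exI[of _ ?Q] conjI ballI allI)
    have "row_mon x a n p q (ind U) \<noteq> 1" if "U \<in> Pow ?I - {{}}" for U
      using that d I by (intro row_mon_ind_neq_1[OF x]) (auto simp: diagram_def)
    then show "mass ?Q \<noteq> 0" using I by (auto simp: mass_subset_kernel)
    show "zero_row r m = 0" if "m \<in> keys ?Q" for m
    proof (rule poly_mapping_eqI)
      fix v :: vertex
      have "v \<notin> ?I \<Longrightarrow> lk m v = 0" using keys_subset_kernel[OF I(2) _ that, of v] by blast
      then show "lk (zero_row r m) v = lk 0 v" by (cases v) (auto simp: lookup_zero_row)
    qed
    show "fsupp (conv ?Q (\<lambda>s. if zero_row r s = b then diagram_series t x a n p q \<beta> s else 0))" for b
    proof (cases "\<forall>j. lk b (r, j) = 0")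
      case True
      then have b: "\<And>j. lk b (r, j) = 0" by simp
      have "(\<lambda>s. if zero_row r s = b then diagram_series t x a n p q \<beta> s else 0) =
        (\<lambda>s. if \<forall>v. v \<notin> ?I \<longrightarrow> lk s v = lk b v then diagram_series t x a n p q \<beta> s else 0)"
      proof
        fix s
        have iff: "(\<forall>v. v \<notin> ?I \<longrightarrow> lk s v = lk b v) \<longleftrightarrow> zero_row r s = b" if "diagram_series t x a n p q \<beta> s \<noteq> 0"
        proof -
          have *: "\<forall>v. v \<notin> cells a n p q \<longrightarrow> lk s v = 0"
            using that by (auto simp: diagram_series_def diagram_wt_def split: if_splits)
          have row: "lk s (r, j) = 0" if "j \<notin> {p r..q r}" for j
            using *[rule_format, of "(r, j)"] that by (auto simp: mem_cells)
          show ?thesis unfolding zero_row_eq_iff[OF b]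
          proof (intro iffI allI impI)
            fix i j assume "\<forall>v. v \<notin> ?I \<longrightarrow> lk s v = lk b v" "i \<noteq> r"
            then show "lk s (i, j) = lk b (i, j)" by simp
          next
            fix v assume A: "\<forall>i j. i \<noteq> r \<longrightarrow> lk s (i, j) = lk b (i, j)" and v: "v \<notin> ?I"
            obtain i j where ij: "v = (i, j)" by (cases v)
            show "lk s v = lk b v"
            proof (cases "i = r")
              case True
              then show ?thesis using v row[of j] b[of j] by (simp add: ij)
            qed (use A ij in simp)
          qed
        qed
        show "(if zero_row r s = b then diagram_series t x a n p q \<beta> s else 0) =
          (if \<forall>v. v \<notin> ?I \<longrightarrow> lk s v = lk b v then diagram_series t x a n p q \<beta> s else 0)"
        proof (cases "diagram_series t x a n p q \<beta> s = 0")
          case False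
          show ?thesis unfolding iff[OF False] ..
        qed (simp only: if_cancel)
      qed
      then show ?thesis using diagram_series_kernel[OF d x I(1), of "lk b" \<beta>] r by auto
    next
      case False
      then have "zero_row r s \<noteq> b" for s by (metis lookup_zero_row)
      then have "(\<lambda>s. if zero_row r s = b then diagram_series t x a n p q \<beta> s else 0) = (\<lambda>s. 0)" by auto
      then show ?thesis by (simp add: conv_def fsupp_def)
    qed
  qed
qed

lemma zero_row_fibre_empty:
  assumes "lk b (r, j) \<noteq> 0"
  shows "(\<lambda>s. if zero_row r s = b then g s else 0) = (\<lambda>s. 0)"
proof
  fix s
  have "zero_row r s \<noteq> b" using assms lookup_zero_row[of r s r j] by auto
  then show "(if zero_row r s = b then g s else 0) = 0" by simp
qed

lemma reg_zero: "reg (\<lambda>x. 0) 0"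
  unfolding reg_def by (rule exI[of _ 1]) (simp add: conv_def fsupp_def tsum_def)

text \<open>Row \<open>r + 1\<close> is empty, which forces row \<open>r - 1\<close> to be empty
  too; every fibre is then a multiple of a two-sided geometric series and has value \<open>0\<close>
  by \<open>flip_fibre\<close>.\<close>

lemma diagram_series_null_bottom:
  fixes x :: "int \<Rightarrow> 'k::field"
  assumes d: "diagram a n p q" and x: "generic t x" and r: "a < r" "r < n"
    and out: "p r = p (r - 1) - 1" "q r = q (r - 1)" and e: "\<not> p (r + 1) \<le> q (r + 1)"
  shows "reg (diagram_series t x a n p q \<beta>) 0"
proof -
  obtain s where s: "reg (diagram_series t x a n p q \<beta>) s" using reg_diagram_series[OF d x] by blast
  obtain Q where "mass Q \<noteq> 0 \<and> (\<forall>m\<in>keys Q. zero_row r m = 0) \<and>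
      (\<forall>b. fsupp (conv Q (\<lambda>s. if zero_row r s = b then diagram_series t x a n p q \<beta> s else 0)))"
    using row_kernel[OF d x r, of \<beta>] by (rule exE)
  then have Q: "mass Q \<noteq> 0" "\<And>m. m \<in> keys Q \<Longrightarrow> zero_row r m = 0"
    "\<And>b. fsupp (conv Q (\<lambda>s. if zero_row r s = b then diagram_series t x a n p q \<beta> s else 0))" by auto
  have "s = 0"
  proof (rule reg_fibrewise_null[OF zero_row_diff s Q])
    fix b show "reg (\<lambda>s. if zero_row r s = b then diagram_series t x a n p q \<beta> s else 0) 0"
    proof (cases "\<forall>j. lk b (r, j) = 0")
      case True
      then show ?thesis using flip_fibre(2)[OF d x r out, of b \<beta>] e by simp
    next
      case False
      then obtain j where "lk b (r, j) \<noteq> 0" by auto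
      then show ?thesis by (simp add: zero_row_fibre_empty reg_zero)
    qed
  qed
  then show ?thesis using s by simp
qed

text \<open>The fibres of the original series need not have value \<open>0\<close>, but those of the
  difference \<open>g1 - C * g2\<close> do. Hence the two total values are proportional, and the
  second is zero by assumption.\<close>

lemma diagram_series_null_flip:
  fixes x :: "int \<Rightarrow> 'k::field"
  assumes d: "diagram a n p q" and x: "generic t x" and r: "a < r" "r < n"
    and out: "p r = p (r - 1) - 1" "q r = q (r - 1)" and e: "p (r + 1) \<le> q (r + 1)"
    and IH: "reg (diagram_series t (x \<circ> Transposition.transpose r (r + 1)) a n (p(r := p (r + 1) + 1)) (q(r := q (r + 1))) \<beta>) 0"
  shows "reg (diagram_series t x a n p q \<beta>) 0"
proof -
  define C where "C = C_top t (x (r + 1) / x r) (p (r - 1)) (p (r + 1)) / C_bot t (x (r + 1) / x r) (q (r - 1)) (q (r + 1))"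
  define g1 where "g1 = diagram_series t x a n p q \<beta>"
  define g2 where "g2 = diagram_series t (x \<circ> Transposition.transpose r (r + 1)) a n (p(r := p (r + 1) + 1)) (q(r := q (r + 1))) \<beta>"
  obtain s where s: "reg g1 s" using reg_diagram_series[OF d x] unfolding g1_def by blast
  obtain Q where "mass Q \<noteq> 0 \<and> (\<forall>m\<in>keys Q. zero_row r m = 0) \<and>
      (\<forall>b. fsupp (conv Q (\<lambda>s. if zero_row r s = b then g1 s else 0)))"
    using row_kernel[OF d x r, of \<beta>] unfolding g1_def by (rule exE)
  then have Q: "mass Q \<noteq> 0" "\<And>m. m \<in> keys Q \<Longrightarrow> zero_row r m = 0"
    "\<And>b. fsupp (conv Q (\<lambda>s. if zero_row r s = b then g1 s else 0))" by auto
  have g: "reg (\<lambda>s. g1 s + (- C) * g2 s) (s + (- C) * 0)"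
    using reg_add[OF s reg_scale[OF IH[folded g2_def], of "- C"]] .
  have f2: "fsupp (\<lambda>s. if zero_row r s = b then g2 s else 0)" for b
  proof (cases "\<forall>j. lk b (r, j) = 0")
    case True
    then show ?thesis using flip_fibre(1)[OF d x r out, of b \<beta>] unfolding g2_def by simp
  next
    case False
    then obtain j where "lk b (r, j) \<noteq> 0" by auto
    then show ?thesis by (simp add: zero_row_fibre_empty) (simp add: fsupp_def)
  qed
  have split: "(\<lambda>s. if zero_row r s = b then g1 s + (- C) * g2 s else 0) =
    (\<lambda>s. (if zero_row r s = b then g1 s else 0) + (- C) * (if zero_row r s = b then g2 s else 0))" for b
    by auto
  have "s + (- C) * 0 = 0"
  proof (rule reg_fibrewise_null[OF zero_row_diff g Q(1,2)])
    fix b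
    show "fsupp (conv Q (\<lambda>s. if zero_row r s = b then g1 s + (- C) * g2 s else 0))"
      unfolding split conv_fun_add conv_fun_scale by (rule fsupp_add[OF Q(3) fsupp_scale[OF fsupp_conv[OF f2]]])
    show "reg (\<lambda>s. if zero_row r s = b then g1 s + (- C) * g2 s else 0) 0"
    proof (cases "\<forall>j. lk b (r, j) = 0")
      case True
      then have "reg (\<lambda>s. if zero_row r s = b then g1 s else 0) (C * tsum (\<lambda>s. if zero_row r s = b then g2 s else 0))"
        using flip_fibre(2)[OF d x r out, of b \<beta>] e unfolding g1_def g2_def C_def by simp
      from reg_add[OF this reg_scale[OF reg_finite[OF f2[of b]], of "- C"]]
      show ?thesis unfolding split by simp
    next
      case False
      then obtain j where "lk b (r, j) \<noteq> 0" by auto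
      then show ?thesis by (simp add: zero_row_fibre_empty reg_zero)
    qed
  qed
  then show ?thesis using s unfolding g1_def by simp
qed

text \<open>Induction on the distance of the enlarging step from the bottom, for all shapes and all
  generic \<open>x\<close> together, since each exchange changes both.\<close>

theorem diagram_series_null:
  fixes x :: "int \<Rightarrow> 'k::field"
  assumes "diagram a n p q" "generic t x" "a < r" "r < n" "p r = p (r - 1) - 1" "q r = q (r - 1)"
  shows "reg (diagram_series t x a n p q \<beta>) 0"
  using assms
proof (induction "nat (n - r)" arbitrary: r x p q rule: less_induct)
  case less
  show ?case
  proof (cases "p (r + 1) \<le> q (r + 1)")
    case False
    then show ?thesis using diagram_series_null_bottom less.prems by blast
  next
    case True
    let ?p = "p(r := p (r + 1) + 1)" and ?q = "q(r := q (r + 1))"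
    have n: "r + 1 < n" using True less.prems by (cases "r + 1 = n") (auto simp: diagram_def)
    have st: "steps (p (r - 1)) (q (r - 1)) (p r) (q r)" "steps (p r) (q r) (p (r + 1)) (q (r + 1))"
      using less.prems(1,3,4) unfolding diagram_def by (auto dest!: spec[of _ "r - 1"])
    \<comment> \<open>The exchange merely permutes the two steps adjacent to row \<open>r\<close>,
      so the conditions on a diagram persist.\<close>
    have "diagram a n ?p ?q"
      unfolding diagram_def
    proof (intro conjI allI impI)
      fix i assume "a \<le> i \<and> i < n"
      then show "steps (?p i) (?q i) (?p (i + 1)) (?q (i + 1))"
        using less.prems(1) st less.prems(5,6) unfolding diagram_def by (cases "i = r"; cases "i = r - 1") (auto simp: steps_def)
    qed (use less.prems(1,4) True in \<open>auto simp: diagram_def\<close>)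
    then have "reg (diagram_series t (x \<circ> Transposition.transpose r (r + 1)) a n ?p ?q \<beta>) 0"
      using n less.prems(3) by (intro less.hyps[of "r + 1"] generic_swap less.prems(2)) auto
    then show ?thesis by (rule diagram_series_null_flip[OF less.prems(1-6) True])
  qed
qed

section \<open>Rational functions\<close>

lemma laurent_times_series_conv: "laurent_times_series Q S = conv Q S"
  by (simp add: laurent_times_series_def conv_def fun_eq_iff)

lemma lookup_times_conv: "lk (Q * p) = conv Q (lk p)"
proof (induction Q rule: poly_mapping_additive_induct)
  case (single m k)
  show ?case
  proof (induction p rule: poly_mapping_additive_induct)
    case (single m' k')
    show ?case by (auto simp: fun_eq_iff mult_single lookup_single when_def)
  next
    case (add p p')
    then show ?case by (simp add: fun_eq_iff lookup_add distrib_left)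
  qed (auto simp: fun_eq_iff)
next
  case (add Q Q')
  then show ?case by (simp add: fun_eq_iff lookup_add distrib_right conv_add)
qed (auto simp: fun_eq_iff)

text \<open>Two denominators act on the series by commuting convolutions, so cross multiplication
  shows that both fractions agree; thus the description in \<open>weighted_ipt\<close> is
  unique.\<close>

lemma weighted_ipt_eq:
  assumes "Q \<noteq> 0" "conv Q (weighted_series \<phi> P) = lk p"
  shows "weighted_ipt \<phi> P = Fract p Q"
  unfolding weighted_ipt_def laurent_times_series_conv
proof (rule the_equality)
  show "\<exists>Q' p'. Q' \<noteq> 0 \<and> conv Q' (weighted_series \<phi> P) = lk p' \<and> Fract p Q = Fract p' Q'"
    by (intro exI[of _ Q] exI[of _ p]) (use assms in simp)
  fix r assume "\<exists>Q' p'. Q' \<noteq> 0 \<and> conv Q' (weighted_series \<phi> P) = lk p' \<and> r = Fract p' Q'"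
  then obtain Q' p' where *: "Q' \<noteq> 0" "conv Q' (weighted_series \<phi> P) = lk p'" "r = Fract p' Q'" by blast
  have "lk (Q * p') = lk (Q' * p)"
    unfolding lookup_times_conv *(2)[symmetric] assms(2)[symmetric] by (rule conv_commute)
  then have "Q * p' = Q' * p" by (simp only: poly_mapping_eq_iff)
  then have "p' * Q = p * Q'" by (simp only: mult.commute)
  then show "r = Fract p Q" unfolding *(3) by (rule iffD2[OF eq_fract(1)[OF *(1) assms(1)]])
qed

section \<open>The specialization as a ring homomorphism\<close>

lemma F_exponent_superset:
  assumes "finite A" "keys a \<subseteq> A"
  shows "F_exponent a = (\<Sum>(i, j)\<in>A. single (i + 1) (lk a (i, j)) - single i (lk a (i, j)))"
  unfolding F_exponent_def using assms by (intro sum.mono_neutral_left) (auto simp: in_keys_iff)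

lemma F_exponent_add: "F_exponent (a + b) = F_exponent a + F_exponent b"
proof -
  let ?A = "keys a \<union> keys b"
  have "F_exponent (a + b) = (\<Sum>(i, j)\<in>?A. single (i + 1) (lk (a + b) (i, j)) - single i (lk (a + b) (i, j)))"
    by (rule F_exponent_superset) (use keys_add[of a b] in auto)
  moreover have "F_exponent a = (\<Sum>(i, j)\<in>?A. single (i + 1) (lk a (i, j)) - single i (lk a (i, j)))"
    by (rule F_exponent_superset) auto
  moreover have "F_exponent b = (\<Sum>(i, j)\<in>?A. single (i + 1) (lk b (i, j)) - single i (lk b (i, j)))"
    by (rule F_exponent_superset) auto
  ultimately show ?thesis
    by (simp add: lookup_add single_add case_prod_unfold add_diff_add flip: sum.distrib)
qed

lemma F_exponent_0 [simp]: "F_exponent 0 = 0"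
  by (simp add: F_exponent_def)

lemma F_laurent_superset:
  assumes "finite A" "keys p \<subseteq> A"
  shows "F_laurent p = (\<Sum>a\<in>A. single (F_exponent a) (lk p a))"
  unfolding F_laurent_def using assms by (intro sum.mono_neutral_left) (auto simp: in_keys_iff)

lemma F_laurent_add: "F_laurent (p + p') = F_laurent p + F_laurent p'"
proof -
  let ?A = "keys p \<union> keys p'"
  have "F_laurent (p + p') = (\<Sum>a\<in>?A. single (F_exponent a) (lk (p + p') a))"
    by (rule F_laurent_superset) (use keys_add[of p p'] in auto)
  moreover have "F_laurent p = (\<Sum>a\<in>?A. single (F_exponent a) (lk p a))"
    by (rule F_laurent_superset) auto
  moreover have "F_laurent p' = (\<Sum>a\<in>?A. single (F_exponent a) (lk p' a))"
    by (rule F_laurent_superset) auto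
  ultimately show ?thesis by (simp add: lookup_add single_add sum.distrib)
qed

lemma F_laurent_0 [simp]: "F_laurent 0 = 0"
  by (simp add: F_laurent_def)

lemma F_laurent_single [simp]: "F_laurent (single a c) = single (F_exponent a) c"
  by (subst F_laurent_superset[where A = "{a}"]) auto

lemma F_laurent_1 [simp]: "F_laurent 1 = 1"
  using F_laurent_single[of 0 1] by (simp del: F_laurent_single)

lemma F_laurent_mult: "F_laurent (p * p') = F_laurent p * F_laurent p'"
proof (induction p rule: poly_mapping_additive_induct)
  case (single m k)
  show ?case
    by (induction p' rule: poly_mapping_additive_induct)
      (auto simp: mult_single F_exponent_add F_laurent_add distrib_left)
qed (auto simp: F_laurent_add distrib_right)

lemma F_laurent_diff: "F_laurent (p - p') = F_laurent p - F_laurent p'"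
  using F_laurent_add[of "p - p'" p'] by (simp add: algebra_simps)

lemma F_laurent_prod: "F_laurent (\<Prod>i\<in>A. f i) = (\<Prod>i\<in>A. F_laurent (f i))"
  by (induction A rule: infinite_finite_induct) (auto simp: F_laurent_mult)

lemma F_spec_eq:
  assumes "F_laurent q \<noteq> 0"
  shows "F_spec (Fract p q) = Fract (F_laurent p) (F_laurent q)"
  unfolding F_spec_def
proof (rule the_equality)
  show "\<exists>p' q'. F_laurent q' \<noteq> 0 \<and> Fract p q = Fract p' q' \<and> Fract (F_laurent p) (F_laurent q) = Fract (F_laurent p') (F_laurent q')"
    by (intro exI[of _ p] exI[of _ q]) (use assms in simp)
  fix y assume "\<exists>p' q'. F_laurent q' \<noteq> 0 \<and> Fract p q = Fract p' q' \<and> y = Fract (F_laurent p') (F_laurent q')"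
  then obtain p' q' where *: "F_laurent q' \<noteq> 0" "Fract p q = Fract p' q'" "y = Fract (F_laurent p') (F_laurent q')" by blast
  have "q \<noteq> 0" "q' \<noteq> 0" using assms *(1) by auto
  then have "p * q' = p' * q" using *(2) by (simp add: eq_fract)
  then have "F_laurent p * F_laurent q' = F_laurent p' * F_laurent q" by (metis F_laurent_mult)
  then show "y = Fract (F_laurent p) (F_laurent q)" using * assms by (simp add: eq_fract)
qed

section \<open>The generic point in the field of rational functions\<close>

type_synonym rat_fun = "int laurent fract"

text \<open>Monomials become elements of the field, so that a specialized series can keep its
  original exponents as index and carry the specialized monomial in its values; no infinite sets of
  terms have to be collected.\<close>

definition mon :: "(int \<Rightarrow>\<^sub>0 int) \<Rightarrow> rat_fun" where
  "mon e = Fract (single e 1) 1"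

definition coef :: "int poly \<Rightarrow> rat_fun" where
  "coef c = Fract (single 0 c) 1"

definition xvar :: "int \<Rightarrow> rat_fun" where
  "xvar i = mon (single i 1)"

definition tvar :: rat_fun where
  "tvar = coef (monom 1 1)"

lemma mon_add: "mon (e + e') = mon e * mon e'"
  by (simp add: mon_def mult_single)

lemma mon_0 [simp]: "mon 0 = 1"
  by (simp add: mon_def One_fract_def)

lemma single_1_inject: "single e (1::int poly) = single e' 1 \<longleftrightarrow> e = e'"
  using keys_single[of e "1::int poly"] keys_single[of e' "1::int poly"] by (metis singleton_inject zero_neq_one)

lemma mon_eq_1_iff: "mon e = 1 \<longleftrightarrow> e = 0"
  using single_1_inject[of e 0] by (simp add: mon_def One_fract_def eq_fract)

lemma mon_neq_0 [simp]: "mon e \<noteq> 0"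
  using mon_add[of e "- e"] by auto

lemma mon_diff: "mon (e - e') = mon e / mon e'"
  using mon_add[of "e - e'" e'] by (simp add: field_simps)

lemma xvar_powi: "xvar i powi k = mon (single i k)"
proof -
  have nat: "xvar i ^ n = mon (single i (int n))" for n
  proof (induction n)
    case (Suc n)
    have "xvar i ^ Suc n = mon (single i 1 + single i (int n))"
      unfolding mon_add power_Suc Suc by (simp add: xvar_def)
    then show ?case by (simp flip: single_add)
  qed simp
  show ?thesis
  proof (cases "k \<ge> 0")
    case True
    then show ?thesis using nat[of "nat k"] by (simp add: power_int_def)
  next
    case False
    then have "xvar i powi k = inverse (mon (single i (- k)))"
      using nat[of "nat (- k)"] by (simp add: power_int_def power_inverse)
    also have "\<dots> = mon (single i k)"
      using mon_diff[of 0 "single i (- k)"] by (simp add: single_uminus divide_inverse)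
    finally show ?thesis .
  qed
qed

lemma mon_sum: "mon (\<Sum>i\<in>A. f i) = (\<Prod>i\<in>A. mon (f i))"
  by (induction A rule: infinite_finite_induct) (auto simp: mon_add)

lemma coef_add: "coef (c + d) = coef c + coef d" and coef_mult: "coef (c * d) = coef c * coef d"
  and coef_0 [simp]: "coef 0 = 0" and coef_1 [simp]: "coef 1 = 1" and coef_diff: "coef (c - d) = coef c - coef d"
  by (simp_all add: coef_def single_add single_diff mult_single Zero_fract_def One_fract_def)

lemma coef_inject: "coef c = coef d \<longleftrightarrow> c = d"
  by (simp add: coef_def eq_fract inj_eq[OF inj_single])

lemma coef_sum: "coef (\<Sum>i\<in>A. f i) = (\<Sum>i\<in>A. coef (f i))"
  by (induction A rule: infinite_finite_induct) (auto simp: coef_add)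

lemma coef_prod: "coef (\<Prod>i\<in>A. f i) = (\<Prod>i\<in>A. coef (f i))"
  by (induction A rule: infinite_finite_induct) (auto simp: coef_mult)

lemma coef_monom: "coef (monom 1 l) = tvar ^ l"
proof (induction l)
  case (Suc l)
  have "monom (1::int) (Suc l) = monom 1 1 * monom 1 l" by (simp add: mult_monom)
  then show ?case using Suc by (simp only: coef_mult tvar_def power_Suc)
qed (simp add: monom_0 pCons_one)

lemma generic_xvar: "generic tvar xvar"
  unfolding generic_def
proof (intro conjI allI impI)
  show "xvar i \<noteq> 0" for i by (simp add: xvar_def)
  show "xvar i \<noteq> tvar * xvar j" if "i \<noteq> j" for i j
  proof
    assume "xvar i = tvar * xvar j"
    then have eq: "single (single i (1::int)) (1 :: int poly) = single (single j 1) (monom 1 1)"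
      by (simp add: xvar_def tvar_def mon_def coef_def mult_single eq_fract)
    have "(single i 1 :: int \<Rightarrow>\<^sub>0 int) \<in> keys (single (single i 1) (1 :: int poly))" by simp
    then have "(single i 1 :: int \<Rightarrow>\<^sub>0 int) = single j 1" unfolding eq by (simp split: if_splits)
    then have "keys (single i (1::int)) = keys (single j (1::int))" by simp
    then show False using that by simp
  qed
  fix A :: "int set" and e :: "int \<Rightarrow> int" assume A: "finite A" "\<exists>i\<in>A. e i \<noteq> 0"
  have "(\<Prod>i\<in>A. xvar i powi e i) = mon (\<Sum>i\<in>A. single i (e i))"
    by (simp add: xvar_powi mon_sum)
  moreover have "(\<Sum>i\<in>A. single i (e i)) \<noteq> 0"
  proof
    assume 0: "(\<Sum>i\<in>A. single i (e i)) = 0"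
    obtain k where k: "k \<in> A" "e k \<noteq> 0" using A by auto
    have "lk (\<Sum>i\<in>A. single i (e i)) k = (\<Sum>i\<in>A. if i = k then e i else 0)"
      by (simp add: lookup_sum lookup_single when_def)
    then show False using 0 k A by simp
  qed
  ultimately show "(\<Prod>i\<in>A. xvar i powi e i) \<noteq> 1" by (simp add: mon_eq_1_iff)
qed

lemma mon_F_exponent:
  assumes "\<And>v. v \<notin> cells a n p q \<Longrightarrow> lk s v = 0"
  shows "mon (F_exponent s) = row_mon xvar a n p q s"
proof -
  have "F_exponent s = (\<Sum>(i, j)\<in>cells a n p q. single (i + 1) (lk s (i, j)) - single i (lk s (i, j)))"
    by (rule F_exponent_superset) (use assms in \<open>auto simp: in_keys_iff\<close>)
  then have "mon (F_exponent s) = (\<Prod>(i, j)\<in>cells a n p q. (xvar (i + 1) / xvar i) powi lk s (i, j))"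
    by (simp add: mon_sum mon_diff case_prod_unfold power_int_divide_distrib xvar_powi)
  also have "\<dots> = (\<Prod>i\<in>{a..n}. \<Prod>j\<in>{p i..q i}. (xvar (i + 1) / xvar i) powi lk s (i, j))"
    unfolding cells_def by (subst prod.Sigma) auto
  also have "\<dots> = row_mon xvar a n p q s"
    unfolding row_mon_def by (rule prod.cong[OF refl], rule prod_power_int) (simp add: xvar_def)
  finally show ?thesis .
qed

section \<open>Ordinary subgraphs as diagrams\<close>

lemma full_edgesD:
  assumes "(u, v) \<in> full_edges \<Gamma>"
  shows "u \<in> \<Gamma>" "v \<in> \<Gamma>"
    "fst v = fst u - 1 \<and> (snd v = snd u \<or> snd v = snd u + 1) \<or> fst u = fst v - 1 \<and> (snd u = snd v \<or> snd u = snd v + 1)"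
  using assms by (auto simp: full_edges_def R_edges_def Let_def)

text \<open>Induction on the length of a walk joining two vertices of row \<open>i\<close>. If the
  walk meets the row in between, it is split there. Otherwise it stays on one side, its inner part
  gives an interval in the adjacent row by induction, and one of the two closure rules fills in row
  \<open>i\<close>.\<close>

lemma path_row_interval:
  fixes f :: "nat \<Rightarrow> vertex"
  assumes down: "\<And>i j. (i, j) \<in> \<Gamma> \<Longrightarrow> (i, j + 1) \<in> \<Gamma> \<Longrightarrow> (i + 1, j) \<in> \<Gamma>"
    and up: "\<And>i j. i > a \<Longrightarrow> (i, j) \<in> \<Gamma> \<Longrightarrow> (i, j + 1) \<in> \<Gamma> \<Longrightarrow> (i - 1, j + 1) \<in> \<Gamma>"
    and top: "\<And>v. v \<in> \<Gamma> \<Longrightarrow> a \<le> fst v"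
    and "\<And>k. k < N \<Longrightarrow> (f k, f (Suc k)) \<in> full_edges \<Gamma>" "f 0 = (i, j0)" "f N = (i, j1)" "f 0 \<in> \<Gamma>" "j0 \<le> j" "j \<le> j1"
  shows "(i, j) \<in> \<Gamma>"
  using assms(4-)
proof (induction N arbitrary: f i j0 j1 j rule: less_induct)
  case (less N)
  note E = less.prems(1)
  have f\<Gamma>: "f k \<in> \<Gamma>" if "k \<le> N" for k
    using that less.prems(4) full_edgesD(2)[OF E[of "k - 1"]] by (cases k) auto
  consider "N = 0" | m where "0 < m" "m < N" "fst (f m) = i" | "N > 0" "\<And>m. 0 < m \<Longrightarrow> m < N \<Longrightarrow> fst (f m) \<noteq> i" by blast
  then show ?case
  proof cases
    case 1
    then show ?thesis using less.prems by auto
  next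
    case 2
    obtain jm where jm: "f m = (i, jm)" using 2(3) by (cases "f m") auto
    show ?thesis
    proof (cases "j \<le> jm")
      case True
      show ?thesis
        by (rule less.IH[of m f i j0 jm j]) (use 2 E less.prems jm True in auto)
    next
      case False
      show ?thesis
        by (rule less.IH[of "N - m" "\<lambda>k. f (m + k)" i jm j1 j]) (use 2 E less.prems jm False f\<Gamma>[of m] in auto)
    qed
  next
    case 3
    have "N \<noteq> 1" using full_edgesD(3)[OF E[of 0]] less.prems(2,3) by auto
    then have N: "N \<ge> 2" using 3(1) by simp
    obtain i1 c1 where f1: "f 1 = (i1, c1)" by (cases "f 1")
    obtain i2 c2 where f2: "f (N - 1) = (i2, c2)" by (cases "f (N - 1)")
    have e1: "i1 = i - 1 \<and> (c1 = j0 \<or> c1 = j0 + 1) \<or> i = i1 - 1 \<and> (j0 = c1 \<or> j0 = c1 + 1)"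
      using full_edgesD(3)[OF E[of 0]] less.prems(2) f1 N by auto
    have e2: "i = i2 - 1 \<and> (j1 = c2 \<or> j1 = c2 + 1) \<or> i2 = i - 1 \<and> (c2 = j1 \<or> c2 = j1 + 1)"
      using full_edgesD(3)[OF E[of "N - 1"]] less.prems(3) f2 N by auto
    \<comment> \<open>Rows change by one along an edge and row \<open>i\<close> is avoided, so the
      walk cannot change sides.\<close>
    have sg: "(fst (f m) > i \<longleftrightarrow> i1 > i)" if "1 \<le> m" "m < N" for m using that
    proof (induction m rule: dec_induct)
      case base
      then show ?case using f1 by simp
    next
      case (step m)
      have "fst (f m) \<noteq> i" "fst (f (Suc m)) \<noteq> i" using 3(2)[of m] 3(2)[of "Suc m"] step by auto
      moreover have "fst (f (Suc m)) = fst (f m) - 1 \<or> fst (f m) = fst (f (Suc m)) - 1"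
        using full_edgesD(3)[OF E[of m]] step by auto
      ultimately show ?case using step by auto
    qed
    have "1 \<le> N - 1" "N - 1 < N" using N by auto
    then have i12: "i2 = i1" using sg[of "N - 1"] f2 e1 e2 by auto
    have mid: "(i1, k) \<in> \<Gamma>" if "c1 \<le> k" "k \<le> c2" for k
      by (rule less.IH[of "N - 2" "\<lambda>k. f (Suc k)" i1 c1 c2 k]) (use N E f1 f2 i12 that f\<Gamma>[of 1] in \<open>auto simp: numeral_2_eq_2 Suc_diff_Suc\<close>)
    have ends: "(i, j0) \<in> \<Gamma>" "(i, j1) \<in> \<Gamma>" using less.prems(2-4) f\<Gamma>[of N] by auto
    show ?thesis
    proof (cases "j = j0 \<or> j = j1")
      case True
      then show ?thesis using ends by auto
    next
      case False
      then have j: "j0 < j" "j < j1" using less.prems by auto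
      show ?thesis
      proof (cases "i1 = i - 1")
        case True
        then have "(i - 1, j) \<in> \<Gamma>" "(i - 1, j + 1) \<in> \<Gamma>" using mid[of j] mid[of "j + 1"] e1 e2 i12 j by auto
        then show ?thesis using down[of "i - 1" j] by simp
      next
        case False
        then have "(i + 1, j - 1) \<in> \<Gamma>" "(i + 1, j - 1 + 1) \<in> \<Gamma>" using mid[of "j - 1"] mid[of j] e1 e2 i12 j by auto
        then show ?thesis using up[of "i + 1" "j - 1"] top[OF ends(1)] by simp
      qed
    qed
  qed
qed

lemma connected_rows:
  assumes "(u, v) \<in> (full_edges \<Gamma>)\<^sup>*" "u \<in> \<Gamma>"
  shows "v \<in> \<Gamma>" "fst u \<le> i \<Longrightarrow> i \<le> fst v \<Longrightarrow> \<exists>w\<in>\<Gamma>. fst w = i"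
    "fst u \<le> i \<Longrightarrow> i < fst v \<Longrightarrow> \<exists>x y. (x, y) \<in> full_edges \<Gamma> \<and> fst x = i \<and> fst y = i + 1"
proof -
  have "v \<in> \<Gamma> \<and> (fst u \<le> i \<and> i \<le> fst v \<longrightarrow> (\<exists>w\<in>\<Gamma>. fst w = i)) \<and>
    (fst u \<le> i \<and> i < fst v \<longrightarrow> (\<exists>x y. (x, y) \<in> full_edges \<Gamma> \<and> fst x = i \<and> fst y = i + 1))"
    using assms
  proof (induction rule: rtrancl_induct)
    case base
    then show ?case by force
  next
    case (step v w)
    note e = full_edgesD[OF step(2)]
    have f: "fst w = fst v - 1 \<or> fst w = fst v + 1" using e(3) by auto
    show ?case
    proof (intro conjI impI)
      show "w \<in> \<Gamma>" by (rule e(2))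
      assume i: "fst u \<le> i \<and> i \<le> fst w"
      show "\<exists>w\<in>\<Gamma>. fst w = i"
      proof (cases "i \<le> fst v")
        case False
        then have "i = fst w" using i f by auto
        then show ?thesis using e(2) by blast
      qed (use step i in auto)
    next
      assume i: "fst u \<le> i \<and> i < fst w"
      show "\<exists>x y. (x, y) \<in> full_edges \<Gamma> \<and> fst x = i \<and> fst y = i + 1"
      proof (cases "i < fst v")
        case False
        then have "fst v = i" "fst w = i + 1" using i f by auto
        then show ?thesis using step(2) by blast
      qed (use step i in auto)
    qed
  qed
  then show "v \<in> \<Gamma>" "fst u \<le> i \<Longrightarrow> i \<le> fst v \<Longrightarrow> \<exists>w\<in>\<Gamma>. fst w = i"
    "fst u \<le> i \<Longrightarrow> i < fst v \<Longrightarrow> \<exists>x y. (x, y) \<in> full_edges \<Gamma> \<and> fst x = i \<and> fst y = i + 1" by auto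
qed

text \<open>The first four conditions are the closure rules at the two ends of each row and are
  vacuous for single vertices; there the edge at \<open>j\<close> prevents the rows from lying too
  far apart.\<close>

lemma steps_of_adjacency:
  assumes "p < q \<longrightarrow> p' \<le> p \<and> p \<le> q'" "p < q \<longrightarrow> p' \<le> q - 1 \<and> q - 1 \<le> q'"
    "p' < q' \<longrightarrow> p \<le> p' + 1 \<and> p' + 1 \<le> q" "p' < q' \<longrightarrow> p \<le> q' \<and> q' \<le> q"
    "p' \<le> j" "j \<le> q'" "p \<le> j \<and> j \<le> q \<or> p \<le> j + 1 \<and> j + 1 \<le> q"
  shows "steps p q p' q'"
  unfolding steps_def using assms by presburger

lemma ordinary_diagram:
  assumes "ordinary \<Gamma>"
  obtains n p q where "diagram (top_row \<Gamma>) n p q" "cells (top_row \<Gamma>) n p q = \<Gamma>" "top_row \<Gamma> < n" "p (top_row \<Gamma>) \<le> q (top_row \<Gamma>)"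
proof -
  define a where "a = top_row \<Gamma>"
  define m where "m = Max (fst ` \<Gamma>)"
  have fin: "finite \<Gamma>" and ne: "\<Gamma> \<noteq> {}" and conn: "\<And>u v. u \<in> \<Gamma> \<Longrightarrow> v \<in> \<Gamma> \<Longrightarrow> (u, v) \<in> (full_edges \<Gamma>)\<^sup>*"
    and down: "\<And>i j. (i, j) \<in> \<Gamma> \<Longrightarrow> (i, j + 1) \<in> \<Gamma> \<Longrightarrow> (i + 1, j) \<in> \<Gamma>"
    and up: "\<And>i j. i > a \<Longrightarrow> (i, j) \<in> \<Gamma> \<Longrightarrow> (i, j + 1) \<in> \<Gamma> \<Longrightarrow> (i - 1, j + 1) \<in> \<Gamma>"
    using assms unfolding ordinary_def a_def by auto
  have top: "a \<le> fst v" "fst v \<le> m" if "v \<in> \<Gamma>" for v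
    using that fin by (auto simp: a_def m_def top_row_def)
  have "a \<in> fst ` \<Gamma>" "m \<in> fst ` \<Gamma>" using fin ne by (auto simp: a_def m_def top_row_def)
  then obtain u v where u: "u \<in> \<Gamma>" "fst u = a" and v: "v \<in> \<Gamma>" "fst v = m" by auto
  have am: "a \<le> m" using top[OF u(1)] u by simp
  define J where "J i = {j. (i, j) \<in> \<Gamma>}" for i
  have finJ: "finite (J i)" for i
    using finite_imageI[OF fin, of snd] by (rule finite_subset[rotated]) (force simp: J_def)
  have neJ: "J i \<noteq> {}" if "a \<le> i" "i \<le> m" for i
  proof -
    have "\<exists>w\<in>\<Gamma>. fst w = i" by (rule connected_rows(2)[OF conn[OF u(1) v(1)] u(1)]) (use u v that in auto)
    then show ?thesis by (force simp: J_def)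
  qed
  have J: "J i = {Min (J i)..Max (J i)}" "Min (J i) \<le> Max (J i)" if i: "a \<le> i" "i \<le> m" for i
  proof -
    have mem: "(i, Min (J i)) \<in> \<Gamma>" "(i, Max (J i)) \<in> \<Gamma>"
      using Min_in[OF finJ neJ[OF i]] Max_in[OF finJ neJ[OF i]] by (auto simp: J_def)
    obtain N where N: "((i, Min (J i)), (i, Max (J i))) \<in> full_edges \<Gamma> ^^ N"
      using conn[OF mem] by (auto dest: rtrancl_imp_relpow)
    then obtain f where f: "f 0 = (i, Min (J i))" "f N = (i, Max (J i))" "\<And>k. k < N \<Longrightarrow> (f k, f (Suc k)) \<in> full_edges \<Gamma>"
      by (auto simp: relpow_fun_conv)
    have f0: "f 0 \<in> \<Gamma>" using mem f by simp
    have "(i, j) \<in> \<Gamma>" if "Min (J i) \<le> j" "j \<le> Max (J i)" for j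
    proof (rule path_row_interval)
      show "(i + 1, j) \<in> \<Gamma>" if "(i, j) \<in> \<Gamma>" "(i, j + 1) \<in> \<Gamma>" for i j by (rule down[OF that])
      show "(i - 1, j + 1) \<in> \<Gamma>" if "a < i" "(i, j) \<in> \<Gamma>" "(i, j + 1) \<in> \<Gamma>" for i j by (rule up[OF that])
      show "a \<le> fst v" if "v \<in> \<Gamma>" for v by (rule top(1)[OF that])
      show "(f k, f (Suc k)) \<in> full_edges \<Gamma>" if "k < N" for k by (rule f(3)[OF that])
    qed (fact f f0 that)+
    note between = this
    show "J i = {Min (J i)..Max (J i)}"
    proof (intro equalityI subsetI)
      fix j assume "j \<in> J i"
      then show "j \<in> {Min (J i)..Max (J i)}" using Min_le[OF finJ] Max_ge[OF finJ] by simp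
    next
      fix j assume "j \<in> {Min (J i)..Max (J i)}"
      then have "(i, j) \<in> \<Gamma>" using between by simp
      then show "j \<in> J i" by (simp add: J_def)
    qed
    show "Min (J i) \<le> Max (J i)" using finJ neJ[OF i] by simp
  qed
  \<comment> \<open>Row \<open>m + 1\<close> is the added empty row, placed so that it follows the
    single vertex of row \<open>m\<close> by a shrinking step.\<close>
  define p where "p i = (if i \<le> m then Min (J i) else Min (J m))" for i
  define q where "q i = (if i \<le> m then Max (J i) else Min (J m) - 1)" for i
  have pq: "(i, j) \<in> \<Gamma> \<longleftrightarrow> p i \<le> j \<and> j \<le> q i" if "a \<le> i" "i \<le> m" for i j
  proof -
    have "(i, j) \<in> \<Gamma> \<longleftrightarrow> j \<in> J i" by (simp add: J_def)
    also have "\<dots> \<longleftrightarrow> j \<in> {Min (J i)..Max (J i)}" using J(1)[OF that] by simp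
    finally show ?thesis using that by (simp add: p_def q_def)
  qed
  have le: "p i \<le> q i" if "a \<le> i" "i \<le> m" for i using J(2)[OF that] that by (simp add: p_def q_def)
  \<comment> \<open>Two adjacent vertices in the last row would force a vertex below it.\<close>
  have last: "p m = q m"
  proof (rule ccontr)
    assume "p m \<noteq> q m"
    then have "(m, p m) \<in> \<Gamma>" "(m, p m + 1) \<in> \<Gamma>" using pq[of m] le[of m] am by auto
    then show False using down top(2) by fastforce
  qed
  have "steps (p i) (q i) (p (i + 1)) (q (i + 1))" if i: "a \<le> i" "i < m + 1" for i
  proof (cases "i = m")
    case True
    then show ?thesis using last by (simp add: steps_def p_def q_def)
  next
    case False
    then have i': "i < m" using i by simp
    obtain x y where xy: "(x, y) \<in> full_edges \<Gamma>" "fst x = i" "fst y = i + 1"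
      using connected_rows(3)[OF conn[OF u(1) v(1)] u(1), of i] u v i i' by auto
    define j where "j = snd y"
    have "(i + 1, j) \<in> \<Gamma>" using full_edgesD(2)[OF xy(1)] xy(3) by (cases y) (simp add: j_def)
    then have j1: "p (i + 1) \<le> j" "j \<le> q (i + 1)" using pq[of "i + 1" j] i i' by auto
    have "(i, j) \<in> \<Gamma> \<or> (i, j + 1) \<in> \<Gamma>" using full_edgesD(1,3)[OF xy(1)] xy(2,3) by (cases x) (auto simp: j_def)
    then have j2: "p i \<le> j \<and> j \<le> q i \<or> p i \<le> j + 1 \<and> j + 1 \<le> q i" using pq[of i] i i' by auto
    have A: "p (i + 1) \<le> k \<and> k \<le> q (i + 1)" if "p i \<le> k" "k + 1 \<le> q i" for k
      using down[of i k] pq[of i] pq[of "i + 1"] i i' that by auto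
    have B: "p i \<le> k + 1 \<and> k + 1 \<le> q i" if "p (i + 1) \<le> k" "k + 1 \<le> q (i + 1)" for k
      using up[of "i + 1" k] pq[of i] pq[of "i + 1"] i i' that by auto
    show ?thesis
      by (rule steps_of_adjacency[OF _ _ _ _ j1 j2])
        (use A[of "p i"] A[of "q i - 1"] B[of "p (i + 1)"] B[of "q (i + 1) - 1"] in auto)
  qed
  moreover have "p i \<le> q i + 1" if "a \<le> i" "i \<le> m + 1" for i
    using le[of i] that by (cases "i = m + 1") (auto simp: p_def q_def)
  ultimately have d: "diagram a (m + 1) p q" using am by (simp add: diagram_def) (simp add: p_def q_def)
  have "v \<in> cells a (m + 1) p q \<longleftrightarrow> v \<in> \<Gamma>" for v
  proof -
    obtain i j where v: "v = (i, j)" by (cases v)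
    show ?thesis
    proof (cases "a \<le> i \<and> i \<le> m")
      case True
      then show ?thesis using pq[of i j] by (auto simp: v mem_cells)
    next
      case False
      then show ?thesis using top[of v] by (auto simp: v mem_cells p_def q_def)
    qed
  qed
  then have "cells a (m + 1) p q = \<Gamma>" by blast
  then show thesis using d le[of a] am that[of "m + 1" p q] unfolding a_def by simp
qed

section \<open>Faces and components\<close>

lemma lookup_scaleR: "lk (r *\<^sub>R x) v = r * lk (x :: array) v"
proof -
  have "finite {i. r *\<^sub>R lk x i \<noteq> 0}"
    by (rule finite_subset[OF _ finite_lookup[of x]]) auto
  then show ?thesis by (simp add: scaleR_poly_mapping_def lookup_Abs_poly_mapping)
qed

lemma face_of_zero_set:
  fixes h :: "'a::real_vector \<Rightarrow> real"
  assumes "convex D" and add: "\<And>x y. h (x + y) = h x + h y" and scale: "\<And>r x. h (r *\<^sub>R x) = r * h x"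
    and nonneg: "\<And>x. x \<in> D \<Longrightarrow> h x \<ge> 0"
  shows "{x\<in>D. h x = 0} face_of D"
  unfolding face_of_def
proof (intro conjI ballI impI)
  show "convex {x\<in>D. h x = 0}"
    using assms(1) unfolding convex_def by (auto simp: add scale)
  fix a b x assume a: "a \<in> D" and b: "b \<in> D" and x: "x \<in> {x\<in>D. h x = 0}" and seg: "x \<in> open_segment a b"
  obtain u where u: "0 < u" "u < 1" "x = (1 - u) *\<^sub>R a + u *\<^sub>R b" using seg by (auto simp: in_segment)
  have eq: "(1 - u) * h a + u * h b = 0" using x u(3) by (simp add: add scale)
  have "(1 - u) * h a \<ge> 0" "u * h b \<ge> 0" using nonneg[OF a] nonneg[OF b] u by auto
  then have "(1 - u) * h a = 0" "u * h b = 0" using eq by linarith+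
  then show "a \<in> {x\<in>D. h x = 0}" "b \<in> {x\<in>D. h x = 0}" using a b u by auto
qed auto

lemma convex_D_poly: "convex (D_poly \<Gamma> bs)"
  unfolding convex_def
proof (intro ballI allI impI)
  fix x y :: array and u v :: real
  assume x: "x \<in> D_poly \<Gamma> bs" and y: "y \<in> D_poly \<Gamma> bs" and uv: "0 \<le> u" "0 \<le> v" "u + v = 1"
  have lk: "lk (u *\<^sub>R x + v *\<^sub>R y) w = u * lk x w + v * lk y w" for w
    by (simp add: lookup_add lookup_scaleR)
  let ?L = "sorted_list_of_set {j. (top_row \<Gamma>, j) \<in> \<Gamma>}"
  have "map (\<lambda>j. lk x (top_row \<Gamma>, j)) ?L = map (\<lambda>j. lk y (top_row \<Gamma>, j)) ?L"
    using x y by (simp add: D_poly_def)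
  then have "lk x (top_row \<Gamma>, j) = lk y (top_row \<Gamma>, j)" if "j \<in> set ?L" for j
    using that by simp
  then have "map (\<lambda>j. lk (u *\<^sub>R x + v *\<^sub>R y) (top_row \<Gamma>, j)) ?L = map (\<lambda>j. lk x (top_row \<Gamma>, j)) ?L"
    unfolding lk using uv(3) by (intro map_cong refl) (simp flip: distrib_right)
  also have "\<dots> = bs" using x by (simp add: D_poly_def)
  finally have m: "map (\<lambda>j. lk (u *\<^sub>R x + v *\<^sub>R y) (top_row \<Gamma>, j)) ?L = bs" .
  have "u * a + v * b \<le> u * c + v * d" if "a \<le> c" "b \<le> d" for a b c d
    using that uv by (intro add_mono mult_left_mono)
  then show "u *\<^sub>R x + v *\<^sub>R y \<in> D_poly \<Gamma> bs" using x y m unfolding D_poly_def mem_Collect_eq lk by simp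
qed

text \<open>Along an edge the difference of the two coordinates has constant sign on the polyhedron,
  so its vanishing cuts out a face. A point with equal coordinates therefore has its whole minimal
  face in there, and with it \<open>x\<close>.\<close>

lemma Delta_edges_minimal_face:
  assumes x: "x \<in> D_poly \<Gamma> bs"
  shows "Delta_edges \<Gamma> bs (minimal_face (D_poly \<Gamma> bs) x) = {(u, v) \<in> full_edges \<Gamma>. lk x u = lk x v}"
proof -
  let ?D = "D_poly \<Gamma> bs"
  have self: "y \<in> minimal_face ?D y" for y by (auto simp: minimal_face_def)
  have "lk x u = lk x v"
    if e: "(u, v) \<in> full_edges \<Gamma>" and y: "y \<in> ?D" "minimal_face ?D y = minimal_face ?D x" "lk y u = lk y v" for u v y
  proof -
    have face: "{s\<in>?D. lk s u = lk s v} face_of ?D"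
    proof -
      have "(\<forall>s\<in>?D. lk s u \<le> lk s v) \<or> (\<forall>s\<in>?D. lk s v \<le> lk s u)"
      proof -
        obtain i j i' j' where uv: "u = (i, j)" "v = (i', j')" by (cases u, cases v)
        have "u \<in> \<Gamma>" "v \<in> \<Gamma>" using full_edgesD[OF e] by auto
        moreover have "i' = i - 1 \<and> (j' = j \<or> j' = j + 1) \<or> i = i' - 1 \<and> (j = j' \<or> j = j' + 1)"
          using full_edgesD(3)[OF e] by (simp add: uv)
        ultimately show ?thesis unfolding uv D_poly_def by (elim disjE conjE) auto
      qed
      then show ?thesis
      proof
        assume "\<forall>s\<in>?D. lk s u \<le> lk s v"
        then show ?thesis using face_of_zero_set[OF convex_D_poly, of "\<lambda>s. lk s v - lk s u" \<Gamma> bs]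
          by (simp add: lookup_add lookup_scaleR algebra_simps eq_commute)
      next
        assume "\<forall>s\<in>?D. lk s v \<le> lk s u"
        then show ?thesis using face_of_zero_set[OF convex_D_poly, of "\<lambda>s. lk s u - lk s v" \<Gamma> bs]
          by (simp add: lookup_add lookup_scaleR algebra_simps)
      qed
    qed
    have "minimal_face ?D y \<subseteq> {s\<in>?D. lk s u = lk s v}"
      unfolding minimal_face_def using face y by blast
    then show ?thesis using self[of x] y(2) by auto
  qed
  then show ?thesis unfolding Delta_edges_def using x by blast
qed

lemma lookup_map_real: "lk (Poly_Mapping.map real_of_int s) v = real_of_int (lk s v)"
  by (simp add: map.rep_eq when_def)

lemma D_poly_diagram:
  assumes \<Gamma>: "cells a n p q = \<Gamma>" "top_row \<Gamma> = a" and an: "a < n" and n: "p n = q n + 1"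
    and bs: "length bs = nat (q a - p a + 1)"
  shows "Poly_Mapping.map real_of_int s \<in> D_poly \<Gamma> (map real_of_int bs) \<longleftrightarrow>
    (\<forall>v. v \<notin> \<Gamma> \<longrightarrow> lk s v = 0) \<and> (\<forall>j\<in>{p a..q a}. lk s (a, j) = bs ! nat (j - p a)) \<and>
    (\<forall>i\<in>{a..<n}. interlaced (p i) (q i) (p (i + 1)) (q (i + 1)) (\<lambda>j. lk s (i, j)) (\<lambda>j. lk s (i + 1, j)))"
proof -
  have mem: "(i, j) \<in> \<Gamma> \<longleftrightarrow> a \<le> i \<and> i \<le> n \<and> p i \<le> j \<and> j \<le> q i" for i j using mem_cells[of i j a n p q] \<Gamma> by simp
  have "{j. (a, j) \<in> \<Gamma>} = {p a..q a}" using an by (auto simp: mem)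
  moreover have "sorted_list_of_set {p a..q a} = [p a..q a]"
    by (rule sorted_distinct_set_unique) auto
  ultimately have L: "sorted_list_of_set {j. (a, j) \<in> \<Gamma>} = [p a..q a]" by simp
  have top: "map (\<lambda>j. real_of_int (lk s (a, j))) [p a..q a] = map real_of_int bs \<longleftrightarrow> (\<forall>j\<in>{p a..q a}. lk s (a, j) = bs ! nat (j - p a))"
    (is "?A \<longleftrightarrow> ?B")
  proof
    assume A: ?A
    show ?B
    proof
      fix j assume j: "j \<in> {p a..q a}"
      define k where "k = nat (j - p a)"
      have k: "k < nat (q a - p a + 1)" "j = p a + int k" using j by (auto simp: k_def)
      have "map (\<lambda>j. real_of_int (lk s (a, j))) [p a..q a] ! k = map real_of_int bs ! k" using A by simp
      then show "lk s (a, j) = bs ! nat (j - p a)" using k bs j by (simp add: nth_upto)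
    qed
  next
    assume B: ?B
    show ?A
    proof (rule nth_equalityI)
      fix k assume "k < length (map (\<lambda>j. real_of_int (lk s (a, j))) [p a..q a])"
      then have k: "k < nat (q a - p a + 1)" by simp
      then show "map (\<lambda>j. real_of_int (lk s (a, j))) [p a..q a] ! k = map real_of_int bs ! k"
        using B[rule_format, of "p a + int k"] bs by (simp add: nth_upto)
    qed (simp add: bs)
  qed
  have il: "(\<forall>i j. (i - 1, j) \<in> \<Gamma> \<and> (i, j) \<in> \<Gamma> \<longrightarrow> lk s (i, j) \<le> lk s (i - 1, j)) \<and>
      (\<forall>i j. (i, j) \<in> \<Gamma> \<and> (i - 1, j + 1) \<in> \<Gamma> \<longrightarrow> lk s (i - 1, j + 1) \<le> lk s (i, j)) \<longleftrightarrow>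
    (\<forall>i\<in>{a..<n}. interlaced (p i) (q i) (p (i + 1)) (q (i + 1)) (\<lambda>j. lk s (i, j)) (\<lambda>j. lk s (i + 1, j)))" (is "?A \<longleftrightarrow> ?B")
  proof
    assume A: ?A
    show ?B
    proof
      fix i assume i: "i \<in> {a..<n}"
      show "interlaced (p i) (q i) (p (i + 1)) (q (i + 1)) (\<lambda>j. lk s (i, j)) (\<lambda>j. lk s (i + 1, j))"
        unfolding interlaced_def
      proof (intro conjI allI impI)
        fix j assume "p i \<le> j \<and> j \<le> q i \<and> p (i + 1) \<le> j \<and> j \<le> q (i + 1)"
        then show "lk s (i + 1, j) \<le> lk s (i, j)" using A[THEN conjunct1, rule_format, of "i + 1" j] i by (auto simp: mem)
      next
        fix j assume "p (i + 1) \<le> j \<and> j \<le> q (i + 1) \<and> p i \<le> j + 1 \<and> j + 1 \<le> q i"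
        then show "lk s (i, j + 1) \<le> lk s (i + 1, j)" using A[THEN conjunct2, rule_format, of "i + 1" j] i by (auto simp: mem)
      qed
    qed
  next
    assume B: ?B
    have B1: "lk s (i + 1, j) \<le> lk s (i, j)" if "(i, j) \<in> \<Gamma>" "(i + 1, j) \<in> \<Gamma>" for i j
      using B[rule_format, of i] that by (auto simp: mem interlaced_def)
    have B2: "lk s (i, j + 1) \<le> lk s (i + 1, j)" if "(i, j + 1) \<in> \<Gamma>" "(i + 1, j) \<in> \<Gamma>" for i j
      using B[rule_format, of i] that by (auto simp: mem interlaced_def)
    show ?A
    proof (intro conjI allI impI)
      fix i j assume "(i - 1, j) \<in> \<Gamma> \<and> (i, j) \<in> \<Gamma>"
      then show "lk s (i, j) \<le> lk s (i - 1, j)" using B1[of "i - 1" j] by simp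
    next
      fix i j assume "(i, j) \<in> \<Gamma> \<and> (i - 1, j + 1) \<in> \<Gamma>"
      then show "lk s (i - 1, j + 1) \<le> lk s (i, j)" using B2[of "i - 1" j] by simp
    qed
  qed
  show ?thesis unfolding D_poly_def mem_Collect_eq lookup_map_real \<Gamma>(2) L top of_int_le_iff of_int_eq_0_iff il ..
qed

text \<open>Equal neighbours in a row squeeze the entry below and between them to the same value,
  and \<open>diagram\<close> ensures that this vertex exists; so a level is connected through the
  row below. For two consecutive rows, monotonicity leads to a squeezed entry adjacent to the given
  one.\<close>

lemma level_connected:
  assumes d: "diagram a n p q" and \<Gamma>: "cells a n p q = \<Gamma>"
    and il: "\<And>i. i \<in> {a..<n} \<Longrightarrow> interlaced (p i) (q i) (p (i + 1)) (q (i + 1)) (\<lambda>j. lk s (i, j)) (\<lambda>j. lk s (i + 1, j))"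
  defines "E \<equiv> {(u, v) \<in> full_edges \<Gamma>. lk s u = lk s v}"
  shows "(i, j) \<in> \<Gamma> \<Longrightarrow> (i, k) \<in> \<Gamma> \<Longrightarrow> lk s (i, j) = lk s (i, k) \<Longrightarrow> ((i, j), (i, k)) \<in> E\<^sup>*"
    and "(i + 1, j) \<in> \<Gamma> \<Longrightarrow> (i, k) \<in> \<Gamma> \<Longrightarrow> lk s (i + 1, j) = lk s (i, k) \<Longrightarrow> ((i + 1, j), (i, k)) \<in> E\<^sup>*"
proof -
  have mem: "(i, j) \<in> \<Gamma> \<longleftrightarrow> a \<le> i \<and> i \<le> n \<and> p i \<le> j \<and> j \<le> q i" for i j using mem_cells[of i j a n p q] \<Gamma> by simp
  have st: "steps (p i) (q i) (p (i + 1)) (q (i + 1))" if "a \<le> i" "i < n" for i using d that by (simp add: diagram_def)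
  have lt: "i < n" if "(i, j) \<in> \<Gamma>" for i j using that d by (cases "i = n") (auto simp: mem diagram_def)
  have symE: "sym E" unfolding sym_def E_def full_edges_def R_edges_def Let_def by auto
  have dec: "lk s (i, k) \<le> lk s (i, j)" if "(i, j) \<in> \<Gamma>" "(i, k) \<in> \<Gamma>" "j \<le> k" for i j k
  proof -
    have i: "a \<le> i" "i < n" using that(1) lt[OF that(1)] by (auto simp: mem)
    have "dec_on (p i) (q i) (\<lambda>j. lk s (i, j))" by (rule interlaced_dec(1)[OF st[OF i] il]) (use i in auto)
    then show ?thesis using that by (auto simp: dec_on_def mem)
  qed
  have E1: "((i + 1, j), (i, j)) \<in> E" if "(i, j) \<in> \<Gamma>" "(i + 1, j) \<in> \<Gamma>" "lk s (i + 1, j) = lk s (i, j)" for i j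
    using that by (auto simp: E_def full_edges_def R_edges_def Let_def)
  have E2: "((i + 1, j), (i, j + 1)) \<in> E" if "(i, j + 1) \<in> \<Gamma>" "(i + 1, j) \<in> \<Gamma>" "lk s (i + 1, j) = lk s (i, j + 1)" for i j
    using that by (auto simp: E_def full_edges_def R_edges_def Let_def)
  have le: "((i, j), (i, k)) \<in> E\<^sup>*" if jk: "j \<le> k" and "(i, j) \<in> \<Gamma>" "(i, k) \<in> \<Gamma>" "lk s (i, j) = lk s (i, k)" for i j k
    using that
  proof (induction k rule: int_ge_induct)
    case (step k)
    have i: "a \<le> i" "i < n" using step.prems lt[of i j] by (auto simp: mem)
    have k: "(i, k) \<in> \<Gamma>" using step by (auto simp: mem)
    have eq: "lk s (i, k) = lk s (i, j)" using dec[OF step.prems(1) k step.hyps] dec[OF k step.prems(2)] step.prems(3) by simp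
    have k1: "(i + 1, k) \<in> \<Gamma>" using st[OF i] step.prems k i by (auto simp: mem steps_def)
    have "lk s (i + 1, k) \<le> lk s (i, k)" "lk s (i, k + 1) \<le> lk s (i + 1, k)"
      using il[of i] i k k1 step.prems(2) by (auto simp: interlaced_def mem)
    then have eq1: "lk s (i + 1, k) = lk s (i, k)" "lk s (i + 1, k) = lk s (i, k + 1)" using eq step.prems(3) by auto
    have "((i, k), (i + 1, k)) \<in> E" using E1[OF k k1 eq1(1)] symE by (meson symD)
    moreover have "((i + 1, k), (i, k + 1)) \<in> E" by (rule E2[OF step.prems(2) k1 eq1(2)])
    moreover have "((i, j), (i, k)) \<in> E\<^sup>*" using step.IH step.prems(1) k eq by simp
    ultimately show ?case by (meson rtrancl.rtrancl_into_rtrancl)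
  qed simp
  have row: "((i, j), (i, k)) \<in> E\<^sup>*" if "(i, j) \<in> \<Gamma>" "(i, k) \<in> \<Gamma>" "lk s (i, j) = lk s (i, k)" for i j k
  proof (cases "j \<le> k")
    case False
    then have "((i, k), (i, j)) \<in> E\<^sup>*" using le[of k j i] that by simp
    then show ?thesis using sym_rtrancl[OF symE] by (meson symD)
  qed (use le that in blast)
  then show "(i, j) \<in> \<Gamma> \<Longrightarrow> (i, k) \<in> \<Gamma> \<Longrightarrow> lk s (i, j) = lk s (i, k) \<Longrightarrow> ((i, j), (i, k)) \<in> E\<^sup>*" .
  assume j: "(i + 1, j) \<in> \<Gamma>" and k: "(i, k) \<in> \<Gamma>" and eq: "lk s (i + 1, j) = lk s (i, k)"
  have i: "a \<le> i" "i < n" using k lt[OF k] by (auto simp: mem)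
  note I = il[of i, unfolded interlaced_def]
  show "((i + 1, j), (i, k)) \<in> E\<^sup>*"
  proof (cases "k \<le> j")
    case True
    have j': "(i, j) \<in> \<Gamma>" using st[OF i] j k True i by (auto simp: mem steps_def)
    have "lk s (i + 1, j) \<le> lk s (i, j)" using I i j j' by (auto simp: mem)
    then have "lk s (i, j) = lk s (i, k)" using dec[OF k j' True] eq by simp
    then have "((i + 1, j), (i, j)) \<in> E" "((i, j), (i, k)) \<in> E\<^sup>*" using E1[OF j' j] row[OF j' k] eq by auto
    then show ?thesis by (rule converse_rtrancl_into_rtrancl)
  next
    case False
    have j': "(i, j + 1) \<in> \<Gamma>" using st[OF i] j k False i by (auto simp: mem steps_def)
    have "lk s (i, j + 1) \<le> lk s (i + 1, j)" using I i j j' by (auto simp: mem)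
    then have "lk s (i, j + 1) = lk s (i, k)" using dec[OF j' k] False eq by simp
    then have "((i + 1, j), (i, j + 1)) \<in> E" "((i, j + 1), (i, k)) \<in> E\<^sup>*" using E2[OF j' j] row[OF j' k] eq by auto
    then show ?thesis by (rule converse_rtrancl_into_rtrancl)
  qed
qed

text \<open>By \<open>level_connected\<close> a component meets a row in a complete level, which
  turns its vertex counts into multiplicities of a value.\<close>

lemma component_rows:
  assumes d: "diagram a n p q" and \<Gamma>: "cells a n p q = \<Gamma>"
    and il: "\<And>i. i \<in> {a..<n} \<Longrightarrow> interlaced (p i) (q i) (p (i + 1)) (q (i + 1)) (\<lambda>j. lk s (i, j)) (\<lambda>j. lk s (i + 1, j))"
    and E: "E = {(u, v) \<in> full_edges \<Gamma>. lk s u = lk s v}"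
    and X: "X \<in> components \<Gamma> E" "(i, j) \<in> X"
  shows "v \<in> X \<Longrightarrow> lk s v = lk s (i, j)" "row X i = {i} \<times> {k\<in>{p i..q i}. lk s (i, k) = lk s (i, j)}"
    "i > a \<Longrightarrow> row X (i - 1) = {i - 1} \<times> {k\<in>{p (i - 1)..q (i - 1)}. lk s (i - 1, k) = lk s (i, j)}"
proof -
  have mem: "(i, j) \<in> \<Gamma> \<longleftrightarrow> a \<le> i \<and> i \<le> n \<and> p i \<le> j \<and> j \<le> q i" for i j using mem_cells[of i j a n p q] \<Gamma> by simp
  obtain u where u: "u \<in> \<Gamma>" "X = (E\<^sup>* \<inter> \<Gamma> \<times> \<Gamma>) `` {u}" using X(1) by (auto simp: components_def elim: quotientE)
  have XG: "X \<subseteq> \<Gamma>" using u by auto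
  have val: "lk s v = lk s w" if "(v, w) \<in> E\<^sup>*" for v w using that
    by (induction rule: rtrancl_induct) (auto simp: E)
  have val': "lk s v = lk s (i, j)" if "v \<in> X" for v
    using val[of u v] val[of u "(i, j)"] that X(2) u(2) by auto
  then show "v \<in> X \<Longrightarrow> lk s v = lk s (i, j)" .
  have ij: "(i, j) \<in> \<Gamma>" "(u, (i, j)) \<in> E\<^sup>*" using X(2) u by auto
  have inX: "w \<in> X" if "((i, j), w) \<in> E\<^sup>*" "w \<in> \<Gamma>" for w
    using that ij u by (auto intro: rtrancl_trans)
  show "row X i = {i} \<times> {k\<in>{p i..q i}. lk s (i, k) = lk s (i, j)}"
  proof (intro equalityI subsetI)
    fix v assume "v \<in> row X i"
    then obtain k where k: "v = (i, k)" "(i, k) \<in> X" by (cases v) (auto simp: row_def)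
    then show "v \<in> {i} \<times> {k\<in>{p i..q i}. lk s (i, k) = lk s (i, j)}"
      using val'[OF k(2)] XG by (auto simp: mem)
  next
    fix v assume "v \<in> {i} \<times> {k\<in>{p i..q i}. lk s (i, k) = lk s (i, j)}"
    then obtain k where k: "v = (i, k)" "(i, k) \<in> \<Gamma>" "lk s (i, k) = lk s (i, j)" using ij(1) by (auto simp: mem)
    have "((i, j), (i, k)) \<in> E\<^sup>*" unfolding E by (rule level_connected(1)[OF d \<Gamma> il]) (use ij k in auto)
    then show "v \<in> row X i" using inX[of v] k by (simp add: row_def)
  qed
  assume i: "i > a"
  show "row X (i - 1) = {i - 1} \<times> {k\<in>{p (i - 1)..q (i - 1)}. lk s (i - 1, k) = lk s (i, j)}"
  proof (intro equalityI subsetI)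
    fix v assume "v \<in> row X (i - 1)"
    then obtain k where k: "v = (i - 1, k)" "(i - 1, k) \<in> X" by (cases v) (auto simp: row_def)
    then show "v \<in> {i - 1} \<times> {k\<in>{p (i - 1)..q (i - 1)}. lk s (i - 1, k) = lk s (i, j)}"
      using val'[OF k(2)] XG by (auto simp: mem)
  next
    fix v assume "v \<in> {i - 1} \<times> {k\<in>{p (i - 1)..q (i - 1)}. lk s (i - 1, k) = lk s (i, j)}"
    then obtain k where k: "v = (i - 1, k)" "(i - 1, k) \<in> \<Gamma>" "lk s (i - 1, k) = lk s (i, j)" using ij(1) i by (auto simp: mem)
    have "((i - 1 + 1, j), (i - 1, k)) \<in> E\<^sup>*" unfolding E by (rule level_connected(2)[OF d \<Gamma> il]) (use ij k in auto)
    then show "v \<in> row X (i - 1)" using inX[of v] k by (simp add: row_def)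
  qed
qed

lemma component_of:
  assumes "E = {(u, v) \<in> full_edges \<Gamma>. lk s u = lk s v}" "v \<in> \<Gamma>"
  obtains X where "X \<in> components \<Gamma> E" "v \<in> X"
proof
  show "(E\<^sup>* \<inter> \<Gamma> \<times> \<Gamma>) `` {v} \<in> components \<Gamma> E" unfolding components_def using assms(2) by (rule quotientI)
  show "v \<in> (E\<^sup>* \<inter> \<Gamma> \<times> \<Gamma>) `` {v}" using assms(2) by auto
qed

lemma components_disjoint:
  assumes E: "E = {(u, v) \<in> full_edges \<Gamma>. lk s u = lk s v}"
    and "X \<in> components \<Gamma> E" "Y \<in> components \<Gamma> E" "v \<in> X" "v \<in> Y"
  shows "X = Y"
proof -
  have "sym E" unfolding sym_def E full_edges_def R_edges_def Let_def by auto
  then have "sym (E\<^sup>*)" by (rule sym_rtrancl)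
  then have "sym (E\<^sup>* \<inter> \<Gamma> \<times> \<Gamma>)" unfolding sym_def by blast
  then have "equiv \<Gamma> (E\<^sup>* \<inter> \<Gamma> \<times> \<Gamma>)"
    unfolding equiv_def refl_on_def trans_def by (auto intro: rtrancl_trans)
  then show ?thesis using assms(2-) unfolding components_def using quotient_disj by fastforce
qed

section \<open>The face weight as a product over rows\<close>

text \<open>A component that meets row \<open>i\<close> corresponds to exactly one value occurring
  there, so pairs of components and rows can be traded for pairs of rows and values. The same value
  may belong to several components, but not within one row.\<close>

lemma coef_face_weight:
  assumes d: "diagram a n p q" and \<Gamma>: "cells a n p q = \<Gamma>" "top_row \<Gamma> = a"
    and il: "\<And>i. i \<in> {a..<n} \<Longrightarrow> interlaced (p i) (q i) (p (i + 1)) (q (i + 1)) (\<lambda>j. lk s (i, j)) (\<lambda>j. lk s (i + 1, j))"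
    and Delta: "Delta_edges \<Gamma> b f = {(u, v) \<in> full_edges \<Gamma>. lk s u = lk s v}"
  shows "coef (face_weight \<Gamma> b f) = (\<Prod>i\<in>{a..<n}. pair_wt tvar (p i) (q i) (p (i + 1)) (q (i + 1)) (\<lambda>j. lk s (i, j)) (\<lambda>j. lk s (i + 1, j)))"
proof -
  define E where "E = Delta_edges \<Gamma> b f"
  have E: "E = {(u, v) \<in> full_edges \<Gamma>. lk s u = lk s v}" using Delta by (simp add: E_def)
  have mem: "(i, j) \<in> \<Gamma> \<longleftrightarrow> a \<le> i \<and> i \<le> n \<and> p i \<le> j \<and> j \<le> q i" for i j using mem_cells[of i j a n p q] \<Gamma> by simp
  have fin: "finite \<Gamma>" using \<Gamma>(1) finite_cells by metis
  define m where "m i c = card {j\<in>{p i..q i}. lk s (i, j) = c}" for i c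
  \<comment> \<open>All pairs that contribute to some exponent; their value of \<open>l\<close> is
    \<open>card (row X i)\<close>, which is at least \<open>1\<close>.\<close>
  define S where "S = {(X, i). X \<in> components \<Gamma> E \<and> i > a \<and> card (row X i) = card (row X (i - 1)) + 1}"
  define g where "g = (\<lambda>(X, i). card (row X i))"
  have sub: "X \<subseteq> \<Gamma>" if "X \<in> components \<Gamma> E" for X using that by (auto simp: components_def quotient_def)
  have rows: "\<exists>j. (i, j) \<in> X \<and> (i, j) \<in> \<Gamma> \<and> row X i = {i} \<times> {k\<in>{p i..q i}. lk s (i, k) = lk s (i, j)} \<and>
      card (row X i) = m i (lk s (i, j)) \<and> card (row X (i - 1)) = m (i - 1) (lk s (i, j)) \<and> lk s ` X = {lk s (i, j)}"
    if X: "X \<in> components \<Gamma> E" and i: "i > a" and ne: "row X i \<noteq> {}" for X i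
  proof -
    obtain j where j: "(i, j) \<in> X" using ne by (auto simp: row_def)
    note c = component_rows[OF d \<Gamma>(1) il E X j]
    have "row X i = {i} \<times> {k\<in>{p i..q i}. lk s (i, k) = lk s (i, j)}" by (rule c(2))
    moreover have "row X (i - 1) = {i - 1} \<times> {k\<in>{p (i - 1)..q (i - 1)}. lk s (i - 1, k) = lk s (i, j)}" by (rule c(3)) (use i in auto)
    moreover have "lk s v = lk s (i, j)" if "v \<in> X" for v by (rule c(1)) (use that in auto)
    then have "lk s ` X = {lk s (i, j)}" using j by blast
    moreover have "(i, j) \<in> \<Gamma>" using j sub[OF X] by auto
    ultimately show ?thesis using j by (intro exI[of _ j]) (simp add: m_def card_cartesian_product_singleton)
  qed
  have Sne: "row X i \<noteq> {}" if "(X, i) \<in> S" for X i using that by (auto simp: S_def)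
  have finS: "finite S"
  proof (rule finite_subset)
    show "S \<subseteq> Pow \<Gamma> \<times> fst ` \<Gamma>"
    proof
      fix z assume z: "z \<in> S"
      obtain X i where z': "z = (X, i)" by (cases z)
      have "X \<subseteq> \<Gamma>" using z sub by (auto simp: z' S_def)
      moreover obtain v where "v \<in> X" "fst v = i" using Sne z by (force simp: z' row_def)
      ultimately show "z \<in> Pow \<Gamma> \<times> fst ` \<Gamma>" by (auto simp: z')
    qed
    show "finite (Pow \<Gamma> \<times> fst ` \<Gamma>)" using fin by simp
  qed
  have gS: "g ` S \<subseteq> {1..card \<Gamma>}"
  proof
    fix l assume "l \<in> g ` S"
    then obtain X i where X: "(X, i) \<in> S" "l = card (row X i)" by (auto simp: g_def)
    have "row X i \<subseteq> \<Gamma>" using X sub by (auto simp: S_def row_def)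
    then have "l \<le> card \<Gamma>" unfolding X(2) using fin by (rule card_mono[rotated])
    then show "l \<in> {1..card \<Gamma>}" using X by (auto simp: S_def)
  qed
  have dc: "d_count \<Gamma> b f l = card {z\<in>S. g z = l}" if "l \<in> {1..card \<Gamma>}" for l
  proof -
    have "{(X, i). X \<in> components \<Gamma> E \<and> i > a \<and> card (row X (i - 1)) = l - 1 \<and> card (row X i) = l} = {z\<in>S. g z = l}"
      using that by (auto simp: S_def g_def)
    then show ?thesis by (simp add: d_count_def E_def \<Gamma>(2))
  qed
  have "coef (face_weight \<Gamma> b f) = (\<Prod>l = 1..card \<Gamma>. (1 - tvar ^ l) ^ card {z\<in>S. g z = l})"
  proof -
    have pow: "coef (c ^ k) = coef c ^ k" for c k by (induction k) (auto simp: coef_mult)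
    show ?thesis unfolding face_weight_def coef_prod
      by (rule prod.cong) (auto simp: dc pow coef_diff coef_monom)
  qed
  also have "\<dots> = (\<Prod>l = 1..card \<Gamma>. \<Prod>z\<in>{z\<in>S. g z = l}. 1 - tvar ^ g z)"
    by (rule prod.cong) auto
  also have "\<dots> = (\<Prod>z\<in>S. 1 - tvar ^ g z)" by (rule prod.group[OF finS _ gS]) simp
  also have "\<dots> = (\<Prod>(i, c)\<in>(SIGMA i:{a + 1..n}. {c\<in>(\<lambda>j. lk s (i, j)) ` {p i..q i}. m i c = m (i - 1) c + 1}). 1 - tvar ^ m i c)"
    (is "_ = (\<Prod>(i, c)\<in>?Y. _)")
  \<comment> \<open>A pair is sent to its row and the common value of its component. Two components
    with equal value in row \<open>i\<close> contain the same level of that row and hence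
    coincide.\<close>
  proof (rule sym, rule prod.reindex_cong[where l = "\<lambda>(X, i). (i, the_elem (lk s ` X))"])
    show "inj_on (\<lambda>(X, i). (i, the_elem (lk s ` X))) S"
    proof (rule inj_onI)
      fix z z' assume zS: "z \<in> S" "z' \<in> S"
        and zz: "(case z of (X, i) \<Rightarrow> (i, the_elem (lk s ` X))) = (case z' of (X, i) \<Rightarrow> (i, the_elem (lk s ` X)))"
      obtain X i X' where z: "z = (X, i)" "z' = (X', i)" using zz by (cases z, cases z') auto
      have 1: "(X, i) \<in> S" and 2: "(X', i) \<in> S" and eq: "the_elem (lk s ` X) = the_elem (lk s ` X')"
        using zS zz by (auto simp: z)
      have c: "X \<in> components \<Gamma> E" "X' \<in> components \<Gamma> E" "i > a" using 1 2 by (auto simp: S_def)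
      obtain j where j: "(i, j) \<in> X" "row X i = {i} \<times> {k\<in>{p i..q i}. lk s (i, k) = lk s (i, j)}" "lk s ` X = {lk s (i, j)}"
        using rows[OF c(1,3) Sne[OF 1]] by blast
      obtain j' where j': "(i, j') \<in> X'" "row X' i = {i} \<times> {k\<in>{p i..q i}. lk s (i, k) = lk s (i, j')}" "lk s ` X' = {lk s (i, j')}"
        using rows[OF c(2,3) Sne[OF 2]] by blast
      have "lk s (i, j) = lk s (i, j')" using eq j(3) j'(3) by simp
      then have eq': "row X i = row X' i" unfolding j(2) j'(2) by simp
      have "(i, j) \<in> row X i" using j(1) by (simp add: row_def)
      then have "(i, j) \<in> X'" unfolding eq' by (simp add: row_def)
      then show "z = z'" using components_disjoint[OF E c(1,2) j(1)] z by simp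
    qed
    show "?Y = (\<lambda>(X, i). (i, the_elem (lk s ` X))) ` S"
    proof (intro equalityI subsetI)
      fix y assume "y \<in> ?Y"
      then obtain i j where y: "y = (i, lk s (i, j))" "i \<in> {a + 1..n}" "j \<in> {p i..q i}" "m i (lk s (i, j)) = m (i - 1) (lk s (i, j)) + 1"
        by auto
      have "(i, j) \<in> \<Gamma>" using y by (auto simp: mem)
      then obtain X where X: "X \<in> components \<Gamma> E" "(i, j) \<in> X" using component_of[OF E] by blast
      have i: "i > a" using y by auto
      have ne: "row X i \<noteq> {}" using X by (auto simp: row_def)
      obtain j' where j': "card (row X i) = m i (lk s (i, j'))" "card (row X (i - 1)) = m (i - 1) (lk s (i, j'))" "lk s ` X = {lk s (i, j')}"
        using rows[OF X(1) i ne] by blast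
      have "lk s (i, j) = lk s (i, j')" using j'(3) X(2) by blast
      then have j'': "card (row X i) = m i (lk s (i, j))" "card (row X (i - 1)) = m (i - 1) (lk s (i, j))" "lk s ` X = {lk s (i, j)}"
        using j' by metis+
      then have "(X, i) \<in> S" "the_elem (lk s ` X) = lk s (i, j)" using X(1) i y(4) unfolding S_def by simp_all
      then show "y \<in> (\<lambda>(X, i). (i, the_elem (lk s ` X))) ` S" using y(1) by force
    next
      fix y assume "y \<in> (\<lambda>(X, i). (i, the_elem (lk s ` X))) ` S"
      then obtain X i where X: "(X, i) \<in> S" "y = (i, the_elem (lk s ` X))" by auto
      then have c: "X \<in> components \<Gamma> E" "i > a" "card (row X i) = card (row X (i - 1)) + 1" by (auto simp: S_def)
      obtain j where "(i, j) \<in> \<Gamma>" "card (row X i) = m i (lk s (i, j))" "card (row X (i - 1)) = m (i - 1) (lk s (i, j))" "lk s ` X = {lk s (i, j)}"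
        using rows[OF c(1,2) Sne[OF X(1)]] by blast
      then show "y \<in> ?Y" using c(2,3) X(2) by (auto simp: mem)
    qed
    fix z assume z: "z \<in> S"
    obtain X i where z': "z = (X, i)" by (cases z)
    have c: "X \<in> components \<Gamma> E" "i > a" using z by (auto simp: S_def z')
    obtain j where "card (row X i) = m i (lk s (i, j))" "lk s ` X = {lk s (i, j)}"
      using rows[OF c Sne[OF z[unfolded z']]] by blast
    then show "(case (case z of (X, i) \<Rightarrow> (i, the_elem (lk s ` X))) of (i, c) \<Rightarrow> 1 - tvar ^ m i c) = 1 - tvar ^ g z"
      by (simp add: z' g_def)
  qed
  also have "\<dots> = (\<Prod>i\<in>{a + 1..n}. \<Prod>c\<in>{c\<in>(\<lambda>j. lk s (i, j)) ` {p i..q i}. m i c = m (i - 1) c + 1}. 1 - tvar ^ m i c)"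
    by (rule prod.Sigma[symmetric]) auto
  also have "\<dots> = (\<Prod>i\<in>{a + 1..n}. \<Prod>c\<in>(\<lambda>j. lk s (i, j)) ` {p i..q i}. row_wt tvar (m (i - 1) c) (m i c))"
  proof (rule prod.cong[OF refl])
    fix i assume "i \<in> {a + 1..n}"
    have "(\<Prod>c\<in>(\<lambda>j. lk s (i, j)) ` {p i..q i}. row_wt tvar (m (i - 1) c) (m i c)) =
      (\<Prod>c\<in>{c\<in>(\<lambda>j. lk s (i, j)) ` {p i..q i}. m i c = m (i - 1) c + 1}. row_wt tvar (m (i - 1) c) (m i c))"
      by (rule prod.mono_neutral_right) (auto simp: row_wt_def)
    also have "\<dots> = (\<Prod>c\<in>{c\<in>(\<lambda>j. lk s (i, j)) ` {p i..q i}. m i c = m (i - 1) c + 1}. 1 - tvar ^ m i c)"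
      by (rule prod.cong[OF refl]) (simp add: row_wt_def)
    finally show "(\<Prod>c\<in>{c\<in>(\<lambda>j. lk s (i, j)) ` {p i..q i}. m i c = m (i - 1) c + 1}. 1 - tvar ^ m i c) =
      (\<Prod>c\<in>(\<lambda>j. lk s (i, j)) ` {p i..q i}. row_wt tvar (m (i - 1) c) (m i c))" by simp
  qed
  also have "\<dots> = (\<Prod>i\<in>{a..<n}. \<Prod>c\<in>(\<lambda>j. lk s (i + 1, j)) ` {p (i + 1)..q (i + 1)}. row_wt tvar (m i c) (m (i + 1) c))"
    by (rule prod.reindex_bij_witness[where i = "\<lambda>i. i + 1" and j = "\<lambda>i. i - 1"]) auto
  also have "\<dots> = (\<Prod>i\<in>{a..<n}. pair_wt tvar (p i) (q i) (p (i + 1)) (q (i + 1)) (\<lambda>j. lk s (i, j)) (\<lambda>j. lk s (i + 1, j)))"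
    by (rule prod.cong[OF refl]) (simp add: pair_wt_def il m_def)
  finally show ?thesis .
qed

lemma coef_weighted_series:
  assumes d: "diagram a n p q" and \<Gamma>: "cells a n p q = \<Gamma>" "top_row \<Gamma> = a" and an: "a < n"
    and bs: "length bs = nat (q a - p a + 1)"
  defines "b \<equiv> map real_of_int bs"
  shows "coef (weighted_series (face_weight \<Gamma> b) (D_poly \<Gamma> b) s) = diagram_wt tvar a n p q (\<lambda>j. bs ! nat (j - p a)) s"
proof -
  let ?x = "Poly_Mapping.map real_of_int s"
  have n: "p n = q n + 1" using d by (simp add: diagram_def)
  note D = D_poly_diagram[OF \<Gamma> an n bs, of s, folded b_def]
  show ?thesis
  proof (cases "?x \<in> D_poly \<Gamma> b")
    case True
    have "Delta_edges \<Gamma> b (minimal_face (D_poly \<Gamma> b) ?x) = {(u, v) \<in> full_edges \<Gamma>. lk s u = lk s v}"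
      using Delta_edges_minimal_face[OF True] by (simp add: lookup_map_real)
    then have "coef (face_weight \<Gamma> b (minimal_face (D_poly \<Gamma> b) ?x)) = (\<Prod>i\<in>{a..<n}. pair_wt tvar (p i) (q i) (p (i + 1)) (q (i + 1)) (\<lambda>j. lk s (i, j)) (\<lambda>j. lk s (i + 1, j)))"
      using True[unfolded D] by (intro coef_face_weight[OF d \<Gamma>]) auto
    then show ?thesis using True True[unfolded D] by (simp add: weighted_series_def Let_def diagram_wt_def \<Gamma>(1))
  next
    case False
    have "diagram_wt tvar a n p q (\<lambda>j. bs ! nat (j - p a)) s = 0"
    proof (cases "(\<forall>v. v \<notin> \<Gamma> \<longrightarrow> lk s v = 0) \<and> (\<forall>j\<in>{p a..q a}. lk s (a, j) = bs ! nat (j - p a))")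
      case True
      then obtain i where i: "i \<in> {a..<n}" "\<not> interlaced (p i) (q i) (p (i + 1)) (q (i + 1)) (\<lambda>j. lk s (i, j)) (\<lambda>j. lk s (i + 1, j))"
        using False[unfolded D] by blast
      then have "pair_wt tvar (p i) (q i) (p (i + 1)) (q (i + 1)) (\<lambda>j. lk s (i, j)) (\<lambda>j. lk s (i + 1, j)) = 0" by (simp add: pair_wt_def)
      then have "(\<Prod>i\<in>{a..<n}. pair_wt tvar (p i) (q i) (p (i + 1)) (q (i + 1)) (\<lambda>j. lk s (i, j)) (\<lambda>j. lk s (i + 1, j))) = 0"
        using i(1) by (intro prod_zero) auto
      then show ?thesis by (simp add: diagram_wt_def)
    next
      case False
      then show ?thesis unfolding diagram_wt_def \<Gamma>(1) by (rule if_not_P)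
    qed
    then show ?thesis using False by (simp add: weighted_series_def Let_def)
  qed
qed

lemma Fract_F_laurent:
  "Fract (F_laurent p) 1 = (\<Sum>y\<in>keys p. coef (lk p y) * mon (F_exponent y))"
proof -
  have add: "Fract (u + v) 1 = Fract u 1 + Fract v 1" for u v :: "int laurent" by simp
  have "Fract (\<Sum>y\<in>A. f y) 1 = (\<Sum>y\<in>A. Fract (f y) 1)" for A and f :: "(vertex \<Rightarrow>\<^sub>0 int) \<Rightarrow> int laurent"
    by (induction A rule: infinite_finite_induct) (auto simp: Zero_fract_def add simp del: add_fract)
  moreover have "Fract (single e c) 1 = coef c * mon e" for e c
    by (simp add: coef_def mon_def mult_single)
  ultimately show ?thesis by (simp add: F_laurent_def)
qed

theorem theorem8:
  fixes \<Gamma> :: "vertex set" and bs :: "int list"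
  assumes "ordinary \<Gamma>"
    and "\<exists>i\<ge>top_row \<Gamma>. card (row \<Gamma> (i + 1)) > card (row \<Gamma> i)"
    and "length bs = top_length \<Gamma>"
    and "sorted_wrt (\<ge>) bs"
  shows "psi \<Gamma> bs = 0"
proof -
  define a where "a = top_row \<Gamma>"
  obtain n p q where d: "diagram a n p q" and \<Gamma>: "cells a n p q = \<Gamma>" and an: "a < n" and pa: "p a \<le> q a"
    using ordinary_diagram[OF assms(1)] unfolding a_def by blast
  have top: "top_row \<Gamma> = a" by (simp add: a_def)
  have mem: "(i, j) \<in> \<Gamma> \<longleftrightarrow> a \<le> i \<and> i \<le> n \<and> p i \<le> j \<and> j \<le> q i" for i j using mem_cells[of i j a n p q] \<Gamma> by simp
  have card_row: "card (row \<Gamma> i) = (if a \<le> i \<and> i \<le> n then nat (q i - p i + 1) else 0)" for i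
  proof -
    have "row \<Gamma> i = (if a \<le> i \<and> i \<le> n then {i} \<times> {p i..q i} else {})" by (auto simp: row_def mem)
    then show ?thesis by (simp add: card_cartesian_product_singleton)
  qed
  have n: "p n = q n + 1" using d by (simp add: diagram_def)
  have bs: "length bs = nat (q a - p a + 1)" using assms(3) an by (simp add: top_length_def top card_row)
  obtain i where i: "a \<le> i" "card (row \<Gamma> (i + 1)) > card (row \<Gamma> i)" using assms(2) top by auto
  define r where "r = i + 1"
  have "i + 1 < n" using i n by (cases "i + 1 = n") (auto simp: card_row split: if_splits)
  then have r: "a < r" "r < n" using i by (auto simp: r_def)
  have "steps (p i) (q i) (p (i + 1)) (q (i + 1))" "p i \<le> q i + 1" using d r i by (auto simp: diagram_def r_def)
  \<comment> \<open>Of the four kinds of step only this one increases the length.\<close>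
  then have out: "p r = p (r - 1) - 1" "q r = q (r - 1)"
    using i r by (auto simp: steps_def card_row r_def)
  define b where "b = map real_of_int bs"
  define \<beta> where "\<beta> j = bs ! nat (j - p a)" for j
  define S where "S = weighted_series (face_weight \<Gamma> b) (D_poly \<Gamma> b)"
  have S: "coef (S s) = diagram_wt tvar a n p q \<beta> s" for s
    unfolding S_def b_def \<beta>_def by (rule coef_weighted_series[OF d \<Gamma> top an bs])
  define I where "I = cells a n p q - {a} \<times> UNIV"
  \<comment> \<open>A denominator before specialization. All factors \<omega> are \<open>1\<close>,
    as the bare weight is invariant under the shifts; the monomials reappear under
    \<open>F_laurent\<close> and keep the specialized denominator nonzero.\<close>
  define Q :: "vertex laurent" where "Q = subset_kernel (Pow I - {{}}) (\<lambda>_. 1)"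
  have "fsupp (conv Q S)" unfolding Q_def
  proof (rule diagram_kernel[OF d])
    show "lk s v = (if v \<in> cells a n p q then \<beta> (snd v) else 0)" if "S s \<noteq> 0" "v \<notin> I" for s v
    proof (rule diagram_wt_support)
      show "diagram_wt tvar a n p q \<beta> s \<noteq> 0" using that(1) S[of s] coef_inject[of "S s" 0] by auto
    qed (use that in \<open>simp add: I_def\<close>)
    show "S (s + ind U) = 1 * S s" if "diagram_wt tvar a n p q \<beta> (s + ind U) = diagram_wt tvar a n p q \<beta> s" for s U
      using that unfolding S[symmetric] coef_inject by simp
  qed (auto simp: I_def)
  then have fin: "finite {y. conv Q S y \<noteq> 0}" by (simp add: fsupp_def)
  define P :: "vertex laurent" where "P = Abs_poly_mapping (conv Q S)"
  have P: "lk P = conv Q S" unfolding P_def by (rule lookup_Abs_poly_mapping[OF fin])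
  have FQ: "F_laurent Q \<noteq> 0"
  proof -
    have "F_laurent (1 - single (ind U) 1) \<noteq> 0" if U: "U \<in> Pow I - {{}}" for U
    proof
      assume "F_laurent (1 - single (ind U) 1) = 0"
      then have "single (F_exponent (ind U)) (1 :: int poly) = single 0 1"
        by (simp add: F_laurent_diff)
      then have "F_exponent (ind U) = 0" by (simp only: single_1_inject)
      then have "mon (F_exponent (ind U)) = 1" by simp
      moreover have "finite U" "U \<subseteq> cells a n p q" using U finite_subset[of U "cells a n p q"] by (auto simp: I_def)
      then have "mon (F_exponent (ind U)) = row_mon xvar a n p q (ind U)"
        by (intro mon_F_exponent) (auto simp: lookup_ind)
      ultimately show False using row_mon_ind_neq_1[OF generic_xvar \<open>U \<subseteq> cells a n p q\<close> _ less_imp_le[OF an] n] U by auto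
    qed
    moreover have "finite (Pow I - {{}})" by (simp add: I_def)
    ultimately show ?thesis unfolding Q_def subset_kernel_def F_laurent_prod by simp
  qed
  then have Q0: "Q \<noteq> 0" by auto
  define g where "g = diagram_series tvar xvar a n p q \<beta>"
  have g: "g s = coef (S s) * mon (F_exponent s)" for s
  proof (cases "diagram_wt tvar a n p q \<beta> s = 0")
    case False
    then have "lk s v = 0" if "v \<notin> cells a n p q" for v using diagram_wt_support[OF False, of v] that by auto
    then have "mon (F_exponent s) = row_mon xvar a n p q s" by (rule mon_F_exponent)
    then show ?thesis by (simp add: g_def diagram_series_def S)
  qed (simp add: g_def diagram_series_def S)
  \<comment> \<open>The same denominator with its specialized monomials moved into the coefficients.
    Convolving \<open>g\<close> with it gives the terms of the numerator \<open>P\<close> with their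
    specialized monomials, and their sum is \<open>F_laurent P\<close>.\<close>
  define Q' where "Q' = Poly_Mapping.mapp (\<lambda>m c. coef c * mon (F_exponent m)) Q"
  have Q': "conv Q' g y = coef (conv Q S y) * mon (F_exponent y)" for y
  proof -
    have F: "mon (F_exponent m) * mon (F_exponent (y - m)) = mon (F_exponent y)" for m
      by (simp flip: mon_add F_exponent_add)
    have "conv Q' g y = (\<Sum>m\<in>keys Q. lk Q' m * g (y - m))"
      by (rule conv_superset) (auto simp: Q'_def keys_mapp_subset)
    also have "\<dots> = (\<Sum>m\<in>keys Q. coef (lk Q m * S (y - m)) * mon (F_exponent y))"
      by (rule sum.cong[OF refl]) (simp add: Q'_def lookup_mapp g coef_mult F mult_ac)
    also have "\<dots> = coef (conv Q S y) * mon (F_exponent y)"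
      by (simp add: conv_def coef_sum sum_distrib_right)
    finally show ?thesis .
  qed
  have "coef c = 0 \<longleftrightarrow> c = 0" for c using coef_inject[of c 0] by simp
  then have keys: "{y. conv Q' g y \<noteq> 0} = keys P"
    by (simp add: Q' set_eq_iff in_keys_iff P)
  then have "fsupp (conv Q' g)" by (simp add: fsupp_def)
  moreover have "reg g 0" unfolding g_def by (rule diagram_series_null[OF d generic_xvar r out])
  \<comment> \<open>The value \<open>0\<close> does not depend on the kernel, so it may be evaluated
    with \<open>Q'\<close>.\<close>
  ultimately have "tsum (conv Q' g) = 0" using reg_kernel[of g 0 Q'] by simp
  then have "Fract (F_laurent P) 1 = 0"
    unfolding Fract_F_laurent tsum_def keys by (simp add: Q' P)
  then have FP: "F_laurent P = 0" by (simp add: Zero_fract_def eq_fract)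
  have "psi \<Gamma> bs = F_spec (weighted_ipt (face_weight \<Gamma> b) (D_poly \<Gamma> b))" by (simp add: psi_def b_def Let_def)
  also have "\<dots> = F_spec (Fract P Q)"
    using weighted_ipt_eq[OF Q0, of "face_weight \<Gamma> b" "D_poly \<Gamma> b" P] P by (simp add: S_def)
  also have "\<dots> = Fract (F_laurent P) (F_laurent Q)" by (rule F_spec_eq[OF FQ])
  also have "\<dots> = 0" unfolding FP using FQ by (simp add: Zero_fract_def eq_fract)
  finally show ?thesis .
qed

end
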